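(* Let $m \geq 1$ be an integer and set $$q(m,n)= \left\lfloor\frac{(m+1)\binom{n+2}{2}}{m+n+1} \right\rfloor .$$ If $n$ is sufficiently large (i.e. for all integers $n \geq n_0$, for some $n_0$ depending on $m$), then the secant variety $\sigma_{s}(X_{m,n})$ has the expected dimension for $s = q(m,n)$.
   Context: We work over $\mathbb{C}$. For an irreducible non-singular variety $X\subset \mathbb{P}^N$ of dimension $d$ and $s\ge 1$, the $s$-th secant variety $\sigma_s(X)$ is the Zariski closure of the union of the linear spans of all $s$-tuples of points of $X$. Its expected dimension is $\min\{N, s(d+1)-1\}$; we say $\sigma_s(X)$ has the expected dimension if $\dim\sigma_s(X)$ equals this number. $X_{m,n}$ denotes the Segre-Veronese variety $\mathbb{P}^m\times\mathbb{P}^n$ embedded in $\mathbb{P}^{(m+1)\binom{n+2}{2}-1}$ by the morphism given by $\mathcal{O}(1,2)$; it has dimension $m+n$. *)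

theory Defs
  imports
    "HOL-Analysis.Abstract_Topology"
    "HOL-Library.Extended_Nat"
    "HOL-Library.Function_Algebras"
    "HOL-Library.FuncSet"
begin

text \<open>
  The dimension of the projective spaces varies, so homogeneous coordinates are indexed by a finite
  set \<open>I\<close> (giving a projective space of dimension \<open>card I - 1\<close>), and coordinate
  vectors are functions vanishing outside \<open>I\<close>.
\<close>

global_interpretation cfun: vector_space "\<lambda>(c::complex) (v::'b \<Rightarrow> complex) b. c * v b"
  by unfold_locales (auto simp: fun_eq_iff algebra_simps)

definition coord_space :: "'i set \<Rightarrow> ('i \<Rightarrow> complex) set" where
  "coord_space I = {x. \<forall>i. i \<notin> I \<longrightarrow> x i = 0}"

text \<open>A point of projective space is the set of all its vectors of homogeneous coordinates.\<close>

definition proj_point :: "('i \<Rightarrow> complex) \<Rightarrow> ('i \<Rightarrow> complex) set" where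
  "proj_point x = {\<lambda>i. c * x i | c. c \<noteq> 0}"

definition proj_space :: "'i set \<Rightarrow> ('i \<Rightarrow> complex) set set" where
  "proj_space I = proj_point ` (coord_space I - {\<lambda>_. 0})"

definition monomial :: "'i set \<Rightarrow> ('i \<Rightarrow> nat) \<Rightarrow> ('i \<Rightarrow> complex) \<Rightarrow> complex" where
  "monomial I e x = (\<Prod>i\<in>I. x i ^ e i)"

text \<open>Homogeneous polynomials of degree \<open>d\<close>, identified with the functions they define
  (the ground field being infinite).\<close>

definition forms :: "'i set \<Rightarrow> nat \<Rightarrow> (('i \<Rightarrow> complex) \<Rightarrow> complex) set" where
  "forms I d = cfun.span (monomial I ` {e. sum e I = d})"

definition zero_locus ::
  "'i set \<Rightarrow> (('i \<Rightarrow> complex) \<Rightarrow> complex) set \<Rightarrow> ('i \<Rightarrow> complex) set set" where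
  "zero_locus I F = {p \<in> proj_space I. \<forall>f\<in>F. \<forall>x\<in>p. f x = 0}"

definition zariski_closed :: "'i set \<Rightarrow> ('i \<Rightarrow> complex) set set \<Rightarrow> bool" where
  "zariski_closed I S \<longleftrightarrow> (\<exists>F \<subseteq> (\<Union>d. forms I d). S = zero_locus I F)"

definition zariski :: "'i set \<Rightarrow> ('i \<Rightarrow> complex) set topology" where
  "zariski I = topology (\<lambda>U. U \<subseteq> proj_space I \<and> zariski_closed I (proj_space I - U))"

lemma monomial_mult: "monomial I e x * monomial I e' x = monomial I (e + e') x"
  by (simp add: monomial_def power_add prod.distrib)

lemma monomial_mult_forms:
  assumes "g \<in> forms I d'" "sum e I = d"
  shows "(\<lambda>x. monomial I e x * g x) \<in> forms I (d + d')"
  using assms(1) unfolding forms_def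
proof (induction rule: cfun.span_induct_alt)
  case base
  show ?case using cfun.span_zero by (simp add: zero_fun_def)
next
  case (step c h g)
  then obtain e' where e': "h = monomial I e'" "sum e' I = d'" by auto
  have "monomial I (e + e') \<in> monomial I ` {e. sum e I = d + d'}"
    using e' assms(2) by (auto simp: sum.distrib)
  then have "(\<lambda>x. c * monomial I (e + e') x) + (\<lambda>x. monomial I e x * g x)
      \<in> cfun.span (monomial I ` {e. sum e I = d + d'})"
    using step(2) by (rule cfun.span_add[OF cfun.span_scale[OF cfun.span_base]])
  moreover have "(\<lambda>x. c * monomial I (e + e') x) + (\<lambda>x. monomial I e x * g x)
      = (\<lambda>x. monomial I e x * ((\<lambda>x. c * h x) + g) x)"
    by (auto simp: fun_eq_iff e' algebra_simps monomial_mult[symmetric])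
  ultimately show ?case by simp
qed

lemma mult_forms:
  assumes "f \<in> forms I d" "g \<in> forms I d'"
  shows "(\<lambda>x. f x * g x) \<in> forms I (d + d')"
  using assms(1) unfolding forms_def[of I d]
proof (induction rule: cfun.span_induct_alt)
  case base
  show ?case using cfun.span_zero by (simp add: forms_def zero_fun_def)
next
  case (step c h f)
  then obtain e where e: "h = monomial I e" "sum e I = d" by auto
  have "(\<lambda>x. c * (monomial I e x * g x)) + (\<lambda>x. f x * g x) \<in> forms I (d + d')"
    using step monomial_mult_forms[OF assms(2) e(2)] unfolding forms_def
    by (intro cfun.span_add cfun.span_scale)
  moreover have "(\<lambda>x. c * (monomial I e x * g x)) + (\<lambda>x. f x * g x)
      = (\<lambda>x. ((\<lambda>x. c * h x) + f) x * g x)"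
    by (auto simp: fun_eq_iff e algebra_simps)
  ultimately show ?case by simp
qed

lemma form_scale:
  assumes "f \<in> forms I d"
  shows "f (\<lambda>i. c * x i) = c ^ d * f x"
  using assms unfolding forms_def
  by (induction rule: cfun.span_induct_alt)
     (auto simp: monomial_def power_mult_distrib prod.distrib power_sum algebra_simps)

lemma form_vanishes_on_point:
  assumes "f \<in> forms I d" "p \<in> proj_space I" "x \<in> p" "y \<in> p" "f x = 0"
  shows "f y = 0"
proof -
  obtain z where z: "p = proj_point z" using assms(2) by (auto simp: proj_space_def)
  obtain a b where ab: "x = (\<lambda>i. a * z i)" "y = (\<lambda>i. b * z i)" "a \<noteq> 0" "b \<noteq> 0"
    using assms(3,4) by (auto simp: z proj_point_def)
  then have "a ^ d * f z = 0" using form_scale[OF assms(1), of a z] assms(5) by simp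
  then show ?thesis using ab form_scale[OF assms(1), of b z] by simp
qed

lemma zariski_closed_Un:
  assumes "zariski_closed I S" "zariski_closed I T"
  shows "zariski_closed I (S \<union> T)"
proof -
  obtain F G where F: "F \<subseteq> (\<Union>d. forms I d)" "S = zero_locus I F"
    and G: "G \<subseteq> (\<Union>d. forms I d)" "T = zero_locus I G"
    using assms unfolding zariski_closed_def by blast
  define H where "H = {\<lambda>x. f x * g x | f g. f \<in> F \<and> g \<in> G}"
  have "H \<subseteq> (\<Union>d. forms I d)"
  proof
    fix h assume "h \<in> H"
    then obtain f g where h: "h = (\<lambda>x. f x * g x)" and fg: "f \<in> F" "g \<in> G"
      unfolding H_def by blast
    obtain d d' where "f \<in> forms I d" "g \<in> forms I d'" using fg F(1) G(1) by blast
    from mult_forms[OF this] show "h \<in> (\<Union>d. forms I d)" unfolding h by (rule UN_I[OF UNIV_I])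
  qed
  moreover have "S \<union> T = zero_locus I H"
  proof (intro equalityI subsetI)
    fix p assume "p \<in> S \<union> T"
    then show "p \<in> zero_locus I H" unfolding F(2) G(2) zero_locus_def H_def
      by (elim UnE; clarsimp)
  next
    fix p assume p: "p \<in> zero_locus I H"
    then have P: "p \<in> proj_space I" by (simp add: zero_locus_def)
    show "p \<in> S \<union> T"
    proof (rule ccontr)
      assume "p \<notin> S \<union> T"
      then obtain f x g y where fg: "f \<in> F" "x \<in> p" "f x \<noteq> 0" "g \<in> G" "y \<in> p" "g y \<noteq> 0"
        using P unfolding F(2) G(2) zero_locus_def by blast
      obtain d where "g \<in> forms I d" using fg G(1) by blast
      then have "g x \<noteq> 0" using form_vanishes_on_point[OF _ P, of g d x y] fg by blast
      moreover have "(\<lambda>x. f x * g x) \<in> H" using fg unfolding H_def by blast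
      with p have "\<forall>x\<in>p. f x * g x = 0" unfolding zero_locus_def by fast
      then have "f x * g x = 0" using fg(2) by (rule bspec)
      ultimately show False using fg by simp
    qed
  qed
  ultimately show ?thesis unfolding zariski_closed_def by blast
qed

lemma zariski_closed_INT:
  assumes "\<And>S. S \<in> \<S> \<Longrightarrow> zariski_closed I S"
  shows "zariski_closed I (proj_space I \<inter> \<Inter>\<S>)"
proof -
  define F where "F = {f \<in> (\<Union>d. forms I d). \<exists>S\<in>\<S>. \<forall>p\<in>S. \<forall>x\<in>p. f x = 0}"
  have mem: "p \<in> S" if p: "p \<in> zero_locus I F" and S: "S \<in> \<S>" for p S
  proof -
    obtain G where G: "G \<subseteq> (\<Union>d. forms I d)" "S = zero_locus I G"
      using assms[OF S] by (auto simp: zariski_closed_def)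
    have "G \<subseteq> F"
    proof
      fix g assume "g \<in> G"
      then have "\<forall>p\<in>S. \<forall>x\<in>p. g x = 0" using G(2) by (simp add: zero_locus_def)
      then show "g \<in> F" using G(1) \<open>g \<in> G\<close> S unfolding F_def by blast
    qed
    then show ?thesis using p unfolding G(2) zero_locus_def by blast
  qed
  have "proj_space I \<inter> \<Inter>\<S> = zero_locus I F"
  proof (intro equalityI subsetI)
    fix p assume "p \<in> proj_space I \<inter> \<Inter>\<S>"
    then show "p \<in> zero_locus I F" unfolding zero_locus_def F_def by blast
  next
    fix p assume p: "p \<in> zero_locus I F"
    then have "p \<in> proj_space I" by (simp add: zero_locus_def)
    then show "p \<in> proj_space I \<inter> \<Inter>\<S>"
      using mem[OF p] by blast
  qed
  moreover have "F \<subseteq> (\<Union>d. forms I d)" unfolding F_def by blast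
  ultimately show ?thesis unfolding zariski_closed_def by blast
qed

lemma zariski_closed_empty: "zariski_closed I {}"
proof -
  have "monomial I (\<lambda>_. 0) \<in> forms I 0"
    unfolding forms_def by (intro cfun.span_base) auto
  moreover have "zero_locus I {monomial I (\<lambda>_. 0)} = {}"
    by (auto simp: zero_locus_def monomial_def proj_space_def proj_point_def intro: exI[of _ 1])
  ultimately show ?thesis
    unfolding zariski_closed_def
    by (metis UN_iff UNIV_I empty_subsetI insert_subset)
qed

lemma istopology_zariski:
  "istopology (\<lambda>U. U \<subseteq> proj_space I \<and> zariski_closed I (proj_space I - U))"
  unfolding istopology_def
proof (intro conjI allI impI)
  fix S T
  assume "S \<subseteq> proj_space I \<and> zariski_closed I (proj_space I - S)"
    and "T \<subseteq> proj_space I \<and> zariski_closed I (proj_space I - T)"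
  then show "S \<inter> T \<subseteq> proj_space I" "zariski_closed I (proj_space I - S \<inter> T)"
    using zariski_closed_Un by (auto simp: Diff_Int)
next
  fix K assume K: "\<forall>U\<in>K. U \<subseteq> proj_space I \<and> zariski_closed I (proj_space I - U)"
  then show "\<Union>K \<subseteq> proj_space I" by blast
  have "proj_space I - \<Union>K = proj_space I \<inter> \<Inter>((\<lambda>U. proj_space I - U) ` K)" by blast
  then show "zariski_closed I (proj_space I - \<Union>K)"
    using zariski_closed_INT[of "(\<lambda>U. proj_space I - U) ` K" I] K
    by (metis (no_types, lifting) imageE)
qed

lemma openin_zariski:
  "openin (zariski I) U \<longleftrightarrow> U \<subseteq> proj_space I \<and> zariski_closed I (proj_space I - U)"
  by (simp add: zariski_def topology_inverse'[OF istopology_zariski])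

lemma topspace_zariski: "topspace (zariski I) = proj_space I"
proof -
  have "openin (zariski I) (proj_space I)"
    by (simp add: openin_zariski zariski_closed_empty)
  then show ?thesis by (metis openin_subset openin_topspace openin_zariski subset_antisym)
qed

lemma closedin_zariski: "closedin (zariski I) S \<longleftrightarrow> zariski_closed I S"
proof -
  have "S \<subseteq> proj_space I" if "zariski_closed I S"
    using that by (auto simp: zariski_closed_def zero_locus_def)
  then show ?thesis
    by (auto simp: closedin_def topspace_zariski openin_zariski double_diff)
qed

definition irreducible_space :: "'a topology \<Rightarrow> bool" where
  "irreducible_space T \<longleftrightarrow> topspace T \<noteq> {} \<and>
    (\<forall>A B. closedin T A \<and> closedin T B \<and> A \<union> B = topspace T
      \<longrightarrow> A = topspace T \<or> B = topspace T)"

text \<open>Krull dimension: the supremum of the lengths \<open>k\<close> of chains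
  \<open>Z 0 \<subset> \<dots> \<subset> Z k\<close> of irreducible closed subsets.
  The empty space gets dimension \<open>0\<close> here.\<close>

definition krull_dim :: "'a topology \<Rightarrow> enat" where
  "krull_dim T = Sup {enat k | k. \<exists>Z.
     (\<forall>i\<le>k. closedin T (Z i) \<and> irreducible_space (subtopology T (Z i))) \<and>
     (\<forall>i<k. Z i \<subset> Z (Suc i))}"

definition proj_dim :: "'i set \<Rightarrow> ('i \<Rightarrow> complex) set set \<Rightarrow> enat" where
  "proj_dim I S = krull_dim (subtopology (zariski I) S)"

definition linear_span :: "'i set \<Rightarrow> ('i \<Rightarrow> complex) set set \<Rightarrow> ('i \<Rightarrow> complex) set set" where
  "linear_span I S = {p \<in> proj_space I. p \<subseteq> cfun.span (\<Union>S)}"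

definition secant_variety ::
  "'i set \<Rightarrow> nat \<Rightarrow> ('i \<Rightarrow> complex) set set \<Rightarrow> ('i \<Rightarrow> complex) set set" where
  "secant_variety I s X =
     zariski I closure_of (\<Union>p \<in> {..<s} \<rightarrow> X. linear_span I (p ` {..<s}))"

definition expected_secant_dim :: "'i set \<Rightarrow> nat \<Rightarrow> ('i \<Rightarrow> complex) set set \<Rightarrow> enat" where
  "expected_secant_dim I s X = min (enat (card I - 1)) (enat s * (proj_dim I X + 1) - 1)"

definition has_expected_secant_dim :: "'i set \<Rightarrow> nat \<Rightarrow> ('i \<Rightarrow> complex) set set \<Rightarrow> bool" where
  "has_expected_secant_dim I s X \<longleftrightarrow>
     proj_dim I (secant_variety I s X) = expected_secant_dim I s X"

text \<open>The index \<open>(i, j, k)\<close> with \<open>j \<le> k\<close> stands for the monomial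
  \<open>x\<^sub>i y\<^sub>j y\<^sub>k\<close>; these form a basis of the global sections of \<open>O(1,2)\<close>.\<close>

definition sv_index :: "nat \<Rightarrow> nat \<Rightarrow> (nat \<times> nat \<times> nat) set" where
  "sv_index m n = {(i, j, k). i \<le> m \<and> j \<le> k \<and> k \<le> n}"

definition sv_map :: "nat \<Rightarrow> nat \<Rightarrow> (nat \<Rightarrow> complex) \<Rightarrow> (nat \<Rightarrow> complex) \<Rightarrow> nat \<times> nat \<times> nat \<Rightarrow> complex"
  where "sv_map m n x y = (\<lambda>(i, j, k). if (i, j, k) \<in> sv_index m n then x i * y j * y k else 0)"

definition segre_veronese :: "nat \<Rightarrow> nat \<Rightarrow> (nat \<times> nat \<times> nat \<Rightarrow> complex) set set" where
  "segre_veronese m n =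
     {proj_point (sv_map m n x y) | x y.
        proj_point x \<in> proj_space {..m} \<and> proj_point y \<in> proj_space {..n}}"

lemma card_sv_index: "card (sv_index m n) = (m + 1) * ((n + 2) choose 2)"
proof -
  define h :: "nat \<times> nat \<times> nat \<Rightarrow> nat \<times> nat \<times> nat" where "h = (\<lambda>(i, k, j). (i, j, k))"
  have "bij_betw h ({..m} \<times> (SIGMA k:{..n}. {..k})) (sv_index m n)"
    by (rule bij_betw_byWitness[where f' = h]) (auto simp: h_def sv_index_def)
  then have "card (sv_index m n) = card ({..m} \<times> (SIGMA k:{..n}. {..k}))"
    by (metis bij_betw_same_card)
  also have "\<dots> = (m + 1) * (\<Sum>k\<le>n. Suc k)"
    by (simp only: card_cartesian_product card_SigmaI finite_atMost ball_simps card_atMost) simp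
  also have "(\<Sum>k\<le>n. Suc k) = (n + 2) choose 2"
    by (induction n) (simp_all add: choose_two numeral_2_eq_2)
  finally show ?thesis .
qed

lemma segre_veronese_subset: "segre_veronese m n \<subseteq> proj_space (sv_index m n)"
proof
  fix p assume "p \<in> segre_veronese m n"
  then obtain x y where p: "p = proj_point (sv_map m n x y)"
    and "proj_point x \<in> proj_space {..m}" "proj_point y \<in> proj_space {..n}"
    unfolding segre_veronese_def by blast
  have nz: "\<exists>i\<le>l. z i \<noteq> 0" if z: "proj_point z \<in> proj_space {..l}" for z :: "nat \<Rightarrow> complex" and l
  proof -
    obtain w where w: "w \<in> coord_space {..l}" "w \<noteq> (\<lambda>_. 0)" "proj_point z = proj_point w"
      using z unfolding proj_space_def by blast
    have "w \<in> proj_point w" by (auto simp: proj_point_def intro: exI[of _ 1])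
    then obtain c where "w = (\<lambda>i. c * z i)" using w(3) by (auto simp: proj_point_def)
    then show ?thesis using w(1,2) by (fastforce simp: coord_space_def fun_eq_iff)
  qed
  obtain i where i: "i \<le> m" "x i \<noteq> 0" using nz[OF \<open>proj_point x \<in> _\<close>] by blast
  obtain j where j: "j \<le> n" "y j \<noteq> 0" using nz[OF \<open>proj_point y \<in> _\<close>] by blast
  have "sv_map m n x y (i, j, j) \<noteq> 0" using i j by (simp add: sv_map_def sv_index_def)
  then have "sv_map m n x y \<noteq> (\<lambda>_. 0)" by metis
  moreover have "sv_map m n x y \<in> coord_space (sv_index m n)"
    by (auto simp: coord_space_def sv_map_def)
  ultimately show "p \<in> proj_space (sv_index m n)" unfolding p proj_space_def by blast
qed

definition q :: "nat \<Rightarrow> nat \<Rightarrow> nat" where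
  "q m n = ((m + 1) * ((n + 2) choose 2)) div (m + n + 1)"

end

theory Submission
  imports Defs "HOL-Computational_Algebra.Polynomial"
begin

text \<open>
  By Terracini's lemma the secant variety has the expected dimension as soon as the tangent spaces
  to the cone over the Segre-Veronese variety at some \<open>s\<close> points are linearly independent;
  \<open>s = q m n\<close> is the largest number for which the ambient space has room for this. For
  \<open>n\<close> large, \<open>q m n\<close> is the integer part of \<open>(m + 1) * t / 2\<close> with
  \<open>t = n + 2 - m\<close> (\<open>q_eq_half\<close>), so it grows by \<open>m + 1\<close> whenever \<open>n\<close>
  grows by \<open>2\<close>. Independent tangent spaces are constructed for all \<open>t\<close> by an
  induction with this step (\<open>exists_tangent_indep\<close>). The old points are kept in a subspace of
  codimension two, and \<open>m + 1\<close> points outside of it are added. Modulo the tensors of the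
  subspace, elimination of the new tangent vectors leaves a condition on the old points, saying that
  certain \<open>2 * s\<close> vectors in a space of dimension \<open>(m + 1) * t\<close> are independent
  (\<open>tangent_indep_adjoin\<close>). An explicit arrangement satisfies it (\<open>exists_pencil_indep\<close>),
  hence so do general points, in particular some points whose tangent spaces are
  independent (\<open>exists_tangent_and_pencil_indep\<close>).

  The Krull dimension is related to parametrisations by counting forms. In a chain of irreducible
  closed sets, forms vanishing on one member but not on the next have independent monomials, and
  comparison with the number of monomials in the parameters bounds the length of the chain
  (\<open>krull_dim_le_card_parameters\<close>). Conversely, if a map to projective space is given by a
  polynomial map to its cone whose value and partial derivatives at one point are independent, then
  the images of a flag of parameter spaces have strictly increasing closures
  (\<open>krull_dim_ge_parameters\<close>). Both bounds are applied to the secant variety, and to the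
  Segre-Veronese variety itself with a single point.
\<close>

section \<open>Polynomial functions of one variable and linear independence\<close>

text \<open>
  Functions of one complex variable given by a polynomial; all genericity arguments restrict to a
  line or a curve and use that a nonzero such function has finitely many zeros.
\<close>
definition polyfn :: "(complex \<Rightarrow> complex) \<Rightarrow> bool" where
  "polyfn f \<longleftrightarrow> (\<exists>p. f = poly p)"

lemma polyfn_const: "polyfn (\<lambda>t. c)"
  unfolding polyfn_def by (rule exI[of _ "[:c:]"]) auto

lemma polyfn_id: "polyfn (\<lambda>t. t)"
  unfolding polyfn_def by (rule exI[of _ "[:0, 1:]"]) auto

lemma polyfn_add: "polyfn f \<Longrightarrow> polyfn g \<Longrightarrow> polyfn (\<lambda>t. f t + g t)"
proof -
  assume "polyfn f" "polyfn g"
  then obtain p q where "f = poly p" "g = poly q" unfolding polyfn_def by blast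
  then show ?thesis unfolding polyfn_def by (intro exI[of _ "p + q"]) auto
qed

lemma polyfn_diff: "polyfn f \<Longrightarrow> polyfn g \<Longrightarrow> polyfn (\<lambda>t. f t - g t)"
proof -
  assume "polyfn f" "polyfn g"
  then obtain p q where "f = poly p" "g = poly q" unfolding polyfn_def by blast
  then show ?thesis unfolding polyfn_def by (intro exI[of _ "p - q"]) auto
qed

lemma polyfn_mult: "polyfn f \<Longrightarrow> polyfn g \<Longrightarrow> polyfn (\<lambda>t. f t * g t)"
proof -
  assume "polyfn f" "polyfn g"
  then obtain p q where "f = poly p" "g = poly q" unfolding polyfn_def by blast
  then show ?thesis unfolding polyfn_def by (intro exI[of _ "p * q"]) auto
qed

lemma polyfn_power: "polyfn f \<Longrightarrow> polyfn (\<lambda>t. f t ^ k)"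
proof -
  assume "polyfn f"
  then obtain p where "f = poly p" unfolding polyfn_def by blast
  then show ?thesis unfolding polyfn_def by (intro exI[of _ "p ^ k"]) auto
qed

lemma polyfn_sum: "(\<And>a. a \<in> A \<Longrightarrow> polyfn (f a)) \<Longrightarrow> polyfn (\<lambda>t. \<Sum>a\<in>A. f a t)"
  by (induction A rule: infinite_finite_induct) (auto intro!: polyfn_const polyfn_add)

lemma polyfn_prod: "(\<And>a. a \<in> A \<Longrightarrow> polyfn (f a)) \<Longrightarrow> polyfn (\<lambda>t. \<Prod>a\<in>A. f a t)"
  by (induction A rule: infinite_finite_induct) (auto intro!: polyfn_const polyfn_mult)

lemma polyfn_if: "polyfn f \<Longrightarrow> polyfn g \<Longrightarrow> polyfn (\<lambda>t. if P then f t else g t)"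
  by (cases P) auto

lemmas polyfn_intros = polyfn_const polyfn_id polyfn_add polyfn_diff polyfn_mult polyfn_power
  polyfn_sum polyfn_prod polyfn_if

lemma polyfn_finite_zeros:
  assumes "polyfn f" "f t0 \<noteq> 0"
  shows "finite {t. f t = 0}"
proof -
  obtain p where p: "f = poly p" using assms(1) unfolding polyfn_def by blast
  then have "p \<noteq> 0" using assms(2) by auto
  then show ?thesis unfolding p by (rule poly_roots_finite)
qed

text \<open>
  Linear independence of the family \<open>(M b)\<close>, \<open>b \<in> B\<close>, of vectors with coordinates
  indexed by \<open>J\<close>. Being a statement on families, it excludes repeated vectors.
\<close>
definition fam_indep :: "'b set \<Rightarrow> 'j set \<Rightarrow> ('b \<Rightarrow> 'j \<Rightarrow> complex) \<Rightarrow> bool" where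
  "fam_indep B J M \<longleftrightarrow>
     (\<forall>c. (\<forall>j\<in>J. (\<Sum>b\<in>B. c b * M b j) = 0) \<longrightarrow> (\<forall>b\<in>B. c b = 0))"

lemma fam_indepD:
  assumes "fam_indep B J M" "\<And>j. j \<in> J \<Longrightarrow> (\<Sum>b\<in>B. c b * M b j) = 0" "b \<in> B"
  shows "c b = 0"
  using assms unfolding fam_indep_def by blast

text \<open>
  Independence is an open condition along a polynomial one-parameter family. The induction on
  \<open>B\<close> is one step of fraction-free Gaussian elimination with pivot \<open>(b0, j0)\<close>, which
  keeps the entries polynomial.
\<close>
lemma fam_indep_generic:
  fixes M :: "complex \<Rightarrow> 'b \<Rightarrow> 'j \<Rightarrow> complex"
  assumes "finite B" "\<And>b j. b \<in> B \<Longrightarrow> j \<in> J \<Longrightarrow> polyfn (\<lambda>t. M t b j)"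
    and "fam_indep B J (M t0)"
  shows "finite {t. \<not> fam_indep B J (M t)}"
  using assms
proof (induction B arbitrary: M rule: finite_induct)
  case empty
  then show ?case by (simp add: fam_indep_def)
next
  case (insert b0 B)
  have "\<exists>j\<in>J. M t0 b0 j \<noteq> 0"
  proof (rule ccontr)
    assume "\<not> (\<exists>j\<in>J. M t0 b0 j \<noteq> 0)"
    then have "(\<Sum>b\<in>insert b0 B. (if b = b0 then 1 else 0) * M t0 b j) = 0" if "j \<in> J" for j
      using that insert.hyps by (intro sum.neutral) auto
    from fam_indepD[OF insert.prems(2) this, of b0] show False by simp
  qed
  then obtain j0 where j0: "j0 \<in> J" "M t0 b0 j0 \<noteq> 0" by blast
  \<comment> \<open>Eliminate coordinate \<open>j0\<close> from the remaining vectors without dividing.\<close>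
  define M' where "M' t b j = M t b j * M t b0 j0 - M t b0 j * M t b j0" for t b j
  have sum_M': "(\<Sum>b\<in>B. c b * M' t b j)
      = (\<Sum>b\<in>B. c b * M t b j) * M t b0 j0 - M t b0 j * (\<Sum>b\<in>B. c b * M t b j0)" for c t j
    by (simp add: M'_def sum_subtractf sum_distrib_left sum_distrib_right algebra_simps)
  have "fam_indep B J (M' t0)"
    unfolding fam_indep_def
  proof (intro allI impI)
    fix c assume c: "\<forall>j\<in>J. (\<Sum>b\<in>B. c b * M' t0 b j) = 0"
    define c' where
      "c' b = (if b = b0 then - (\<Sum>b\<in>B. c b * M t0 b j0) else c b * M t0 b0 j0)" for b
    have c'B: "(\<Sum>b\<in>B. c' b * M t0 b j) = (\<Sum>b\<in>B. c b * M t0 b0 j0 * M t0 b j)" for j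
      using insert.hyps by (intro sum.cong) (auto simp: c'_def)
    have "(\<Sum>b\<in>insert b0 B. c' b * M t0 b j) = 0" if "j \<in> J" for j
      using c[rule_format, OF that] insert.hyps
      unfolding sum_M' by (simp add: c'B) (simp add: c'_def sum_distrib_left sum_distrib_right algebra_simps)
    then have "\<forall>b\<in>insert b0 B. c' b = 0" using fam_indepD[OF insert.prems(2)] by blast
    then show "\<forall>b\<in>B. c b = 0" using insert.hyps j0 by (auto simp: c'_def split: if_splits)
  qed
  moreover have "polyfn (\<lambda>t. M' t b j)" if "b \<in> B" "j \<in> J" for b j
    unfolding M'_def using that insert.prems(1) j0(1) by (intro polyfn_intros) auto
  ultimately have "finite {t. \<not> fam_indep B J (M' t)}"
    by (intro insert.IH)
  moreover have "finite {t. M t b0 j0 = 0}"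
    using insert.prems(1) j0 by (intro polyfn_finite_zeros[of _ t0]) auto
  moreover have "{t. \<not> fam_indep (insert b0 B) J (M t)}
      \<subseteq> {t. \<not> fam_indep B J (M' t)} \<union> {t. M t b0 j0 = 0}"
  proof (rule subsetI, rule ccontr)
    fix t assume t: "t \<in> {t. \<not> fam_indep (insert b0 B) J (M t)}"
      "t \<notin> {t. \<not> fam_indep B J (M' t)} \<union> {t. M t b0 j0 = 0}"
    then have ind: "fam_indep B J (M' t)" and nz: "M t b0 j0 \<noteq> 0" by auto
    obtain c b1 where c: "\<And>j. j \<in> J \<Longrightarrow> (\<Sum>b\<in>insert b0 B. c b * M t b j) = 0"
      and b1: "b1 \<in> insert b0 B" "c b1 \<noteq> 0"
      using t(1) unfolding fam_indep_def by blast
    have c': "(\<Sum>b\<in>B. c b * M t b j) = - c b0 * M t b0 j" if "j \<in> J" for j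
      using c[OF that] insert.hyps by (simp add: eq_neg_iff_add_eq_0 add.commute)
    have "(\<Sum>b\<in>B. c b * M' t b j) = 0" if "j \<in> J" for j
      unfolding sum_M' c'[OF that] c'[OF j0(1)] by simp
    then have B: "\<forall>b\<in>B. c b = 0" using fam_indepD[OF ind] by blast
    then have "c b0 * M t b0 j0 = 0" using c'[OF j0(1)] by simp
    with nz B b1 show False by auto
  qed
  ultimately show ?case by (meson finite_Un finite_subset)
qed

text \<open>
  An independent family has a dual family of linear functionals, given by coefficient vectors
  \<open>L a\<close>. The induction is a Gram-Schmidt step: \<open>R\<close> is the new vector minus its
  components along the old ones.
\<close>
lemma fam_indep_dual:
  fixes P :: "'b \<Rightarrow> 'j \<Rightarrow> complex"
  assumes "finite B" "finite J" "fam_indep B J P"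
  shows "\<exists>L. \<forall>a\<in>B. \<forall>b\<in>B. (\<Sum>j\<in>J. L a j * P b j) = (if a = b then 1 else 0)"
  using assms(1,3)
proof (induction B rule: finite_induct)
  case empty
  then show ?case by simp
next
  case (insert b0 B)
  have "fam_indep B J P"
    unfolding fam_indep_def
  proof (intro allI impI)
    fix c assume c: "\<forall>j\<in>J. (\<Sum>b\<in>B. c b * P b j) = 0"
    have "(\<Sum>b\<in>insert b0 B. (if b = b0 then 0 else c b) * P b j) = 0" if "j \<in> J" for j
    proof -
      have "(\<Sum>b\<in>B. (if b = b0 then 0 else c b) * P b j) = (\<Sum>b\<in>B. c b * P b j)"
        using insert.hyps by (intro sum.cong) auto
      then show ?thesis using insert.hyps c that by simp
    qed
    from fam_indepD[OF insert.prems this] show "\<forall>b\<in>B. c b = 0"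
      using insert.hyps by (metis insertCI)
  qed
  from insert.IH[OF this] obtain L where
    L: "\<And>a b. a \<in> B \<Longrightarrow> b \<in> B \<Longrightarrow> (\<Sum>j\<in>J. L a j * P b j) = (if a = b then 1 else 0)"
    by blast
  define R where "R j = P b0 j - (\<Sum>b\<in>B. (\<Sum>i\<in>J. L b i * P b0 i) * P b j)" for j
  have "\<exists>j\<in>J. R j \<noteq> 0"
  proof (rule ccontr)
    assume R: "\<not> (\<exists>j\<in>J. R j \<noteq> 0)"
    define c where "c b = (if b = b0 then 1 else - (\<Sum>i\<in>J. L b i * P b0 i))" for b
    have cR: "(\<Sum>b\<in>insert b0 B. c b * P b j) = R j" for j
    proof -
      have "(\<Sum>b\<in>B. c b * P b j) = (\<Sum>b\<in>B. - (\<Sum>i\<in>J. L b i * P b0 i) * P b j)"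
        using insert.hyps by (intro sum.cong) (auto simp: c_def)
      then show ?thesis using insert.hyps by (simp add: R_def c_def sum_negf)
    qed
    have "c b0 = 0"
    proof (rule fam_indepD[OF insert.prems])
      fix j assume "j \<in> J"
      then show "(\<Sum>b\<in>insert b0 B. c b * P b j) = 0" unfolding cR using R by blast
    qed simp
    then show False by (simp add: c_def)
  qed
  then obtain i0 where i0: "i0 \<in> J" "R i0 \<noteq> 0" by blast
  define L0 where "L0 j = ((if j = i0 then 1 else 0) - (\<Sum>b\<in>B. P b i0 * L b j)) / R i0" for j
  have L0: "(\<Sum>j\<in>J. L0 j * P b j)
      = (P b i0 - (\<Sum>a\<in>B. P a i0 * (\<Sum>j\<in>J. L a j * P b j))) / R i0" for b
  proof -
    have "(\<Sum>j\<in>J. L0 j * P b j) * R i0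
        = (\<Sum>j\<in>J. (if j = i0 then P b j else 0) - (\<Sum>a\<in>B. P a i0 * L a j * P b j))"
      unfolding sum_distrib_right
    proof (intro sum.cong refl)
      fix j
      have "L0 j * R i0 = (if j = i0 then 1 else 0) - (\<Sum>a\<in>B. P a i0 * L a j)"
        using i0 by (simp add: L0_def)
      then have "L0 j * P b j * R i0
          = ((if j = i0 then 1 else 0) - (\<Sum>a\<in>B. P a i0 * L a j)) * P b j"
        by (metis mult.assoc mult.commute)
      then show "L0 j * P b j * R i0
          = (if j = i0 then P b j else 0) - (\<Sum>a\<in>B. P a i0 * L a j * P b j)"
        by (simp add: left_diff_distrib sum_distrib_right)
    qed
    also have "\<dots> = P b i0 - (\<Sum>j\<in>J. \<Sum>a\<in>B. P a i0 * L a j * P b j)"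
      using i0 assms(2) by (simp add: sum_subtractf)
    also have "(\<Sum>j\<in>J. \<Sum>a\<in>B. P a i0 * L a j * P b j)
        = (\<Sum>a\<in>B. P a i0 * (\<Sum>j\<in>J. L a j * P b j))"
      by (subst sum.swap) (simp add: sum_distrib_left mult.assoc)
    finally show ?thesis using i0 by (simp add: field_simps)
  qed
  have L0B: "(\<Sum>j\<in>J. L0 j * P b j) = 0" if "b \<in> B" for b
  proof -
    have "(\<Sum>a\<in>B. P a i0 * (\<Sum>j\<in>J. L a j * P b j)) = (\<Sum>a\<in>B. if a = b then P a i0 else 0)"
      using that by (intro sum.cong) (auto simp: L)
    then show ?thesis unfolding L0 using that insert.hyps by simp
  qed
  have L00: "(\<Sum>j\<in>J. L0 j * P b0 j) = 1"
    unfolding L0 using i0 by (simp add: R_def algebra_simps)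
  define L' where
    "L' a j = (if a = b0 then L0 j else L a j - (\<Sum>i\<in>J. L a i * P b0 i) * L0 j)" for a j
  have "(\<Sum>j\<in>J. L' a j * P b j) = (if a = b then 1 else 0)"
    if "a \<in> insert b0 B" "b \<in> insert b0 B" for a b
  proof (cases "a = b0")
    case True
    then show ?thesis using that L0B L00 insert.hyps by (auto simp: L'_def)
  next
    case False
    define r where "r = (\<Sum>i\<in>J. L a i * P b0 i)"
    have "(\<Sum>j\<in>J. L' a j * P b j) = (\<Sum>j\<in>J. L a j * P b j) - r * (\<Sum>j\<in>J. L0 j * P b j)"
      using False
      by (simp add: L'_def r_def[symmetric] sum_subtractf sum_distrib_left left_diff_distrib mult.assoc)
    then show ?thesis using False that L L0B L00 by (auto simp: r_def)
  qed
  then show ?case by blast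
qed

section \<open>Forms, Zariski closures and irreducibility\<close>

lemma forms_add: "f \<in> forms I d \<Longrightarrow> g \<in> forms I d \<Longrightarrow> (\<lambda>x. f x + g x) \<in> forms I d"
  unfolding forms_def using cfun.span_add by (fastforce simp: plus_fun_def)

lemma forms_scale: "f \<in> forms I d \<Longrightarrow> (\<lambda>x. c * f x) \<in> forms I d"
  unfolding forms_def by (rule cfun.span_scale)

lemma forms_zero: "(\<lambda>x. 0) \<in> forms I d"
  unfolding forms_def using cfun.span_zero by (simp add: zero_fun_def)

lemma forms_one: "(\<lambda>x. 1) \<in> forms I 0"
proof -
  have "monomial I (\<lambda>_. 0) \<in> forms I 0"
    unfolding forms_def by (intro cfun.span_base) auto
  moreover have "monomial I (\<lambda>_. 0) = (\<lambda>x. 1)" by (simp add: fun_eq_iff monomial_def)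
  ultimately show ?thesis by simp
qed

lemma forms_sum: "(\<And>a. a \<in> A \<Longrightarrow> f a \<in> forms I d) \<Longrightarrow> (\<lambda>x. \<Sum>a\<in>A. f a x) \<in> forms I d"
  by (induction A rule: infinite_finite_induct) (auto intro: forms_zero forms_add)

lemma forms_power: "f \<in> forms I d \<Longrightarrow> (\<lambda>x. f x ^ k) \<in> forms I (d * k)"
proof (induction k)
  case 0
  then show ?case by (simp add: forms_one)
next
  case (Suc k)
  then show ?case using mult_forms[of f I d "\<lambda>x. f x ^ k" "d * k"] by simp
qed

lemma forms_prod:
  "(\<And>a. a \<in> A \<Longrightarrow> f a \<in> forms I (d a)) \<Longrightarrow> (\<lambda>x. \<Prod>a\<in>A. f a x) \<in> forms I (\<Sum>a\<in>A. d a)"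
proof (induction A rule: infinite_finite_induct)
  case (insert a A)
  then show ?case using mult_forms[of "f a" I "d a" "\<lambda>x. \<Prod>a\<in>A. f a x"] by simp
qed (auto intro: forms_one)

lemma coordinate_forms:
  assumes "finite I" "i \<in> I"
  shows "(\<lambda>x. x i) \<in> forms I 1"
proof -
  have "monomial I (\<lambda>j. if j = i then 1 else 0) = (\<lambda>x. x i)"
  proof
    fix x
    have "monomial I (\<lambda>j. if j = i then 1 else 0) x = (\<Prod>j\<in>I. if j = i then x j else 1)"
      unfolding monomial_def by (intro prod.cong) auto
    then show "monomial I (\<lambda>j. if j = i then 1 else 0) x = x i" using assms by simp
  qed
  moreover have "monomial I (\<lambda>j. if j = i then 1 else 0) \<in> forms I 1"
    unfolding forms_def using assms by (intro cfun.span_base) auto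
  ultimately show ?thesis by simp
qed

lemma linear_forms:
  assumes "finite I"
  shows "(\<lambda>x. \<Sum>i\<in>I. L i * x i) \<in> forms I 1"
  using assms by (intro forms_sum forms_scale coordinate_forms)

lemma form_polyfn:
  assumes "f \<in> forms I d" "\<And>i. i \<in> I \<Longrightarrow> polyfn (\<lambda>t. \<gamma> t i)"
  shows "polyfn (\<lambda>t. f (\<gamma> t))"
  using assms(1) unfolding forms_def
proof (induction rule: cfun.span_induct_alt)
  case base
  show ?case by (simp add: polyfn_const)
next
  case (step c h g)
  then show ?case using assms(2) by (auto simp: monomial_def intro!: polyfn_intros)
qed

text \<open>
  A function on coordinate vectors vanishes on a set of projective points if it vanishes on all
  their homogeneous coordinate vectors.
\<close>
definition vanishes_on :: "(('i \<Rightarrow> complex) \<Rightarrow> complex) \<Rightarrow> ('i \<Rightarrow> complex) set set \<Rightarrow> bool" where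
  "vanishes_on f S \<longleftrightarrow> (\<forall>p\<in>S. \<forall>x\<in>p. f x = 0)"

lemma vanishes_on_subset: "vanishes_on f S \<Longrightarrow> T \<subseteq> S \<Longrightarrow> vanishes_on f T"
  unfolding vanishes_on_def by blast

lemma closedin_vanishing:
  assumes "f \<in> forms I d"
  shows "closedin (zariski I) {p \<in> proj_space I. \<forall>x\<in>p. f x = 0}"
proof -
  have "{p \<in> proj_space I. \<forall>x\<in>p. f x = 0} = zero_locus I {f}" by (auto simp: zero_locus_def)
  then show ?thesis using assms unfolding closedin_zariski zariski_closed_def by blast
qed

lemma vanishes_on_closure:
  assumes "f \<in> forms I d" "S \<subseteq> proj_space I" "vanishes_on f S"
  shows "vanishes_on f (zariski I closure_of S)"
proof -
  have "zariski I closure_of S \<subseteq> {p \<in> proj_space I. \<forall>x\<in>p. f x = 0}"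
    using assms by (intro closure_of_minimal closedin_vanishing) (auto simp: vanishes_on_def)
  then show ?thesis by (auto simp: vanishes_on_def)
qed

lemma self_in_proj_point: "x \<in> proj_point x"
  unfolding proj_point_def by (rule CollectI, rule exI[of _ 1]) auto

lemma proj_point_in_proj_space: "x \<in> coord_space I \<Longrightarrow> x \<noteq> (\<lambda>_. 0) \<Longrightarrow> proj_point x \<in> proj_space I"
  unfolding proj_space_def by blast

lemma form_at_proj_point:
  assumes "f \<in> forms I d" "x \<in> coord_space I" "x \<noteq> (\<lambda>_. 0)" "f x = 0" "y \<in> proj_point x"
  shows "f y = 0"
  using form_vanishes_on_point[OF assms(1) proj_point_in_proj_space[OF assms(2,3)]
      self_in_proj_point assms(5,4)] .

lemma not_in_closed_obtain:
  assumes "closedin (zariski I) T" "p \<in> proj_space I" "p \<notin> T"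
  obtains f d where "f \<in> forms I d" "vanishes_on f T" "\<And>x. x \<in> p \<Longrightarrow> f x \<noteq> 0"
proof -
  obtain F where F: "F \<subseteq> (\<Union>d. forms I d)" "T = zero_locus I F"
    using assms(1) unfolding closedin_zariski zariski_closed_def by blast
  obtain f x where f: "f \<in> F" "x \<in> p" "f x \<noteq> 0"
    using assms(2,3) unfolding F(2) zero_locus_def by blast
  obtain d where d: "f \<in> forms I d" using F(1) f(1) by blast
  show thesis
  proof
    show "f \<in> forms I d" by fact
    show "vanishes_on f T" using f(1) unfolding F(2) vanishes_on_def zero_locus_def by blast
    show "f y \<noteq> 0" if "y \<in> p" for y
      using form_vanishes_on_point[OF d assms(2) that f(2)] f(3) by blast
  qed
qed

text \<open>
  The homogeneous ideal of an irreducible set is prime.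
\<close>
lemma irreducible_mult_vanishes:
  assumes "Z \<subseteq> proj_space I" "irreducible_space (subtopology (zariski I) Z)"
    and "f \<in> forms I d" "g \<in> forms I e" "vanishes_on (\<lambda>x. f x * g x) Z"
  shows "vanishes_on f Z \<or> vanishes_on g Z"
proof -
  let ?V = "\<lambda>f. {p \<in> proj_space I. \<forall>x\<in>p. f x = (0::complex)}"
  have top: "topspace (subtopology (zariski I) Z) = Z"
    using assms(1) by (auto simp: topspace_zariski)
  have cl: "closedin (subtopology (zariski I) Z) (?V f \<inter> Z)"
    "closedin (subtopology (zariski I) Z) (?V g \<inter> Z)"
    unfolding closedin_subtopology using closedin_vanishing assms(3,4) by blast+
  have "p \<in> ?V f \<union> ?V g" if p: "p \<in> Z" for p
  proof (rule ccontr)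
    assume "p \<notin> ?V f \<union> ?V g"
    moreover have pp: "p \<in> proj_space I" using p assms(1) by blast
    ultimately obtain x y where "x \<in> p" "f x \<noteq> 0" "y \<in> p" "g y \<noteq> 0" by blast
    moreover from this have "g x \<noteq> 0" using form_vanishes_on_point[OF assms(4) pp] by blast
    ultimately show False using assms(5) p by (auto simp: vanishes_on_def)
  qed
  then have "(?V f \<inter> Z) \<union> (?V g \<inter> Z) = Z" by blast
  then have "?V f \<inter> Z = Z \<or> ?V g \<inter> Z = Z"
    using assms(2) cl unfolding irreducible_space_def top by blast
  then show ?thesis unfolding vanishes_on_def by blast
qed

text \<open>
  A set of vectors in which any two elements are joined by a polynomial curve has an irreducible
  Zariski closure, also after intersecting the closure with a set \<open>S\<close> that contains all the
  points: two forms, each nonzero at one end of a curve, are both nonzero at some point of it.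
\<close>
lemma irreducible_space_closure:
  assumes "A \<subseteq> coord_space I" "proj_point ` (A - {\<lambda>_. 0}) \<subseteq> S" "S \<subseteq> proj_space I"
    and ne: "A - {\<lambda>_. 0} \<noteq> {}"
    and curve: "\<And>x y. x \<in> A \<Longrightarrow> y \<in> A \<Longrightarrow>
      \<exists>\<gamma>. \<gamma> 0 = x \<and> \<gamma> 1 = y \<and> (\<forall>t. \<gamma> t \<in> A) \<and> (\<forall>i\<in>I. polyfn (\<lambda>t. \<gamma> t i))"
  shows "irreducible_space
    (subtopology (zariski I) (S \<inter> zariski I closure_of (proj_point ` (A - {\<lambda>_. 0}))))"
proof -
  define P where "P = proj_point ` (A - {\<lambda>_. 0})"
  define Z where "Z = S \<inter> zariski I closure_of P"
  have PS: "P \<subseteq> proj_space I" using assms(2,3) by (auto simp: P_def)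
  have PZ: "P \<subseteq> Z"
    using assms(2) closure_of_subset[of P "zariski I"] PS by (auto simp: Z_def P_def topspace_zariski)
  have top: "topspace (subtopology (zariski I) Z) = Z"
    using assms(3) by (auto simp: topspace_zariski Z_def)
  have "C1 = Z \<or> C2 = Z"
    if C: "closedin (subtopology (zariski I) Z) C1" "closedin (subtopology (zariski I) Z) C2"
      "C1 \<union> C2 = Z" for C1 C2
  proof -
    obtain T1 T2 where T: "closedin (zariski I) T1" "C1 = T1 \<inter> Z" "closedin (zariski I) T2" "C2 = T2 \<inter> Z"
      using C unfolding closedin_subtopology by blast
    have sub: "T \<inter> Z = Z" if "closedin (zariski I) T" "P \<subseteq> T" for T
      using closure_of_minimal[OF that(2,1)] by (auto simp: Z_def)
    show ?thesis
    proof (rule ccontr)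
      assume "\<not> ?thesis"
      then have "\<not> P \<subseteq> T1" "\<not> P \<subseteq> T2" using sub T by metis+
      then obtain x y where x: "x \<in> A" "x \<noteq> (\<lambda>_. 0)" "proj_point x \<notin> T1"
        and y: "y \<in> A" "y \<noteq> (\<lambda>_. 0)" "proj_point y \<notin> T2"
        unfolding P_def by blast
      have px: "proj_point x \<in> proj_space I" "proj_point y \<in> proj_space I"
        using x y assms(1) by (auto intro: proj_point_in_proj_space)
      obtain f d where f: "f \<in> forms I d" "vanishes_on f T1" "f x \<noteq> 0"
        using not_in_closed_obtain[OF T(1) px(1) x(3)] self_in_proj_point by metis
      obtain g e where g: "g \<in> forms I e" "vanishes_on g T2" "g y \<noteq> 0"
        using not_in_closed_obtain[OF T(3) px(2) y(3)] self_in_proj_point by metis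
      obtain \<gamma> where \<gamma>: "\<gamma> 0 = x" "\<gamma> 1 = y" "\<And>t. \<gamma> t \<in> A" "\<And>i. i \<in> I \<Longrightarrow> polyfn (\<lambda>t. \<gamma> t i)"
        using curve[OF x(1) y(1)] by blast
      obtain i where i: "x i \<noteq> 0" using x(2) by blast
      then have "i \<in> I" using x(1) assms(1) by (auto simp: coord_space_def)
      have "finite {t. f (\<gamma> t) = 0}"
        using form_polyfn[OF f(1) \<gamma>(4)] by (rule polyfn_finite_zeros[of _ 0]) (auto simp: f \<gamma>)
      moreover have "finite {t. g (\<gamma> t) = 0}"
        using form_polyfn[OF g(1) \<gamma>(4)] by (rule polyfn_finite_zeros[of _ 1]) (auto simp: g \<gamma>)
      moreover have "finite {t. \<gamma> t i = 0}"
        using \<gamma>(4)[OF \<open>i \<in> I\<close>] by (rule polyfn_finite_zeros[of _ 0]) (auto simp: i \<gamma>)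
      ultimately have "finite ({t. f (\<gamma> t) = 0} \<union> {t. g (\<gamma> t) = 0} \<union> {t. \<gamma> t i = 0})" by simp
      from ex_new_if_finite[OF infinite_UNIV_char_0 this] obtain t where
        t: "f (\<gamma> t) \<noteq> 0" "g (\<gamma> t) \<noteq> 0" "\<gamma> t i \<noteq> 0" by blast
      then have "proj_point (\<gamma> t) \<in> P" using \<gamma>(3) by (auto simp: P_def)
      then have "proj_point (\<gamma> t) \<in> T1 \<union> T2" using PZ C(3) T by blast
      then show False using f(2) g(2) t self_in_proj_point unfolding vanishes_on_def by blast
    qed
  qed
  moreover have "Z \<noteq> {}" using ne PZ by (auto simp: P_def)
  ultimately show ?thesis
    unfolding irreducible_space_def Z_def[symmetric] P_def[symmetric] top by blast
qed

section \<open>Spaces of polynomial functions\<close>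

text \<open>
  Polynomial functions in the variables \<open>J\<close> of degree at most \<open>D\<close> in each variable
  and without terms of total degree below \<open>r\<close>. Bounding each variable separately makes the
  dimension count of \<open>box_polys_finite_span\<close> a mere power.
\<close>
definition box_polys :: "'j set \<Rightarrow> nat \<Rightarrow> nat \<Rightarrow> (('j \<Rightarrow> complex) \<Rightarrow> complex) set" where
  "box_polys J D r = cfun.span (monomial J ` {e. (\<forall>j\<in>J. e j \<le> D) \<and> r \<le> sum e J})"

lemma box_polys_mono: "f \<in> box_polys J D r \<Longrightarrow> D \<le> D' \<Longrightarrow> r' \<le> r \<Longrightarrow> f \<in> box_polys J D' r'"
  unfolding box_polys_def by (erule rev_subsetD[OF _ cfun.span_mono]) force

lemma box_polys_add:
  "f \<in> box_polys J D r \<Longrightarrow> g \<in> box_polys J D r \<Longrightarrow> (\<lambda>x. f x + g x) \<in> box_polys J D r"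
  unfolding box_polys_def using cfun.span_add by (fastforce simp: plus_fun_def)

lemma box_polys_scale: "f \<in> box_polys J D r \<Longrightarrow> (\<lambda>x. c * f x) \<in> box_polys J D r"
  unfolding box_polys_def by (rule cfun.span_scale)

lemma box_polys_zero: "(\<lambda>x. 0) \<in> box_polys J D r"
  unfolding box_polys_def using cfun.span_zero by (simp add: zero_fun_def)

lemma box_polys_const: "(\<lambda>x. c) \<in> box_polys J D 0"
proof -
  have "monomial J (\<lambda>_. 0) \<in> box_polys J D 0"
    unfolding box_polys_def by (intro cfun.span_base) auto
  moreover have "monomial J (\<lambda>_. 0) = (\<lambda>x. 1)" by (simp add: fun_eq_iff monomial_def)
  ultimately show ?thesis using box_polys_scale[of "\<lambda>x. 1" J D 0 c] by simp
qed

lemma box_polys_sum: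
  "(\<And>a. a \<in> A \<Longrightarrow> f a \<in> box_polys J D r) \<Longrightarrow> (\<lambda>x. \<Sum>a\<in>A. f a x) \<in> box_polys J D r"
  by (induction A rule: infinite_finite_induct) (auto intro: box_polys_zero box_polys_add)

lemma box_polys_var:
  assumes "finite J" "j \<in> J"
  shows "(\<lambda>x. x j) \<in> box_polys J 1 1"
proof -
  have "monomial J (\<lambda>i. if i = j then 1 else 0) = (\<lambda>x. x j)"
  proof
    fix x
    have "monomial J (\<lambda>i. if i = j then 1 else 0) x = (\<Prod>i\<in>J. if i = j then x i else 1)"
      unfolding monomial_def by (intro prod.cong) auto
    then show "monomial J (\<lambda>i. if i = j then 1 else 0) x = x j" using assms by simp
  qed
  moreover have "monomial J (\<lambda>i. if i = j then 1 else 0) \<in> box_polys J 1 1"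
    unfolding box_polys_def using assms by (intro cfun.span_base) auto
  ultimately show ?thesis by simp
qed

lemma box_polys_mult:
  assumes "f \<in> box_polys J D r" "g \<in> box_polys J D' r'"
  shows "(\<lambda>x. f x * g x) \<in> box_polys J (D + D') (r + r')"
  using assms(1) unfolding box_polys_def[of J D r]
proof (induction rule: cfun.span_induct_alt)
  case base
  show ?case by (simp add: box_polys_zero)
next
  case (step c h f)
  then obtain e where e: "h = monomial J e" "\<forall>j\<in>J. e j \<le> D" "r \<le> sum e J" by auto
  have "(\<lambda>x. h x * g x) \<in> box_polys J (D + D') (r + r')"
    using assms(2) unfolding box_polys_def[of J D' r']
  proof (induction rule: cfun.span_induct_alt)
    case base
    show ?case by (simp add: box_polys_zero)
  next
    case (step c k g)
    then obtain e' where e': "k = monomial J e'" "\<forall>j\<in>J. e' j \<le> D'" "r' \<le> sum e' J" by auto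
    have "monomial J (e + e') \<in> box_polys J (D + D') (r + r')"
      unfolding box_polys_def using e e'
      by (intro cfun.span_base imageI) (auto simp: sum.distrib intro: add_mono)
    from box_polys_add[OF box_polys_scale[OF this, of c] step(2)]
    show ?case by (simp add: e e' monomial_mult[symmetric] algebra_simps)
  qed
  from box_polys_add[OF box_polys_scale[OF this, of c] step(2)]
  show ?case by (simp add: algebra_simps)
qed

lemma box_polys_power:
  "f \<in> box_polys J D 0 \<Longrightarrow> (\<lambda>x. f x ^ k) \<in> box_polys J (D * k) 0"
proof (induction k)
  case 0
  then show ?case by (simp add: box_polys_const)
next
  case (Suc k)
  then show ?case using box_polys_mult[of f J D 0 "\<lambda>x. f x ^ k" "D * k" 0] by simp
qed

lemma box_polys_prod:
  "(\<And>a. a \<in> A \<Longrightarrow> f a \<in> box_polys J (D a) 0) \<Longrightarrow> (\<lambda>x. \<Prod>a\<in>A. f a x) \<in> box_polys J (\<Sum>a\<in>A. D a) 0"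
proof (induction A rule: infinite_finite_induct)
  case (insert a A)
  then show ?case using box_polys_mult[of "f a" J "D a" 0 "\<lambda>x. \<Prod>a\<in>A. f a x"] by simp
qed (auto intro: box_polys_const)

lemma form_box_polys:
  assumes "f \<in> forms I d" "\<And>i. i \<in> I \<Longrightarrow> (\<lambda>w. \<Phi> w i) \<in> box_polys J D 0"
  shows "(\<lambda>w. f (\<Phi> w)) \<in> box_polys J (D * d) 0"
  using assms(1) unfolding forms_def
proof (induction rule: cfun.span_induct_alt)
  case base
  show ?case by (simp add: box_polys_zero)
next
  case (step c h g)
  then obtain e where e: "h = monomial I e" "sum e I = d" by auto
  have "(\<lambda>w. \<Prod>i\<in>I. \<Phi> w i ^ e i) \<in> box_polys J (\<Sum>i\<in>I. D * e i) 0"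
    using assms(2) by (intro box_polys_prod box_polys_power)
  then have "(\<lambda>w. h (\<Phi> w)) \<in> box_polys J (D * d) 0"
    by (simp add: e monomial_def sum_distrib_left[symmetric])
  from box_polys_add[OF box_polys_scale[OF this, of c] step(2)] show ?case by simp
qed

lemma box_polys_polyfn:
  assumes "f \<in> box_polys J D r" "\<And>j. j \<in> J \<Longrightarrow> polyfn (\<lambda>t. w t j)"
  shows "polyfn (\<lambda>t. f (w t))"
  using assms(1) unfolding box_polys_def
proof (induction rule: cfun.span_induct_alt)
  case base
  show ?case by (simp add: polyfn_const)
next
  case (step c h g)
  then show ?case using assms(2) by (auto simp: monomial_def intro!: polyfn_intros)
qed

text \<open>
  If all the variables are divisible by \<open>t ^ k\<close> then a polynomial function without terms
  of degree below \<open>r\<close> is divisible by \<open>t ^ (k * r)\<close>.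
\<close>
lemma box_polys_order:
  assumes "f \<in> box_polys J D r" "\<And>j. j \<in> J \<Longrightarrow> polyfn (\<rho> j)"
  shows "\<exists>R. polyfn R \<and> (\<forall>t. f (\<lambda>j. t ^ k * \<rho> j t) = t ^ (k * r) * R t)"
  using assms(1) unfolding box_polys_def
proof (induction rule: cfun.span_induct_alt)
  case base
  show ?case by (intro exI[of _ "\<lambda>t. 0"]) (simp add: polyfn_const)
next
  case (step c h g)
  then obtain e where e: "h = monomial J e" "r \<le> sum e J" by auto
  obtain R where R: "polyfn R" "\<And>t. g (\<lambda>j. t ^ k * \<rho> j t) = t ^ (k * r) * R t" using step by blast
  define R' where "R' t = c * (t ^ (k * (sum e J - r)) * (\<Prod>j\<in>J. \<rho> j t ^ e j)) + R t" for t
  have "h (\<lambda>j. t ^ k * \<rho> j t) = t ^ (k * r) * (t ^ (k * (sum e J - r)) * (\<Prod>j\<in>J. \<rho> j t ^ e j))" for t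
  proof -
    have "h (\<lambda>j. t ^ k * \<rho> j t) = (\<Prod>j\<in>J. t ^ (k * e j)) * (\<Prod>j\<in>J. \<rho> j t ^ e j)"
      by (simp add: e monomial_def power_mult_distrib power_mult prod.distrib)
    also have "(\<Prod>j\<in>J. t ^ (k * e j)) = t ^ (k * sum e J)"
      by (simp add: power_sum sum_distrib_left)
    also have "k * sum e J = k * r + k * (sum e J - r)"
      using e(2) by (simp add: distrib_left[symmetric])
    finally show ?thesis by (simp add: power_add mult.assoc)
  qed
  then have "\<forall>t. ((\<lambda>x. c * h x) + g) (\<lambda>j. t ^ k * \<rho> j t) = t ^ (k * r) * R' t"
    by (simp add: R R'_def algebra_simps)
  moreover have "polyfn R'" unfolding R'_def using R(1) assms(2) by (intro polyfn_intros) auto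
  ultimately show ?case by blast
qed

lemma box_polys_cut:
  fixes j K :: nat
  assumes "f \<in> box_polys {..<K} D r" "j \<le> K"
  shows "(\<lambda>w. f (\<lambda>l. if l < j then w l else 0)) \<in> box_polys {..<j} D 0"
  using assms(1) unfolding box_polys_def[of "{..<K}"]
proof (induction rule: cfun.span_induct_alt)
  case base
  show ?case by (simp add: box_polys_zero)
next
  case (step c h g)
  then obtain e where e: "h = monomial {..<K} e" "\<forall>l<K. e l \<le> D" by auto
  have split: "h (\<lambda>l. if l < j then w l else 0) = monomial {..<j} e w * (\<Prod>l\<in>{j..<K}. 0 ^ e l)" for w
  proof -
    have "{..<K} = {..<j} \<union> {j..<K}" using assms(2) by auto
    then have "h (\<lambda>l. if l < j then w l else 0)
        = (\<Prod>l<j. (if l < j then w l else 0) ^ e l) * (\<Prod>l\<in>{j..<K}. (if l < j then w l else 0) ^ e l)"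
      unfolding e(1) monomial_def by (simp add: prod.union_disjoint ivl_disj_int_one)
    then show ?thesis by (simp add: monomial_def)
  qed
  have "monomial {..<j} e \<in> box_polys {..<j} D 0"
    unfolding box_polys_def using e(2) assms(2) by (intro cfun.span_base) auto
  from box_polys_add[OF box_polys_scale[OF this, of "c * (\<Prod>l\<in>{j..<K}. 0 ^ e l)"] step(2)]
  show ?case by (simp add: split algebra_simps)
qed

lemma box_polys_finite_span:
  assumes "finite J"
  shows "\<exists>G. finite G \<and> card G \<le> (D + 1) ^ card J \<and> box_polys J D 0 = cfun.span G"
proof -
  let ?E = "PiE J (\<lambda>_. {..D})"
  have "monomial J ` {e. (\<forall>j\<in>J. e j \<le> D) \<and> 0 \<le> sum e J} = monomial J ` ?E"
  proof (intro equalityI image_subsetI)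
    fix e assume "e \<in> {e. (\<forall>j\<in>J. e j \<le> D) \<and> 0 \<le> sum e J}"
    then have "restrict e J \<in> ?E" by auto
    moreover have "monomial J e = monomial J (restrict e J)"
      unfolding monomial_def by (intro ext prod.cong) auto
    ultimately show "monomial J e \<in> monomial J ` ?E" by blast
  next
    fix e assume "e \<in> ?E"
    then show "monomial J e \<in> monomial J ` {e. (\<forall>j\<in>J. e j \<le> D) \<and> 0 \<le> sum e J}"
      by (intro imageI) (auto simp: PiE_def Pi_def)
  qed
  moreover have "finite ?E" using assms by (intro finite_PiE) auto
  moreover have "card (monomial J ` ?E) \<le> (D + 1) ^ card J"
    using card_image_le[OF \<open>finite ?E\<close>, of "monomial J"] assms by (simp add: card_PiE)
  ultimately show ?thesis unfolding box_polys_def by (metis finite_imageI)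
qed

lemma linear_relation_of_card:
  fixes f :: "'a \<Rightarrow> 'b \<Rightarrow> complex"
  assumes "finite A" "finite G" "\<And>a. a \<in> A \<Longrightarrow> f a \<in> cfun.span G" "card G < card A"
  shows "\<exists>c. (\<exists>a\<in>A. c a \<noteq> 0) \<and> (\<forall>x. (\<Sum>a\<in>A. c a * f a x) = 0)"
proof (cases "inj_on f A")
  case False
  then obtain a b where ab: "a \<in> A" "b \<in> A" "a \<noteq> b" "f a = f b" unfolding inj_on_def by blast
  define c where "c z = (if z = a then 1 else if z = b then - 1 else (0::complex))" for z
  have "(\<Sum>z\<in>A. c z * f z x) = 0" for x
  proof -
    have "(\<Sum>z\<in>A. c z * f z x) = (\<Sum>z\<in>{a, b}. c z * f z x)"
      using ab assms(1) by (intro sum.mono_neutral_right) (auto simp: c_def)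
    then show ?thesis using ab by (simp add: c_def)
  qed
  moreover have "c a \<noteq> 0" by (simp add: c_def)
  ultimately show ?thesis using ab(1) by blast
next
  case True
  have "cfun.dependent (f ` A)"
  proof (rule ccontr)
    assume "\<not> cfun.dependent (f ` A)"
    then have "card (f ` A) \<le> card G"
      using cfun.independent_span_bound[OF assms(2), of "f ` A"] assms(3) by blast
    then show False using assms(4) card_image[OF True] by simp
  qed
  then obtain S u where S: "finite S" "S \<subseteq> f ` A" "\<exists>v\<in>S. u v \<noteq> 0" and
    0: "(\<Sum>v\<in>S. (\<lambda>b. u v * v b)) = 0"
    unfolding cfun.dependent_explicit by auto
  define c where "c a = (if f a \<in> S then u (f a) else 0)" for a
  have "(\<Sum>a\<in>A. c a * f a x) = 0" for x
  proof -
    have sum_app: "(\<Sum>v\<in>S. (\<lambda>b. u v * v b)) x = (\<Sum>v\<in>S. u v * v x)"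
      by (induction S rule: infinite_finite_induct) auto
    have "(\<Sum>a\<in>A. c a * f a x) = (\<Sum>v\<in>f ` A. (if v \<in> S then u v else 0) * v x)"
      using True by (simp add: sum.reindex c_def)
    also have "\<dots> = (\<Sum>v\<in>S. u v * v x)"
      using S assms(1) by (intro sum.mono_neutral_cong_right) auto
    also have "\<dots> = 0" using sum_app 0 by simp
    finally show ?thesis .
  qed
  moreover have "\<exists>a\<in>A. c a \<noteq> 0" using S by (auto simp: c_def)
  ultimately show ?thesis by blast
qed

section \<open>Upper bounds for the Krull dimension\<close>

text \<open>
  In a chain of irreducible sets, choose forms \<open>f i\<close> of one degree, with \<open>f i\<close>
  vanishing on \<open>Z (i - 1)\<close> but not on \<open>Z i\<close>. The monomials of degree \<open>d\<close> in
  \<open>f 0, \<dots>, f j\<close> are then linearly independent on \<open>Z j\<close>: divide a relation by the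
  largest possible power of \<open>f j\<close> (by primality), and restrict the quotient to
  \<open>Z (j - 1)\<close>, where only the terms not divisible by \<open>f j\<close> survive. The monomials
  are indexed by a set \<open>A\<close> through their exponent vectors \<open>\<alpha> a\<close>.
\<close>
lemma chain_monomials_indep:
  fixes f :: "nat \<Rightarrow> ('i \<Rightarrow> complex) \<Rightarrow> complex"
  assumes Z: "\<And>i. i \<le> K \<Longrightarrow> Z i \<subseteq> proj_space I"
    "\<And>i. i \<le> K \<Longrightarrow> irreducible_space (subtopology (zariski I) (Z i))"
    "\<And>i. i < K \<Longrightarrow> Z i \<subseteq> Z (Suc i)"
    and f: "\<And>i. i \<le> K \<Longrightarrow> f i \<in> forms I E" "\<And>i. i < K \<Longrightarrow> vanishes_on (f (Suc i)) (Z i)"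
    "\<And>i. i \<le> K \<Longrightarrow> \<not> vanishes_on (f i) (Z i)"
    and "j \<le> K" "finite A" "inj_on (\<lambda>a. restrict (\<alpha> a) {..j}) A"
    and "\<And>a. a \<in> A \<Longrightarrow> sum (\<alpha> a) {..j} = d"
    and "vanishes_on (\<lambda>x. \<Sum>a\<in>A. c a * (\<Prod>i\<le>j. f i x ^ \<alpha> a i)) (Z j)"
    and "a \<in> A"
  shows "c a = 0"
  using assms(7-)
proof (induction j arbitrary: A d a)
  case 0
  obtain p x where px: "p \<in> Z 0" "x \<in> p" "f 0 x \<noteq> 0"
    using f(3)[of 0] by (auto simp: vanishes_on_def)
  have single: "b = a" if "b \<in> A" for b
  proof -
    have "\<alpha> b 0 = \<alpha> a 0" using 0(4)[OF that] 0(4)[OF 0(6)] by simp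
    then have "restrict (\<alpha> b) {..0} = restrict (\<alpha> a) {..0}" by (auto simp: fun_eq_iff restrict_def)
    then show ?thesis by (rule inj_onD[OF 0(3) _ that 0(6)])
  qed
  then have "A = {a}" using 0(6) by blast
  then have "c a * f 0 x ^ \<alpha> a 0 = 0"
    using 0(5)[unfolded vanishes_on_def, rule_format, OF px(1,2)] by simp
  then show ?case using px by simp
next
  case (Suc j)
  show ?case
  proof (rule ccontr)
    assume "c a \<noteq> 0"
    define B where "B = {b \<in> A. c b \<noteq> 0}"
    define k where "k = Min ((\<lambda>b. \<alpha> b (Suc j)) ` B)"
    have B: "finite B" "B \<noteq> {}" using Suc.prems \<open>c a \<noteq> 0\<close> by (auto simp: B_def)
    have k: "k \<le> \<alpha> b (Suc j)" if "b \<in> B" for b using B that by (simp add: k_def)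
    have "k \<in> (\<lambda>b. \<alpha> b (Suc j)) ` B" unfolding k_def using B by (intro Min_in) auto
    then obtain b0 where b0: "b0 \<in> B" "\<alpha> b0 (Suc j) = k" by blast
    define H where "H x = (\<Sum>b\<in>B. c b * ((\<Prod>i\<le>j. f i x ^ \<alpha> b i) * f (Suc j) x ^ (\<alpha> b (Suc j) - k)))" for x
    have fact: "(\<Sum>b\<in>A. c b * (\<Prod>i\<le>Suc j. f i x ^ \<alpha> b i)) = f (Suc j) x ^ k * H x" for x
    proof -
      have "(\<Sum>b\<in>A. c b * (\<Prod>i\<le>Suc j. f i x ^ \<alpha> b i)) = (\<Sum>b\<in>B. c b * (\<Prod>i\<le>Suc j. f i x ^ \<alpha> b i))"
        using Suc.prems(2) by (intro sum.mono_neutral_right) (auto simp: B_def)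
      also have "\<dots> = f (Suc j) x ^ k * H x"
        unfolding H_def sum_distrib_left
      proof (intro sum.cong refl)
        fix b assume "b \<in> B"
        then have "f (Suc j) x ^ \<alpha> b (Suc j) = f (Suc j) x ^ k * f (Suc j) x ^ (\<alpha> b (Suc j) - k)"
          using k by (simp flip: power_add)
        then show "c b * (\<Prod>i\<le>Suc j. f i x ^ \<alpha> b i)
          = f (Suc j) x ^ k * (c b * ((\<Prod>i\<le>j. f i x ^ \<alpha> b i) * f (Suc j) x ^ (\<alpha> b (Suc j) - k)))"
          by (simp add: algebra_simps)
      qed
      finally show ?thesis .
    qed
    have H: "H \<in> forms I (E * (d - k))"
      unfolding H_def
    proof (intro forms_sum forms_scale)
      fix b assume b: "b \<in> B"
      have "(\<lambda>x. (\<Prod>i\<le>j. f i x ^ \<alpha> b i) * f (Suc j) x ^ (\<alpha> b (Suc j) - k))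
        \<in> forms I ((\<Sum>i\<le>j. E * \<alpha> b i) + E * (\<alpha> b (Suc j) - k))"
        using f(1) Suc.prems(1) by (intro mult_forms forms_prod forms_power) auto
      moreover have "(\<Sum>i\<le>j. E * \<alpha> b i) + E * (\<alpha> b (Suc j) - k) = E * (d - k)"
      proof -
        have "(\<Sum>i\<le>j. \<alpha> b i) + \<alpha> b (Suc j) = d" using Suc.prems(4)[of b] b by (simp add: B_def)
        then have "(\<Sum>i\<le>j. \<alpha> b i) + (\<alpha> b (Suc j) - k) = d - k" using k[OF b] by linarith
        then show ?thesis by (metis distrib_left sum_distrib_left)
      qed
      ultimately show "(\<lambda>x. (\<Prod>i\<le>j. f i x ^ \<alpha> b i) * f (Suc j) x ^ (\<alpha> b (Suc j) - k))
          \<in> forms I (E * (d - k))" by simp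
    qed
    have "vanishes_on (\<lambda>x. f (Suc j) x ^ k * H x) (Z (Suc j))"
      using Suc.prems(5) unfolding fact .
    then have "vanishes_on (\<lambda>x. f (Suc j) x ^ k) (Z (Suc j)) \<or> vanishes_on H (Z (Suc j))"
      by (rule irreducible_mult_vanishes[OF Z(1,2)[OF Suc.prems(1)]
            forms_power[OF f(1)[OF Suc.prems(1)]] H])
    moreover have "\<not> vanishes_on (\<lambda>x. f (Suc j) x ^ k) (Z (Suc j))"
      using f(3)[OF Suc.prems(1)] by (auto simp: vanishes_on_def)
    ultimately have HZ: "vanishes_on H (Z j)"
      using vanishes_on_subset Z(3) Suc.prems(1) by (metis Suc_le_lessD)
    have Heq: "H x = (\<Sum>b\<in>{b \<in> B. \<alpha> b (Suc j) = k}. c b * (\<Prod>i\<le>j. f i x ^ \<alpha> b i))"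
      if "f (Suc j) x = 0" for x
      unfolding H_def
    proof (intro sum.mono_neutral_cong_right)
      show "\<forall>b\<in>B - {b \<in> B. \<alpha> b (Suc j) = k}.
          c b * ((\<Prod>i\<le>j. f i x ^ \<alpha> b i) * f (Suc j) x ^ (\<alpha> b (Suc j) - k)) = 0"
      proof
        fix b assume "b \<in> B - {b \<in> B. \<alpha> b (Suc j) = k}"
        then have "\<alpha> b (Suc j) - k \<noteq> 0" using k[of b] by auto
        then show "c b * ((\<Prod>i\<le>j. f i x ^ \<alpha> b i) * f (Suc j) x ^ (\<alpha> b (Suc j) - k)) = 0"
          using that by (simp add: zero_power)
      qed
    qed (use B in auto)
    have fZ: "vanishes_on (f (Suc j)) (Z j)" using f(2) Suc.prems(1) by simp
    have van: "vanishes_on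
        (\<lambda>x. \<Sum>b\<in>{b \<in> B. \<alpha> b (Suc j) = k}. c b * (\<Prod>i\<le>j. f i x ^ \<alpha> b i)) (Z j)"
      unfolding vanishes_on_def
    proof (intro ballI)
      fix p x assume px: "p \<in> Z j" "x \<in> p"
      then have f0: "f (Suc j) x = 0" and H0: "H x = 0" using HZ fZ by (auto simp: vanishes_on_def)
      show "(\<Sum>b\<in>{b \<in> B. \<alpha> b (Suc j) = k}. c b * (\<Prod>i\<le>j. f i x ^ \<alpha> b i)) = 0"
        using H0 unfolding Heq[OF f0] .
    qed
    have "c b0 = 0"
    proof (rule Suc.IH[OF _ _ _ _ van, where d = "d - k"])
      show "inj_on (\<lambda>a. restrict (\<alpha> a) {..j}) {b \<in> B. \<alpha> b (Suc j) = k}"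
      proof (rule inj_onI)
        fix b b' assume bb: "b \<in> {b \<in> B. \<alpha> b (Suc j) = k}" "b' \<in> {b \<in> B. \<alpha> b (Suc j) = k}"
          and eq: "restrict (\<alpha> b) {..j} = restrict (\<alpha> b') {..j}"
        have "\<alpha> b i = \<alpha> b' i" if "i \<le> Suc j" for i
        proof (cases "i = Suc j")
          case False
          then have "i \<in> {..j}" using that by simp
          then show ?thesis using eq by (metis restrict_apply')
        qed (use bb in simp)
        then have "restrict (\<alpha> b) {..Suc j} = restrict (\<alpha> b') {..Suc j}" by (auto simp: restrict_def)
        then show "b = b'" by (rule inj_onD[OF Suc.prems(3)]) (use bb in \<open>auto simp: B_def\<close>)
      qed
      show "sum (\<alpha> b) {..j} = d - k" if "b \<in> {b \<in> B. \<alpha> b (Suc j) = k}" for b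
        using Suc.prems(4)[of b] that by (simp add: B_def)
    qed (use b0 B Suc.prems(1) in auto)
    then show False using b0 by (simp add: B_def)
  qed
qed

text \<open>
  A point \<open>g\<close> of the box \<open>{0..b} ^ K\<close> is completed by a zeroth exponent to an exponent
  vector in \<open>K + 1\<close> variables of total degree \<open>K * b\<close>; the entries of \<open>g\<close> are
  shifted by one.
\<close>
definition simplex_exp :: "nat \<Rightarrow> nat \<Rightarrow> (nat \<Rightarrow> nat) \<Rightarrow> nat \<Rightarrow> nat" where
  "simplex_exp K b g i = (if i = 0 then K * b - (\<Sum>l<K. g l) else g (i - 1))"

abbreviation box_exps :: "nat \<Rightarrow> nat \<Rightarrow> (nat \<Rightarrow> nat) set" where
  "box_exps K b \<equiv> PiE {..<K} (\<lambda>_. {..b})"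

lemma finite_box_exps: "finite (box_exps K b)" by (intro finite_PiE) auto

lemma card_box_exps: "card (box_exps K b) = (b + 1) ^ K" by (simp add: card_PiE)

lemma sum_simplex_exp:
  assumes "g \<in> box_exps K b"
  shows "sum (simplex_exp K b g) {..K} = K * b"
proof -
  have "(\<Sum>l<K. g l) \<le> (\<Sum>l<K. b)" using assms by (intro sum_mono) auto
  moreover have "sum (simplex_exp K b g) {..K} = K * b - (\<Sum>l<K. g l) + (\<Sum>l<K. g l)"
    by (subst sum.atMost_shift) (simp add: simplex_exp_def)
  ultimately show ?thesis by simp
qed

lemma inj_on_simplex_exp: "inj_on (\<lambda>g. restrict (simplex_exp K b g) {..K}) (box_exps K b)"
proof (rule inj_onI)
  fix g h assume gh: "g \<in> box_exps K b" "h \<in> box_exps K b"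
    and eq: "restrict (simplex_exp K b g) {..K} = restrict (simplex_exp K b h) {..K}"
  have "g l = h l" if "l < K" for l
  proof -
    have "Suc l \<in> {..K}" using that by simp
    then have "simplex_exp K b g (Suc l) = simplex_exp K b h (Suc l)" using eq by (metis restrict_apply')
    then show ?thesis by (simp add: simplex_exp_def)
  qed
  then show "g = h" using gh by (intro PiE_ext[of g _ _ h]) auto
qed

text \<open>
  The comparison of growth rates that decides the dimension counts.
\<close>
lemma growth:
  fixes C k K :: nat
  assumes "k < K"
  shows "\<exists>b>0. (C * b + 1) ^ k < (b + 1) ^ K"
proof -
  define b where "b = Suc C ^ k"
  have "(C * b + 1) ^ k \<le> (Suc C * (b + 1)) ^ k" by (intro power_mono) auto
  also have "\<dots> = b * (b + 1) ^ k" by (simp only: power_mult_distrib b_def)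
  also have "\<dots> < (b + 1) ^ Suc k" by simp
  also have "\<dots> \<le> (b + 1) ^ K" using assms by (intro power_increasing) auto
  finally show ?thesis by (intro exI[of _ b]) (auto simp: b_def)
qed

text \<open>
  If the forms that vanish on the image of \<open>\<Phi>\<close> vanish on \<open>S\<close>, then the dimension of
  \<open>S\<close> is at most the number of parameters of \<open>\<Phi>\<close>: a chain of length \<open>K\<close> yields
  \<open>(b + 1) ^ K\<close> independent forms of degree proportional to \<open>b\<close>, whereas their pullbacks
  along \<open>\<Phi>\<close> lie in a space of dimension \<open>O(b ^ card J)\<close>.
\<close>
lemma krull_dim_le_card_parameters:
  fixes \<Phi> :: "('j \<Rightarrow> complex) \<Rightarrow> 'i \<Rightarrow> complex"
  assumes I: "finite I" and J: "finite J" and S: "S \<subseteq> proj_space I"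
    and \<Phi>: "\<And>i. i \<in> I \<Longrightarrow> (\<lambda>w. \<Phi> w i) \<in> box_polys J D 0"
    and van: "\<And>F d. F \<in> forms I d \<Longrightarrow> (\<And>w. F (\<Phi> w) = 0) \<Longrightarrow> vanishes_on F S"
  shows "krull_dim (subtopology (zariski I) S) \<le> enat (card J)"
  unfolding krull_dim_def
proof (rule Sup_least, clarify)
  fix K Z
  assume Z: "\<forall>i\<le>K. closedin (subtopology (zariski I) S) (Z i)
      \<and> irreducible_space (subtopology (subtopology (zariski I) S) (Z i))"
    and strict: "\<forall>i<K. Z i \<subset> Z (Suc i)"
  have ZS: "Z i \<subseteq> S" if "i \<le> K" for i
    using Z that S closedin_subset by (fastforce simp: topspace_zariski)
  have ZP: "Z i \<subseteq> proj_space I" if "i \<le> K" for i using ZS[OF that] S by blast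
  have Zirr: "irreducible_space (subtopology (zariski I) (Z i))" if "i \<le> K" for i
  proof -
    have "S \<inter> Z i = Z i" using ZS[OF that] by blast
    then show ?thesis using Z that unfolding subtopology_subtopology by metis
  qed
  have sep: "\<exists>g d. g \<in> forms I d \<and> \<not> vanishes_on g (Z i) \<and> (\<forall>l. i = Suc l \<longrightarrow> vanishes_on g (Z l))"
    if i: "i \<le> K" for i
  proof (cases i)
    case 0
    have "Z i \<noteq> {}" using Zirr[OF i] ZP[OF i] by (auto simp: irreducible_space_def)
    then obtain p where p: "p \<in> Z i" by blast
    then obtain x where "p = proj_point x" using ZP[OF i] by (auto simp: proj_space_def)
    then have "\<not> vanishes_on (\<lambda>x. 1) (Z i)" using p self_in_proj_point unfolding vanishes_on_def by fastforce
    then show ?thesis using forms_one 0 by blast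
  next
    case (Suc l)
    then obtain p where p: "p \<in> Z i" "p \<notin> Z l" using strict i by (metis Suc_le_eq psubsetE subsetI)
    obtain T where T: "closedin (zariski I) T" "Z l = T \<inter> S"
      using Z i Suc unfolding closedin_subtopology by (metis Suc_leD)
    have "p \<in> proj_space I" "p \<notin> T" using p ZP[OF i] ZS[OF i] T by blast+
    from not_in_closed_obtain[OF T(1) this] obtain g d where
      g: "g \<in> forms I d" "vanishes_on g T" "\<And>x. x \<in> p \<Longrightarrow> g x \<noteq> 0" by metis
    have "\<not> vanishes_on g (Z i)"
      using g(3) p(1) ZP[OF i] self_in_proj_point by (fastforce simp: vanishes_on_def proj_space_def)
    then show ?thesis using g T(2) Suc vanishes_on_subset[OF g(2), of "Z l"] by blast
  qed
  then obtain g d where gd: "\<And>i. i \<le> K \<Longrightarrow> g i \<in> forms I (d i)"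
    "\<And>i. i \<le> K \<Longrightarrow> \<not> vanishes_on (g i) (Z i)" "\<And>i. Suc i \<le> K \<Longrightarrow> vanishes_on (g (Suc i)) (Z i)"
    by metis
  \<comment> \<open>Multiplication with powers of a coordinate that is nonzero at a witness makes all degrees equal.\<close>
  define E where "E = (\<Sum>i\<le>K. d i)"
  have dE: "d i \<le> E" if "i \<le> K" for i unfolding E_def using that by (intro member_le_sum) auto
  have "\<exists>f. f \<in> forms I E \<and> \<not> vanishes_on f (Z i) \<and> (\<forall>l. i = Suc l \<longrightarrow> vanishes_on f (Z l))"
    if i: "i \<le> K" for i
  proof -
    obtain p x where px: "p \<in> Z i" "x \<in> p" "g i x \<noteq> 0" using gd(2)[OF i] by (auto simp: vanishes_on_def)
    obtain y where y: "y \<in> coord_space I" "y \<noteq> (\<lambda>_. 0)" "p = proj_point y"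
      using px(1) ZP[OF i] by (auto simp: proj_space_def)
    obtain a where a: "y a \<noteq> 0" using y(2) by blast
    then have aI: "a \<in> I" using y(1) by (auto simp: coord_space_def)
    have xa: "x a \<noteq> 0" using px(2) a unfolding y(3) proj_point_def by auto
    define f where "f z = g i z * z a ^ (E - d i)" for z
    have "f \<in> forms I (d i + 1 * (E - d i))"
      unfolding f_def by (intro mult_forms gd i forms_power coordinate_forms I aI)
    then have "f \<in> forms I E" using dE[OF i] by simp
    moreover have "\<not> vanishes_on f (Z i)" using px xa by (auto simp: vanishes_on_def f_def)
    moreover have "vanishes_on f (Z l)" if "i = Suc l" for l
      using gd(3)[of l] i that by (auto simp: vanishes_on_def f_def)
    ultimately show ?thesis by blast
  qed
  then obtain f where f: "\<And>i. i \<le> K \<Longrightarrow> f i \<in> forms I E"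
    "\<And>i. i \<le> K \<Longrightarrow> \<not> vanishes_on (f i) (Z i)" "\<And>i. Suc i \<le> K \<Longrightarrow> vanishes_on (f (Suc i)) (Z i)"
    by metis
  have "K \<le> card J"
  proof (rule ccontr)
    assume "\<not> K \<le> card J"
    then obtain b where b: "(D * (E * K) * b + 1) ^ card J < (b + 1) ^ K"
      using growth[of "card J" K "D * (E * K)"] by auto
    define F where "F e x = (\<Prod>i\<le>K. f i x ^ simplex_exp K b e i)" for e x
    have F: "F e \<in> forms I (E * (K * b))" if "e \<in> box_exps K b" for e
    proof -
      have "F e \<in> forms I (\<Sum>i\<le>K. E * simplex_exp K b e i)"
        unfolding F_def using f(1) by (intro forms_prod forms_power) auto
      then show ?thesis using sum_simplex_exp[OF that] by (simp add: sum_distrib_left[symmetric])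
    qed
    obtain G where G: "finite G" "card G \<le> (D * (E * (K * b)) + 1) ^ card J"
      "box_polys J (D * (E * (K * b))) 0 = cfun.span G"
      using box_polys_finite_span[OF J] by metis
    have "\<exists>c. (\<exists>e\<in>box_exps K b. c e \<noteq> 0) \<and> (\<forall>w. (\<Sum>e\<in>box_exps K b. c e * F e (\<Phi> w)) = 0)"
    proof (rule linear_relation_of_card[OF finite_box_exps G(1)])
      show "(\<lambda>w. F e (\<Phi> w)) \<in> cfun.span G" if "e \<in> box_exps K b" for e
        unfolding G(3)[symmetric] by (rule form_box_polys[OF F[OF that] \<Phi>])
      show "card G < card (box_exps K b)"
        unfolding card_box_exps using G(2) b by (simp add: mult.assoc)
    qed
    then obtain c e0 where c: "e0 \<in> box_exps K b" "c e0 \<noteq> 0"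
      "\<And>w. (\<Sum>e\<in>box_exps K b. c e * F e (\<Phi> w)) = 0" by blast
    have "vanishes_on (\<lambda>x. \<Sum>e\<in>box_exps K b. c e * F e x) S"
      using c(3) F by (intro van[where d = "E * (K * b)"] forms_sum forms_scale) auto
    then have "vanishes_on (\<lambda>x. \<Sum>e\<in>box_exps K b. c e * F e x) (Z K)"
      using vanishes_on_subset ZS by blast
    then have "c e0 = 0"
      unfolding F_def
    proof (rule chain_monomials_indep[where K = K and j = K and Z = Z and f = f and E = E
          and \<alpha> = "simplex_exp K b", rotated -2])
      show "sum (simplex_exp K b e) {..K} = K * b" if "e \<in> box_exps K b" for e
        by (rule sum_simplex_exp[OF that])
    qed (use ZP Zirr strict f c(1) finite_box_exps inj_on_simplex_exp in auto)
    then show False using c(2) by simp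
  qed
  then show "enat K \<le> enat (card J)" by simp
qed


section \<open>Lower bounds for the Krull dimension\<close>

text \<open>
  The polynomial function \<open>\<phi>\<close> has order \<open>n\<close> at \<open>0\<close> and leading coefficient
  \<open>1\<close>.
\<close>
definition unit_order :: "nat \<Rightarrow> (complex \<Rightarrow> complex) \<Rightarrow> bool" where
  "unit_order n \<phi> \<longleftrightarrow> (\<exists>R. polyfn R \<and> (\<forall>t. \<phi> t = t ^ n * (1 + t * R t)))"

lemma unit_order_mult:
  assumes "unit_order n \<phi>" "unit_order n' \<psi>"
  shows "unit_order (n + n') (\<lambda>t. \<phi> t * \<psi> t)"
proof -
  obtain R R' where R: "polyfn R" "\<And>t. \<phi> t = t ^ n * (1 + t * R t)"
    and R': "polyfn R'" "\<And>t. \<psi> t = t ^ n' * (1 + t * R' t)"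
    using assms unfolding unit_order_def by blast
  have "polyfn (\<lambda>t. R t + R' t + t * R t * R' t)" using R(1) R'(1) by (intro polyfn_intros)
  moreover have "\<phi> t * \<psi> t = t ^ (n + n') * (1 + t * (R t + R' t + t * R t * R' t))" for t
    by (simp add: R R' power_add algebra_simps)
  ultimately show ?thesis
    unfolding unit_order_def by (intro exI[of _ "\<lambda>t. R t + R' t + t * R t * R' t"]) blast
qed

lemma unit_order_one: "unit_order 0 (\<lambda>t. 1)"
  unfolding unit_order_def by (intro exI[of _ "\<lambda>t. 0"]) (simp add: polyfn_const)

lemma unit_order_power: "unit_order n \<phi> \<Longrightarrow> unit_order (n * k) (\<lambda>t. \<phi> t ^ k)"
proof (induction k)
  case (Suc k)
  then show ?case using unit_order_mult[of n \<phi> "n * k" "\<lambda>t. \<phi> t ^ k"] by simp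
qed (simp add: unit_order_one)

lemma unit_order_prod:
  "(\<And>a. a \<in> A \<Longrightarrow> unit_order (n a) (\<phi> a)) \<Longrightarrow> unit_order (\<Sum>a\<in>A. n a) (\<lambda>t. \<Prod>a\<in>A. \<phi> a t)"
proof (induction A rule: infinite_finite_induct)
  case (insert a A)
  then show ?case using unit_order_mult[of "n a" "\<phi> a" _ "\<lambda>t. \<Prod>a\<in>A. \<phi> a t"] by simp
qed (auto intro: unit_order_one)

lemma distinct_orders_nonzero:
  assumes "finite A" "inj_on n A" "\<And>a. a \<in> A \<Longrightarrow> unit_order (n a) (\<phi> a)" "a \<in> A" "c a \<noteq> 0"
  shows "\<exists>t. (\<Sum>a\<in>A. c a * \<phi> a t) \<noteq> 0"
proof (rule ccontr)
  assume "\<not> ?thesis"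
  then have 0: "(\<Sum>a\<in>A. c a * \<phi> a t) = 0" for t by blast
  define B where "B = {b \<in> A. c b \<noteq> 0}"
  have B: "finite B" "B \<noteq> {}" using assms by (auto simp: B_def)
  define k where "k = Min (n ` B)"
  have "k \<in> n ` B" unfolding k_def using B by (intro Min_in) auto
  then obtain b where b: "b \<in> B" "n b = k" by blast
  have kle: "k \<le> n a" if "a \<in> B" for a using B that by (simp add: k_def)
  have klt: "k < n a" if "a \<in> B" "a \<noteq> b" for a
    using kle[OF that(1)] inj_onD[OF assms(2), of a b] that b by (auto simp: B_def le_less)
  obtain R where R: "\<And>a. a \<in> A \<Longrightarrow> polyfn (R a)"
    "\<And>a t. a \<in> A \<Longrightarrow> \<phi> a t = t ^ n a * (1 + t * R a t)"
    using assms(3) unfolding unit_order_def by metis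
  define H where "H t = c b * R b t + (\<Sum>a\<in>B - {b}. c a * (t ^ (n a - Suc k) * (1 + t * R a t)))" for t
  have H: "polyfn H" unfolding H_def using R(1) b by (intro polyfn_intros) (auto simp: B_def)
  have "(\<Sum>a\<in>A. c a * \<phi> a t) = t ^ k * (c b + t * H t)" for t
  proof -
    have "(\<Sum>a\<in>A. c a * \<phi> a t) = (\<Sum>a\<in>B. c a * \<phi> a t)"
      using assms(1) by (intro sum.mono_neutral_right) (auto simp: B_def)
    also have "\<dots> = c b * \<phi> b t + (\<Sum>a\<in>B - {b}. c a * \<phi> a t)" using B b by (intro sum.remove)
    also have "(\<Sum>a\<in>B - {b}. c a * \<phi> a t)
        = (\<Sum>a\<in>B - {b}. t ^ k * (t * (c a * (t ^ (n a - Suc k) * (1 + t * R a t)))))"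
    proof (intro sum.cong refl)
      fix a assume a: "a \<in> B - {b}"
      then have "n a = k + Suc (n a - Suc k)" using klt[of a] by auto
      then have "t ^ n a = t ^ k * (t * t ^ (n a - Suc k))" by (metis power_add power_Suc)
      then show "c a * \<phi> a t = t ^ k * (t * (c a * (t ^ (n a - Suc k) * (1 + t * R a t))))"
        using R(2)[of a t] a by (simp add: B_def mult.assoc mult.left_commute)
    qed
    finally show ?thesis
      using R(2)[of b t] b by (simp add: H_def B_def sum_distrib_left algebra_simps)
  qed
  then have "c b + t * H t = 0" if "t \<noteq> 0" for t using 0[of t] that by simp
  then have "- {0} \<subseteq> {t. c b + t * H t = 0}" by blast
  moreover have "finite {t. c b + t * H t = 0}"
    using b by (intro polyfn_finite_zeros[of _ 0] polyfn_intros H) (auto simp: B_def)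
  ultimately have "finite (- {0 :: complex})" by (rule finite_subset)
  then show False using infinite_UNIV_char_0[where 'a = complex] by (simp add: Compl_eq_Diff_UNIV)
qed

lemma digits_less:
  fixes g :: "nat \<Rightarrow> nat"
  assumes "\<And>l. l < n \<Longrightarrow> g l < \<beta>"
  shows "(\<Sum>l<n. \<beta> ^ l * g l) < \<beta> ^ n"
  using assms
proof (induction n)
  case (Suc n)
  then have "(\<Sum>l<n. \<beta> ^ l * g l) < \<beta> ^ n" by simp
  moreover have "\<beta> ^ n * Suc (g n) \<le> \<beta> ^ n * \<beta>" using Suc.prems[of n] by (intro mult_left_mono) auto
  ultimately show ?case by (simp add: algebra_simps)
qed simp

lemma digits_inj:
  fixes g h :: "nat \<Rightarrow> nat"
  assumes "\<And>l. l < n \<Longrightarrow> g l < \<beta>" "\<And>l. l < n \<Longrightarrow> h l < \<beta>"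
    and "(\<Sum>l<n. \<beta> ^ l * g l) = (\<Sum>l<n. \<beta> ^ l * h l)" "l < n"
  shows "g l = h l"
  using assms
proof (induction n arbitrary: l)
  case (Suc n)
  have *: "(\<Sum>l<Suc n. \<beta> ^ l * f l) div \<beta> ^ n = f n \<and> (\<Sum>l<Suc n. \<beta> ^ l * f l) mod \<beta> ^ n = (\<Sum>l<n. \<beta> ^ l * f l)"
    if "\<And>l. l < Suc n \<Longrightarrow> f l < \<beta>" for f :: "nat \<Rightarrow> nat"
  proof -
    have lt: "(\<Sum>l<n. \<beta> ^ l * f l) < \<beta> ^ n" using that by (intro digits_less) simp
    then have "\<beta> ^ n \<noteq> 0" by linarith
    then show ?thesis using lt by simp
  qed
  have "g n = h n" "(\<Sum>l<n. \<beta> ^ l * g l) = (\<Sum>l<n. \<beta> ^ l * h l)"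
    using *[of g] *[of h] Suc.prems(1-3) by metis+
  then show ?case using Suc.IH Suc.prems by (metis less_Suc_eq)
qed simp

lemma inj_on_weighted_digits:
  "inj_on (\<lambda>g. \<Sum>l<n. ((b + 1) ^ n + (b + 1) ^ l) * g l) (box_exps n b)"
proof (rule inj_onI)
  fix g h assume gh: "g \<in> box_exps n b" "h \<in> box_exps n b"
    and eq: "(\<Sum>l<n. ((b + 1) ^ n + (b + 1) ^ l) * g l) = (\<Sum>l<n. ((b + 1) ^ n + (b + 1) ^ l) * h l)"
  have lt: "g l < b + 1" "h l < b + 1" if "l < n" for l using gh that by (auto simp: less_Suc_eq_le)
  have md: "(\<Sum>l<n. ((b + 1) ^ n + (b + 1) ^ l) * f l) mod (b + 1) ^ n = (\<Sum>l<n. (b + 1) ^ l * f l)"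
    if "\<And>l. l < n \<Longrightarrow> f l < b + 1" for f :: "nat \<Rightarrow> nat"
  proof -
    have "(\<Sum>l<n. ((b + 1) ^ n + (b + 1) ^ l) * f l)
        = (b + 1) ^ n * (\<Sum>l<n. f l) + (\<Sum>l<n. (b + 1) ^ l * f l)"
      by (simp only: distrib_right sum.distrib sum_distrib_left)
    moreover have "(\<Sum>l<n. (b + 1) ^ l * f l) < (b + 1) ^ n" by (rule digits_less[OF that])
    ultimately show ?thesis by (metis mod_less mod_mult_self4)
  qed
  from arg_cong[OF eq, of "\<lambda>x. x mod (b + 1) ^ n"]
  have "(\<Sum>l<n. (b + 1) ^ l * g l) = (\<Sum>l<n. (b + 1) ^ l * h l)"
    by (simp only: md lt)
  then have "g l = h l" if "l < n" for l using digits_inj[of n g "b + 1" h l] lt that by blast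
  then show "g = h" using gh by (intro PiE_ext[of g _ _ h]) auto
qed

text \<open>
  If \<open>\<Psi>\<close> has values in the cone over \<open>S\<close>, and its value \<open>P 0\<close> and its \<open>K\<close>
  partial derivatives at \<open>0\<close> are linearly independent, then \<open>S\<close> has dimension at least
  \<open>K\<close>. The chain consists of the closures of the images of the coordinate subspaces spanned
  by the first \<open>j\<close> parameters. It is strict: let \<open>lin 0, \<dots>, lin (j + 1)\<close> be linear forms
  dual to the first \<open>j + 2\<close> of the vectors \<open>P\<close>. By counting, some nontrivial homogeneous
  polynomial in them vanishes on the image of \<open>j\<close> parameters. It does not vanish on the curve
  in which the parameter \<open>l\<close> is \<open>t\<close> to the power \<open>\<Gamma> + \<beta> ^ l\<close>: as
  \<open>\<beta> ^ l < \<Gamma>\<close>, the terms of \<open>\<Psi>\<close> of degree at least two do not affect leading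
  terms, and the orders of the monomials are pairwise distinct, because the exponents of
  \<open>lin 1, \<dots>, lin (j + 1)\<close> are at most \<open>b = \<beta> - 1\<close>, hence digits to base
  \<open>\<beta>\<close>.
\<close>
lemma krull_dim_ge_parameters:
  fixes \<Psi> :: "(nat \<Rightarrow> complex) \<Rightarrow> 'i \<Rightarrow> complex"
  assumes I: "finite I" and S: "S \<subseteq> proj_space I"
    and \<Psi>I: "\<And>w. \<Psi> w \<in> coord_space I"
    and \<Psi>: "\<And>w i. i \<in> I \<Longrightarrow> \<Psi> w i = P 0 i + (\<Sum>l<K. w l * P (Suc l) i) + Q i w"
    and Q: "\<And>i. i \<in> I \<Longrightarrow> Q i \<in> box_polys {..<K} D 2"
    and P: "fam_indep {..K} I P"
    and inS: "\<And>w. \<Psi> w \<noteq> (\<lambda>_. 0) \<Longrightarrow> proj_point (\<Psi> w) \<in> S"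
  shows "enat K \<le> krull_dim (subtopology (zariski I) S)"
proof -
  define A where "A j = {\<Psi> w | w. \<forall>l\<ge>j. w l = 0}" for j
  define C where "C j = proj_point ` (A j - {\<lambda>_. 0})" for j
  define Z where "Z j = S \<inter> zariski I closure_of (C j)" for j
  have AI: "A j \<subseteq> coord_space I" for j using \<Psi>I by (auto simp: A_def)
  have CS: "C j \<subseteq> S" for j using inS by (auto simp: C_def A_def)
  have CP: "C j \<subseteq> proj_space I" for j using CS S by blast
  have Amono: "A j \<subseteq> A (Suc j)" for j unfolding A_def by fastforce
  have box: "(\<lambda>w. \<Psi> w i) \<in> box_polys {..<K} (Suc D) 0" if "i \<in> I" for i
  proof -
    have "(\<lambda>w. P 0 i + (\<Sum>l<K. P (Suc l) i * w l) + Q i w) \<in> box_polys {..<K} (Suc D) 0"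
    proof (intro box_polys_add box_polys_sum box_polys_scale)
      show "(\<lambda>w. w l) \<in> box_polys {..<K} (Suc D) 0" if "l \<in> {..<K}" for l
        using that by (intro box_polys_mono[OF box_polys_var]) auto
      show "Q i \<in> box_polys {..<K} (Suc D) 0" using Q[OF that] by (rule box_polys_mono) auto
    qed (rule box_polys_const)
    then show ?thesis using \<Psi>[OF that] by (simp add: mult.commute)
  qed
  obtain L where L: "\<And>a b. a \<le> K \<Longrightarrow> b \<le> K \<Longrightarrow> (\<Sum>i\<in>I. L a i * P b i) = (if a = b then 1 else 0)"
    using fam_indep_dual[OF _ I P] by auto
  define lin where "lin a x = (\<Sum>i\<in>I. L a i * x i)" for a x
  have lin: "lin a \<in> forms I 1" for a unfolding lin_def by (rule linear_forms[OF I])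
  have irr: "irreducible_space (subtopology (zariski I) (Z j))" if "j \<le> K" for j
    unfolding Z_def C_def
  proof (rule irreducible_space_closure[OF AI])
    show "proj_point ` (A j - {\<lambda>_. 0}) \<subseteq> S" using CS by (simp add: C_def)
    have "lin 0 (\<Psi> (\<lambda>_. 0)) \<noteq> 0"
    proof -
      have "\<exists>R. polyfn R \<and> (\<forall>t. Q i (\<lambda>j. t ^ 1 * 0) = t ^ (1 * 2) * R t)" if "i \<in> I" for i
        using box_polys_order[OF Q[OF that], of "\<lambda>j t. 0" 1] by (simp add: polyfn_const)
      then have "Q i (\<lambda>_. 0) = 0" if "i \<in> I" for i using that
        by (metis mult_zero_left mult_zero_right power_zero_numeral mult_1)
      then have "lin 0 (\<Psi> (\<lambda>_. 0)) = (\<Sum>i\<in>I. L 0 i * P 0 i)"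
        unfolding lin_def by (intro sum.cong) (auto simp: \<Psi>)
      then show ?thesis using L[of 0 0] by simp
    qed
    then have "\<Psi> (\<lambda>_. 0) \<noteq> (\<lambda>_. 0)" by (auto simp: lin_def)
    then show "A j - {\<lambda>_. 0} \<noteq> {}" by (auto simp: A_def)
    fix x y assume "x \<in> A j" "y \<in> A j"
    then obtain w w' where w: "x = \<Psi> w" "y = \<Psi> w'" "\<And>l. l \<ge> j \<Longrightarrow> w l = 0" "\<And>l. l \<ge> j \<Longrightarrow> w' l = 0"
      by (auto simp: A_def)
    define \<omega> where "\<omega> t l = w l + t * (w' l - w l)" for t l
    have "polyfn (\<lambda>t. \<Psi> (\<omega> t) i)" if "i \<in> I" for i
      using box[OF that] unfolding \<omega>_def by (rule box_polys_polyfn) (intro polyfn_intros)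
    moreover have "\<omega> 0 = w" "\<omega> 1 = w'" by (auto simp: \<omega>_def fun_eq_iff)
    then have "\<Psi> (\<omega> 0) = x" "\<Psi> (\<omega> 1) = y" by (simp_all add: w(1,2))
    moreover have "\<Psi> (\<omega> t) \<in> A j" for t using w(3,4) by (auto simp: A_def \<omega>_def)
    ultimately show "\<exists>\<gamma>. \<gamma> 0 = x \<and> \<gamma> 1 = y \<and> (\<forall>t. \<gamma> t \<in> A j) \<and> (\<forall>i\<in>I. polyfn (\<lambda>t. \<gamma> t i))"
      by (intro exI[of _ "\<lambda>t. \<Psi> (\<omega> t)"]) blast
  qed (rule S)
  have strict: "Z j \<subset> Z (Suc j)" if j: "j < K" for j
  proof
    have "C j \<subseteq> C (Suc j)" using Amono by (auto simp: C_def)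
    then show "Z j \<subseteq> Z (Suc j)" unfolding Z_def using closure_of_mono by blast
    define n where "n = Suc j"
    obtain b where b: "b > 0" "(Suc D * n * b + 1) ^ j < (b + 1) ^ n"
      using growth[of j n "Suc D * n"] by (auto simp: n_def)
    define F where "F e x = (\<Prod>a\<le>n. lin a x ^ simplex_exp n b e a)" for e x
    have F: "F e \<in> forms I (n * b)" if "e \<in> box_exps n b" for e
    proof -
      have "F e \<in> forms I (\<Sum>a\<le>n. 1 * simplex_exp n b e a)"
        unfolding F_def by (intro forms_prod forms_power lin)
      then show ?thesis using sum_simplex_exp[OF that] by simp
    qed
    define cut where "cut w l = (if l < j then w l else 0)" for w :: "nat \<Rightarrow> complex" and l
    obtain G where G: "finite G" "card G \<le> (Suc D * (n * b) + 1) ^ card {..<j}"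
      "box_polys {..<j} (Suc D * (n * b)) 0 = cfun.span G"
      using box_polys_finite_span[of "{..<j}"] by (metis finite_lessThan)
    have "\<exists>c. (\<exists>e\<in>box_exps n b. c e \<noteq> 0) \<and> (\<forall>w. (\<Sum>e\<in>box_exps n b. c e * F e (\<Psi> (cut w))) = 0)"
    proof (rule linear_relation_of_card[OF finite_box_exps G(1)])
      show "(\<lambda>w. F e (\<Psi> (cut w))) \<in> cfun.span G" if "e \<in> box_exps n b" for e
        unfolding G(3)[symmetric] cut_def
        using box j by (intro form_box_polys[OF F[OF that]] box_polys_cut[of _ K]) auto
      show "card G < card (box_exps n b)"
        using G(2) b(2) unfolding card_box_exps card_lessThan mult.assoc by linarith
    qed
    then obtain c e0 where c: "e0 \<in> box_exps n b" "c e0 \<noteq> 0"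
      "\<And>w. (\<Sum>e\<in>box_exps n b. c e * F e (\<Psi> (cut w))) = 0" by blast
    define H where "H x = (\<Sum>e\<in>box_exps n b. c e * F e x)" for x
    have H: "H \<in> forms I (n * b)" unfolding H_def using F by (intro forms_sum forms_scale) auto
    have "H x = 0" if xA: "x \<in> A j" for x
    proof -
      obtain w where w: "x = \<Psi> w" "\<And>l. l \<ge> j \<Longrightarrow> w l = 0" using xA by (auto simp: A_def)
      then have "cut w = w" by (auto simp: cut_def fun_eq_iff)
      then show ?thesis using c(3)[of w] by (simp add: H_def w)
    qed
    then have "vanishes_on H (C j)"
      unfolding vanishes_on_def C_def using form_at_proj_point[OF H] AI by blast
    then have vanZ: "vanishes_on H (Z j)"
      using vanishes_on_closure[OF H CP] vanishes_on_subset unfolding Z_def by (metis inf_le2)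
    define \<beta> where "\<beta> = b + 1"
    define \<Gamma> where "\<Gamma> = \<beta> ^ n"
    have \<beta>: "\<beta> \<ge> 2" using b(1) by (simp add: \<beta>_def)
    define \<rho> where "\<rho> l t = (if l < n then t ^ (\<beta> ^ l) else 0)" for l and t :: complex
    define \<omega> where "\<omega> t l = t ^ \<Gamma> * \<rho> l t" for t l
    have \<rho>: "polyfn (\<rho> l)" for l unfolding \<rho>_def by (intro polyfn_intros)
    have "\<forall>i\<in>I. \<exists>R. polyfn R \<and> (\<forall>t. Q i (\<omega> t) = t ^ (\<Gamma> * 2) * R t)"
    proof
      fix i assume "i \<in> I"
      moreover have "\<omega> t = (\<lambda>l. t ^ \<Gamma> * \<rho> l t)" for t by (simp add: \<omega>_def fun_eq_iff)
      ultimately show "\<exists>R. polyfn R \<and> (\<forall>t. Q i (\<omega> t) = t ^ (\<Gamma> * 2) * R t)"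
        using box_polys_order[OF Q, where \<rho> = \<rho> and k = \<Gamma>, OF _ \<rho>] by simp
    qed
    then obtain R where R: "\<And>i. i \<in> I \<Longrightarrow> polyfn (R i)"
      "\<And>i t. i \<in> I \<Longrightarrow> Q i (\<omega> t) = t ^ (\<Gamma> * 2) * R i t" by metis
    define T where "T a t = (\<Sum>i\<in>I. L a i * R i t)" for a t
    have T: "polyfn (T a)" for a unfolding T_def using R(1) by (intro polyfn_intros) auto
    have lin\<Psi>: "lin a (\<Psi> (\<omega> t)) = (if a = 0 then 1 else \<omega> t (a - 1)) + t ^ (\<Gamma> * 2) * T a t"
      if a: "a \<le> n" for a t
    proof -
      have aK: "a \<le> K" using a j by (simp add: n_def)
      have "lin a (\<Psi> (\<omega> t)) = (\<Sum>i\<in>I. L a i * P 0 i + (\<Sum>l<K. \<omega> t l * (L a i * P (Suc l) i))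
          + t ^ (\<Gamma> * 2) * (L a i * R i t))"
        unfolding lin_def
        by (intro sum.cong) (auto simp: \<Psi> R(2) algebra_simps sum_distrib_left)
      also have "\<dots> = (\<Sum>i\<in>I. L a i * P 0 i) + (\<Sum>l<K. \<omega> t l * (\<Sum>i\<in>I. L a i * P (Suc l) i))
          + t ^ (\<Gamma> * 2) * T a t"
        unfolding sum.distrib T_def by (subst sum.swap) (simp add: sum_distrib_left)
      also have "(\<Sum>l<K. \<omega> t l * (\<Sum>i\<in>I. L a i * P (Suc l) i))
          = (\<Sum>l<K. if l = a - 1 \<and> a \<noteq> 0 then \<omega> t (a - 1) else 0)"
        using aK by (intro sum.cong) (auto simp: L)
      also have "\<dots> = (if a = 0 then 0 else \<omega> t (a - 1))" using aK by auto
      finally show ?thesis using L[OF aK, of 0] by simp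
    qed
    define ord where "ord a = (if a = 0 then 0 else \<Gamma> + \<beta> ^ (a - 1))" for a :: nat
    have unit: "unit_order (ord a) (\<lambda>t. lin a (\<Psi> (\<omega> t)))" if a: "a \<le> n" for a
    proof -
      have "ord a < \<Gamma> * 2"
      proof (cases "a = 0")
        case True
        then show ?thesis using \<beta> by (simp add: ord_def \<Gamma>_def)
      next
        case False
        then have "\<beta> ^ (a - 1) < \<beta> ^ n" using a \<beta> by (intro power_strict_increasing) auto
        then show ?thesis using False by (simp add: ord_def \<Gamma>_def)
      qed
      then have ex: "\<Gamma> * 2 = ord a + Suc (\<Gamma> * 2 - Suc (ord a))" by simp
      have main: "(if a = 0 then 1 else \<omega> t (a - 1)) = t ^ ord a" for t
        using a by (auto simp: ord_def \<omega>_def \<rho>_def power_add)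
      have "lin a (\<Psi> (\<omega> t)) = t ^ ord a * (1 + t * (t ^ (\<Gamma> * 2 - Suc (ord a)) * T a t))" for t
        unfolding lin\<Psi>[OF a] main
        by (subst ex) (simp add: power_add algebra_simps del: ex)
      moreover have "polyfn (\<lambda>t. t ^ (\<Gamma> * 2 - Suc (ord a)) * T a t)" using T by (intro polyfn_intros)
      ultimately show ?thesis unfolding unit_order_def by blast
    qed
    have "\<exists>t. (\<Sum>e\<in>box_exps n b. c e * F e (\<Psi> (\<omega> t))) \<noteq> 0"
    proof (rule distinct_orders_nonzero[where \<phi> = "\<lambda>e t. F e (\<Psi> (\<omega> t))" and c = c and a = e0,
          OF finite_box_exps inj_on_weighted_digits _ c(1,2)])
      fix e
      have "unit_order (\<Sum>a\<le>n. ord a * simplex_exp n b e a) (\<lambda>t. F e (\<Psi> (\<omega> t)))"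
        unfolding F_def by (intro unit_order_prod unit_order_power unit) auto
      moreover have "(\<Sum>a\<le>n. ord a * simplex_exp n b e a) = (\<Sum>l<n. ((b + 1) ^ n + (b + 1) ^ l) * e l)"
        by (subst sum.atMost_shift) (simp add: ord_def simplex_exp_def \<Gamma>_def \<beta>_def)
      ultimately show "unit_order (\<Sum>l<n. ((b + 1) ^ n + (b + 1) ^ l) * e l) (\<lambda>t. F e (\<Psi> (\<omega> t)))"
        by simp
    qed
    then obtain t where t: "H (\<Psi> (\<omega> t)) \<noteq> 0" by (auto simp: H_def)
    have "n * b \<noteq> 0" using b(1) by (simp add: n_def)
    then have "H (\<lambda>_. 0) = 0" using form_scale[OF H, of 0 "\<lambda>_. 0"] by (simp add: zero_power)
    then have nz: "\<Psi> (\<omega> t) \<noteq> (\<lambda>_. 0)" using t by metis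
    have "\<Psi> (\<omega> t) \<in> A n" unfolding A_def \<omega>_def \<rho>_def by auto
    then have mem: "proj_point (\<Psi> (\<omega> t)) \<in> C n" using nz by (auto simp: C_def)
    then have "proj_point (\<Psi> (\<omega> t)) \<in> Z n"
      using CS CP closure_of_subset[of "C n" "zariski I"] by (auto simp: Z_def topspace_zariski)
    moreover have "proj_point (\<Psi> (\<omega> t)) \<notin> Z j"
      using vanZ t self_in_proj_point unfolding vanishes_on_def by blast
    ultimately show "Z j \<noteq> Z (Suc j)" by (metis n_def)
  qed
  have "closedin (subtopology (zariski I) S) (Z j)" for j
    unfolding Z_def closedin_subtopology by (metis closedin_closure_of inf_commute)
  moreover have "irreducible_space (subtopology (subtopology (zariski I) S) (Z j))" if "j \<le> K" for j
  proof -
    have "S \<inter> Z j = Z j" by (auto simp: Z_def)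
    then show ?thesis using irr[OF that] by (simp add: subtopology_subtopology)
  qed
  ultimately show ?thesis
    unfolding krull_dim_def using strict by (intro Sup_upper) blast
qed

section \<open>Points with independent tangent spaces\<close>

text \<open>
  The coordinate \<open>(k, p, l)\<close> of the derivative of the sum over \<open>i < s\<close> of
  \<open>u i \<otimes> v i \<otimes> v i\<close> in the direction \<open>(x, y)\<close>.
\<close>
definition tangent_sum :: "nat \<Rightarrow> (nat \<Rightarrow> nat \<Rightarrow> complex) \<Rightarrow> (nat \<Rightarrow> nat \<Rightarrow> complex)
    \<Rightarrow> (nat \<Rightarrow> nat \<Rightarrow> complex) \<Rightarrow> (nat \<Rightarrow> nat \<Rightarrow> complex) \<Rightarrow> nat \<Rightarrow> nat \<Rightarrow> nat \<Rightarrow> complex" where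
  "tangent_sum s u v x y k p l =
     (\<Sum>i<s. x i k * v i p * v i l + u i k * (v i p * y i l + v i l * y i p))"

text \<open>
  The tangent spaces to the affine cone over the Segre-Veronese variety at the \<open>s\<close> points
  \<open>u i \<otimes> v i \<otimes> v i\<close> have the maximal dimension and are independent; here \<open>u i\<close>
  has \<open>m + 1\<close> and \<open>v i\<close> has \<open>N\<close> coordinates. The directions \<open>(u i, 0)\<close> and
  \<open>(0, v i)\<close> have proportional derivatives; requiring \<open>y i\<close> to vanish at one coordinate
  \<open>\<kappa> i\<close> removes this redundancy.
\<close>
definition tangent_indep :: "nat \<Rightarrow> nat \<Rightarrow> nat \<Rightarrow> (nat \<Rightarrow> nat \<Rightarrow> complex)
    \<Rightarrow> (nat \<Rightarrow> nat \<Rightarrow> complex) \<Rightarrow> (nat \<Rightarrow> nat) \<Rightarrow> bool" where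
  "tangent_indep m N s u v \<kappa> \<longleftrightarrow>
     (\<forall>x y. (\<forall>i<s. y i (\<kappa> i) = 0) \<longrightarrow>
        (\<forall>k\<le>m. \<forall>p<N. \<forall>l<N. tangent_sum s u v x y k p l = 0) \<longrightarrow>
        (\<forall>i<s. (\<forall>k\<le>m. x i k = 0) \<and> (\<forall>p<N. y i p = 0)))"

lemma tangent_indepD:
  assumes "tangent_indep m N s u v \<kappa>" "\<And>i. i < s \<Longrightarrow> y i (\<kappa> i) = 0"
    and "\<And>k p l. k \<le> m \<Longrightarrow> p < N \<Longrightarrow> l < N \<Longrightarrow> tangent_sum s u v x y k p l = 0"
    and "i < s"
  shows "k \<le> m \<Longrightarrow> x i k = 0" "p < N \<Longrightarrow> y i p = 0"
  using assms unfolding tangent_indep_def by blast+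

text \<open>
  The coordinate directions allowed in \<open>tangent_indep\<close>, and the tangent vectors belonging
  to them: \<open>Inl a\<close> varies the coordinate \<open>a\<close> of \<open>u i\<close>, and \<open>Inr r\<close> varies
  the coordinate \<open>r\<close> of \<open>v i\<close>.
\<close>
definition tan_index :: "nat \<Rightarrow> nat \<Rightarrow> nat \<Rightarrow> (nat \<Rightarrow> nat) \<Rightarrow> (nat \<times> (nat + nat)) set" where
  "tan_index m N s \<kappa> = Sigma {..<s} (\<lambda>i. {..m} <+> ({..<N} - {\<kappa> i}))"

definition tan_vec :: "(nat \<Rightarrow> nat \<Rightarrow> complex) \<Rightarrow> (nat \<Rightarrow> nat \<Rightarrow> complex)
    \<Rightarrow> nat \<times> (nat + nat) \<Rightarrow> nat \<times> nat \<times> nat \<Rightarrow> complex" where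
  "tan_vec u v = (\<lambda>(i, b) (k, p, l). case b of
     Inl a \<Rightarrow> (if k = a then v i p * v i l else 0)
   | Inr r \<Rightarrow> u i k * (v i p * (if l = r then 1 else 0) + v i l * (if p = r then 1 else 0)))"

lemma finite_tan_index: "finite (tan_index m N s \<kappa>)"
  unfolding tan_index_def by auto

lemma sum_tan_vec:
  assumes "k \<le> m" "p < N" "l < N"
  shows "(\<Sum>b\<in>tan_index m N s \<kappa>. c b * tan_vec u v b (k, p, l))
    = tangent_sum s u v (\<lambda>i a. c (i, Inl a)) (\<lambda>i r. if r = \<kappa> i then 0 else c (i, Inr r)) k p l"
proof -
  have "(\<Sum>b\<in>{..m} <+> ({..<N} - {\<kappa> i}). c (i, b) * tan_vec u v (i, b) (k, p, l))
    = c (i, Inl k) * v i p * v i l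
      + u i k * (v i p * (if l = \<kappa> i then 0 else c (i, Inr l))
               + v i l * (if p = \<kappa> i then 0 else c (i, Inr p)))" for i
  proof -
    have 1: "(\<Sum>a\<le>m. c (i, Inl a) * tan_vec u v (i, Inl a) (k, p, l)) = c (i, Inl k) * v i p * v i l"
    proof -
      have "(\<Sum>a\<le>m. c (i, Inl a) * tan_vec u v (i, Inl a) (k, p, l))
          = (\<Sum>a\<le>m. if a = k then c (i, Inl k) * v i p * v i l else 0)"
        by (intro sum.cong) (auto simp: tan_vec_def)
      then show ?thesis using assms by simp
    qed
    let ?R = "{..<N} - {\<kappa> i}"
    have "(\<Sum>r\<in>?R. c (i, Inr r) * tan_vec u v (i, Inr r) (k, p, l))
        = (\<Sum>r\<in>?R. (if r = l then u i k * v i p * c (i, Inr l) else 0)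
            + (if r = p then u i k * v i l * c (i, Inr p) else 0))"
      by (intro sum.cong) (auto simp: tan_vec_def algebra_simps)
    also have "\<dots> = u i k * (v i p * (if l = \<kappa> i then 0 else c (i, Inr l))
               + v i l * (if p = \<kappa> i then 0 else c (i, Inr p)))"
      using assms by (auto simp: sum.distrib algebra_simps)
    finally show ?thesis using 1
      by (subst sum.Plus) (auto)
  qed
  moreover have "(\<Sum>b\<in>tan_index m N s \<kappa>. c b * tan_vec u v b (k, p, l))
      = (\<Sum>i<s. \<Sum>b\<in>{..m} <+> ({..<N} - {\<kappa> i}). c (i, b) * tan_vec u v (i, b) (k, p, l))"
    unfolding tan_index_def by (subst sum.Sigma) (auto simp: case_prod_beta)
  ultimately show ?thesis unfolding tangent_sum_def by simp
qed

lemma tangent_indep_iff_fam_indep: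
  "tangent_indep m N s u v \<kappa>
    \<longleftrightarrow> fam_indep (tan_index m N s \<kappa>) ({..m} \<times> {..<N} \<times> {..<N}) (tan_vec u v)"
proof
  assume t: "tangent_indep m N s u v \<kappa>"
  show "fam_indep (tan_index m N s \<kappa>) ({..m} \<times> {..<N} \<times> {..<N}) (tan_vec u v)"
    unfolding fam_indep_def
  proof (intro allI impI ballI)
    fix c b
    assume c: "\<forall>j\<in>{..m} \<times> {..<N} \<times> {..<N}. (\<Sum>b\<in>tan_index m N s \<kappa>. c b * tan_vec u v b j) = 0"
      and b: "b \<in> tan_index m N s \<kappa>"
    let ?x = "\<lambda>i a. c (i, Inl a)" and ?y = "\<lambda>i r. if r = \<kappa> i then 0 else c (i, Inr r)"
    have 0: "tangent_sum s u v ?x ?y k p l = 0" if "k \<le> m" "p < N" "l < N" for k p l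
      using c that by (auto simp: sum_tan_vec)
    have z1: "?x i k = 0" if "i < s" "k \<le> m" for i k
      using tangent_indepD(1)[OF t, of ?y ?x, OF _ 0 that(1)] that by auto
    have z2: "c (i, Inr p) = 0" if "i < s" "p < N" "p \<noteq> \<kappa> i" for i p
      using tangent_indepD(2)[OF t, of ?y ?x, OF _ 0 that(1,2)] that by auto
    show "c b = 0" using b z1 z2 by (auto simp: tan_index_def)
  qed
next
  assume f: "fam_indep (tan_index m N s \<kappa>) ({..m} \<times> {..<N} \<times> {..<N}) (tan_vec u v)"
  show "tangent_indep m N s u v \<kappa>"
    unfolding tangent_indep_def
  proof (intro allI impI)
    fix x y :: "nat \<Rightarrow> nat \<Rightarrow> complex" and i
    assume y: "\<forall>i<s. y i (\<kappa> i) = 0" and i: "i < s"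
      and 0: "\<forall>k\<le>m. \<forall>p<N. \<forall>l<N. tangent_sum s u v x y k p l = 0"
    define c where "c = (\<lambda>(i, b). case b of Inl a \<Rightarrow> x i a | Inr r \<Rightarrow> y i r)"
    have "(\<Sum>b\<in>tan_index m N s \<kappa>. c b * tan_vec u v b (k, p, l)) = tangent_sum s u v x y k p l"
      if "k \<le> m" "p < N" "l < N" for k p l
      unfolding sum_tan_vec[OF that] tangent_sum_def using y
      by (intro sum.cong) (auto simp: c_def)
    then have c0: "(\<Sum>b\<in>tan_index m N s \<kappa>. c b * tan_vec u v b j) = 0"
      if "j \<in> {..m} \<times> {..<N} \<times> {..<N}" for j
      using 0 that by auto
    have "c b = 0" if "b \<in> tan_index m N s \<kappa>" for b
      by (rule fam_indepD[OF f c0 that])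
    from this[of "(i, Inl _)"] this[of "(i, Inr _)"]
    show "(\<forall>k\<le>m. x i k = 0) \<and> (\<forall>p<N. y i p = 0)"
      using i y by (auto simp: tan_index_def c_def)
  qed
qed

text \<open>
  The \<open>2 * s\<close> vectors \<open>u i \<otimes> v i\<close> and \<open>T (u i) \<otimes> v i\<close> are independent,
  where \<open>T\<close> is the diagonal matrix with entries \<open>0, \<dots>, m\<close> and only the first \<open>t\<close>
  coordinates of the \<open>v i\<close> are taken into account.
\<close>
definition pencil_indep :: "nat \<Rightarrow> nat \<Rightarrow> nat \<Rightarrow> (nat \<Rightarrow> nat \<Rightarrow> complex)
    \<Rightarrow> (nat \<Rightarrow> nat \<Rightarrow> complex) \<Rightarrow> bool" where
  "pencil_indep m t s u v \<longleftrightarrow>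
     fam_indep ({..<s} \<times> UNIV) ({..m} \<times> {..<t})
       (\<lambda>(i, b) (k, p). (if b then of_nat k else 1) * u i k * v i p)"

lemma pencil_indep_iff:
  "pencil_indep m t s u v \<longleftrightarrow>
     (\<forall>g h. (\<forall>k\<le>m. \<forall>p<t. (\<Sum>i<s. (g i - of_nat k * h i) * u i k * v i p) = 0)
        \<longrightarrow> (\<forall>i<s. g i = 0 \<and> h i = 0))" (is "_ = ?R")
proof -
  have sum_eq: "(\<Sum>b\<in>{..<s} \<times> UNIV. c b
        * (case b of (i, b) \<Rightarrow> \<lambda>(k, p). (if b then of_nat k else 1) * u i k * v i p) (k, p))
      = (\<Sum>i<s. (c (i, False) - of_nat k * (- c (i, True))) * u i k * v i p)"
    for c :: "nat \<times> bool \<Rightarrow> complex" and k p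
    unfolding sum.cartesian_product'
    by (intro sum.cong) (auto simp: UNIV_bool algebra_simps)
  show ?thesis
  proof
    assume ind: "pencil_indep m t s u v"
    show ?R
    proof (intro allI impI)
      fix g h :: "nat \<Rightarrow> complex" and i
      assume 0: "\<forall>k\<le>m. \<forall>p<t. (\<Sum>i<s. (g i - of_nat k * h i) * u i k * v i p) = 0" and i: "i < s"
      define c where "c = (\<lambda>(i, b). if b then - h i else g i)"
      have "c b = 0" if "b \<in> {..<s} \<times> UNIV" for b
      proof (rule fam_indepD[OF ind[unfolded pencil_indep_def] _ that])
        fix j assume "j \<in> {..m} \<times> {..<t}"
        then obtain k p where j: "j = (k, p)" "k \<le> m" "p < t" by auto
        show "(\<Sum>b\<in>{..<s} \<times> UNIV. c b
          * (case b of (i, b) \<Rightarrow> \<lambda>(k, p). (if b then of_nat k else 1) * u i k * v i p) j) = 0"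
          unfolding j(1) sum_eq using 0 j(2,3) by (simp add: c_def)
      qed
      from this[of "(i, True)"] this[of "(i, False)"] show "g i = 0 \<and> h i = 0"
        using i by (simp add: c_def)
    qed
  next
    assume r: ?R
    show "pencil_indep m t s u v"
      unfolding pencil_indep_def fam_indep_def
    proof (intro allI impI ballI)
      fix c :: "nat \<times> bool \<Rightarrow> complex" and b
      assume 0: "\<forall>j\<in>{..m} \<times> {..<t}. (\<Sum>b\<in>{..<s} \<times> UNIV. c b
          * (case b of (i, b) \<Rightarrow> \<lambda>(k, p). (if b then of_nat k else 1) * u i k * v i p) j) = 0"
        and b: "b \<in> {..<s} \<times> (UNIV :: bool set)"
      have "\<forall>k\<le>m. \<forall>p<t. (\<Sum>i<s. (c (i, False) - of_nat k * (- c (i, True))) * u i k * v i p) = 0"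
        unfolding sum_eq[symmetric] using 0 by simp
      then have "\<forall>i<s. c (i, False) = 0 \<and> - c (i, True) = 0"
        by (rule r[THEN spec[of _ "\<lambda>i. c (i, False)"], THEN spec[of _ "\<lambda>i. - c (i, True)"], THEN mp])
      then show "c b = 0" using b by (cases b; cases "snd b") auto
    qed
  qed
qed

lemma pencil_indepD:
  assumes "pencil_indep m t s u v"
    and "\<And>k p. k \<le> m \<Longrightarrow> p < t \<Longrightarrow> (\<Sum>i<s. u i k * v i p * (g i - of_nat k * h i)) = 0"
    and "i < s"
  shows "g i = 0 \<and> h i = 0"
proof -
  have "\<forall>k\<le>m. \<forall>p<t. (\<Sum>i<s. (g i - of_nat k * h i) * u i k * v i p) = 0"
    using assms(2) by (simp add: mult.assoc mult.commute mult.left_commute)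
  then show ?thesis
    using assms(1,3) unfolding pencil_indep_iff by blast
qed

text \<open>
  The inductive step. Two coordinates, \<open>N\<close> and \<open>N + 1\<close>, and \<open>m + 1\<close> points
  \<open>e j \<otimes> b j \<otimes> b j\<close> are adjoined, where \<open>e j\<close> is a basis vector and
  \<open>b j\<close> is \<open>w j\<close> plus the new basis vector \<open>N\<close> plus \<open>j\<close> times the new basis
  vector \<open>N + 1\<close>. The old points are assumed to have coordinates among the first \<open>N\<close>.
  The vectors \<open>w 0\<close> and \<open>w 1\<close> are zero, and the others are the basis vectors beyond
  the first \<open>t\<close>; hence the first \<open>t\<close> coordinates of a relation involve, after elimination
  of the new unknowns, only the old points, and there \<open>pencil_indep\<close> applies.
\<close>
lemma tangent_indep_adjoin:
  fixes u v :: "nat \<Rightarrow> nat \<Rightarrow> complex"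
  assumes m: "m \<ge> 1" and N: "N + 1 = t + m"
    and v0: "\<And>i p. i < s \<Longrightarrow> p \<ge> N \<Longrightarrow> v i p = 0"
    and ti: "tangent_indep m N s u v \<kappa>" and pi: "pencil_indep m t s u v"
    and \<kappa>: "\<And>i. i < s \<Longrightarrow> \<kappa> i < N"
  shows "\<exists>u' v' \<kappa>'. tangent_indep m (N + 2) (s + (m + 1)) u' v' \<kappa>' \<and> (\<forall>i<s + (m + 1). \<kappa>' i < N + 2)"
proof -
  define w :: "nat \<Rightarrow> nat \<Rightarrow> complex" where
    "w j p = (if j \<ge> 2 \<and> p + 2 = t + j then 1 else 0)" for j p
  define b :: "nat \<Rightarrow> nat \<Rightarrow> complex" where
    "b j p = (if p < N then w j p else if p = N then 1 else if p = N + 1 then of_nat j else 0)" for j p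
  define u' where "u' i k = (if i < s then u i k else if k = i - s then 1 else 0)" for i k
  define v' where "v' i p = (if i < s then v i p else b (i - s) p)" for i p
  define \<kappa>' where "\<kappa>' i = (if i < s then \<kappa> i else N)" for i
  have "tangent_indep m (N + 2) (s + (m + 1)) u' v' \<kappa>'"
    unfolding tangent_indep_def
  proof (intro allI impI)
    fix x y :: "nat \<Rightarrow> nat \<Rightarrow> complex" and i0
    assume y\<kappa>: "\<forall>i<s + (m + 1). y i (\<kappa>' i) = 0"
      and 0: "\<forall>k\<le>m. \<forall>p<N + 2. \<forall>l<N + 2. tangent_sum (s + (m + 1)) u' v' x y k p l = 0"
      and i0: "i0 < s + (m + 1)"
    define X where "X j k = x (s + j) k" for j k
    define Y where "Y j p = y (s + j) p" for j p
    have YN: "Y k N = 0" if "k \<le> m" for k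
      using y\<kappa>[rule_format, of "s + k"] that by (simp add: \<kappa>'_def Y_def)
    have rel: "(\<Sum>i<s. x i k * v i p * v i l + u i k * (v i p * y i l + v i l * y i p))
        + (\<Sum>j\<le>m. X j k * b j p * b j l) + (b k p * Y k l + b k l * Y k p) = 0"
      if k: "k \<le> m" "p < N + 2" "l < N + 2" for k p l
    proof -
      have "tangent_sum (s + (m + 1)) u' v' x y k p l
        = (\<Sum>i<s. x i k * v' i p * v' i l + u' i k * (v' i p * y i l + v' i l * y i p))
        + (\<Sum>i = s..<s + (m + 1). x i k * v' i p * v' i l + u' i k * (v' i p * y i l + v' i l * y i p))"
        unfolding tangent_sum_def lessThan_atLeast0
        by (rule sum.atLeastLessThan_concat[symmetric]) auto
      also have "(\<Sum>i<s. x i k * v' i p * v' i l + u' i k * (v' i p * y i l + v' i l * y i p))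
          = (\<Sum>i<s. x i k * v i p * v i l + u i k * (v i p * y i l + v i l * y i p))"
        by (intro sum.cong) (auto simp: u'_def v'_def)
      also have "(\<Sum>i = s..<s + (m + 1). x i k * v' i p * v' i l + u' i k * (v' i p * y i l + v' i l * y i p))
          = (\<Sum>j\<le>m. X j k * b j p * b j l + (if j = k then b k p * Y k l + b k l * Y k p else 0))"
        by (rule sum.reindex_bij_witness[of _ "\<lambda>j. s + j" "\<lambda>i. i - s"])
           (auto simp: u'_def v'_def X_def Y_def)
      also have "\<dots> = (\<Sum>j\<le>m. X j k * b j p * b j l) + (b k p * Y k l + b k l * Y k p)"
        using k by (simp add: sum.distrib)
      finally show ?thesis using 0 k by (simp add: add.assoc)
    qed
    have vN: "v i N = 0" "v i (Suc N) = 0" if "i < s" for i using v0 that by auto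
    have bN: "b j N = 1" "b j (Suc N) = of_nat j" for j by (auto simp: b_def)
    have bw: "b j p = w j p" if "p < N" for j p using that by (auto simp: b_def)
    \<comment> \<open>The coordinates of the relation that involve \<open>N\<close> or \<open>N + 1\<close>.\<close>
    have e1: "(\<Sum>j\<le>m. X j k) = 0" if "k \<le> m" for k
      using rel[of k N N] that YN by (simp add: vN bN)
    have e2: "(\<Sum>j\<le>m. X j k * of_nat j) + Y k (Suc N) = 0" if "k \<le> m" for k
      using rel[of k N "Suc N"] that YN by (simp add: vN bN)
    have e3: "(\<Sum>j\<le>m. X j k * of_nat j * of_nat j) + 2 * of_nat k * Y k (Suc N) = 0" if "k \<le> m" for k
      using rel[of k "Suc N" "Suc N"] that by (simp add: vN bN mult.assoc)
    have e4: "(\<Sum>i<s. u i k * v i p * y i N) + (\<Sum>j\<le>m. X j k * w j p) + Y k p = 0"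
      if "k \<le> m" "p < N" for k p
      using rel[of k p N] that YN by (simp add: vN bN bw mult.assoc)
    have e5: "(\<Sum>i<s. u i k * v i p * y i (Suc N)) + (\<Sum>j\<le>m. X j k * w j p * of_nat j)
        + (w k p * Y k (Suc N) + of_nat k * Y k p) = 0"
      if "k \<le> m" "p < N" for k p
      using rel[of k p "Suc N"] that by (simp add: vN bN bw mult.assoc)
    define c where "c k j = X j k * (of_nat j - of_nat k)" for k j
    have c_sum: "(\<Sum>j\<le>m. c k j) = - Y k (Suc N)" if "k \<le> m" for k
    proof -
      have "(\<Sum>j\<le>m. c k j) = (\<Sum>j\<le>m. X j k * of_nat j) - of_nat k * (\<Sum>j\<le>m. X j k)"
        by (simp add: c_def sum_distrib_left sum_subtractf algebra_simps)
      then show ?thesis using e1[OF that] e2[OF that] by (simp add: eq_neg_iff_add_eq_0)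
    qed
    have c_sum2: "(\<Sum>j\<le>m. c k j * (of_nat j - of_nat k)) = 0" if "k \<le> m" for k
    proof -
      have "(\<Sum>j\<le>m. c k j * (of_nat j - of_nat k))
        = (\<Sum>j\<le>m. X j k * of_nat j * of_nat j) - 2 * of_nat k * (\<Sum>j\<le>m. X j k * of_nat j)
          + of_nat k * of_nat k * (\<Sum>j\<le>m. X j k)"
        by (simp add: c_def sum_distrib_left sum_subtractf sum.distrib algebra_simps)
      also have "\<dots> = - 2 * of_nat k * (Y k (Suc N) + (\<Sum>j\<le>m. X j k * of_nat j))"
        unfolding e3[OF that, folded eq_neg_iff_add_eq_0] e1[OF that] by (simp add: distrib_left)
      finally show ?thesis using e2[OF that] by (simp add: add.commute)
    qed
    \<comment> \<open>Subtracting \<open>k\<close> times \<open>e4\<close> from \<open>e5\<close> eliminates the unknowns \<open>Y k p\<close>.\<close>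
    have e6: "(\<Sum>i<s. u i k * v i p * (y i (Suc N) - of_nat k * y i N)) + (\<Sum>j\<le>m. c k j * w j p)
        = w k p * (\<Sum>j\<le>m. c k j)" if k: "k \<le> m" "p < N" for k p
    proof -
      have "(\<Sum>i<s. u i k * v i p * (y i (Suc N) - of_nat k * y i N)) + (\<Sum>j\<le>m. c k j * w j p)
        = ((\<Sum>i<s. u i k * v i p * y i (Suc N)) + (\<Sum>j\<le>m. X j k * w j p * of_nat j))
         - of_nat k * ((\<Sum>i<s. u i k * v i p * y i N) + (\<Sum>j\<le>m. X j k * w j p))"
        by (simp add: c_def sum_distrib_left sum_subtractf sum.distrib algebra_simps)
      also have "\<dots> = - (w k p * Y k (Suc N) + of_nat k * Y k p) + of_nat k * Y k p"
        unfolding e4[OF k, folded eq_neg_iff_add_eq_0] e5[OF k, folded eq_neg_iff_add_eq_0] by simp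
      finally show ?thesis using c_sum[OF k(1)] by simp
    qed
    have w0: "w j p = 0" if "p < t" for j p using that by (auto simp: w_def)
    have old: "y i (Suc N) = 0 \<and> y i N = 0" if "i < s" for i
    proof (rule pencil_indepD[OF pi _ that])
      fix k p assume "k \<le> m" "p < t"
      then show "(\<Sum>i<s. u i k * v i p * (y i (Suc N) - of_nat k * y i N)) = 0"
        using e6[of k p] N m by (simp add: w0)
    qed
    have c0: "c k j = 0" if k: "k \<le> m" and "j \<le> m" for k j
    proof -
      have ge2: "c k j = (if j = k then \<Sum>j\<le>m. c k j else 0)" if j: "2 \<le> j" "j \<le> m" for j
      proof -
        have p: "t + j - 2 < N" using j N by auto
        have wj: "w i (t + j - 2) = (if i = j then 1 else 0)" for i
          using j by (auto simp: w_def)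
        have "(\<Sum>i\<le>m. c k i * w i (t + j - 2)) = (\<Sum>i\<le>m. if i = j then c k j else 0)"
          by (intro sum.cong) (auto simp: wj)
        then show ?thesis using e6[OF k p] old j by (simp add: wj)
      qed
      have kk: "c k k = 0" by (simp add: c_def)
      have C: "2 \<le> k \<Longrightarrow> (\<Sum>j\<le>m. c k j) = 0" using ge2[of k] k kk by simp
      then have ge2': "c k j = 0" if "2 \<le> j" "j \<le> m" for j using ge2[OF that] that by auto
      have two: "(\<Sum>j\<le>m. f j) = f 0 + f 1" if "\<And>j. 2 \<le> j \<Longrightarrow> j \<le> m \<Longrightarrow> f j = 0"
        for f :: "nat \<Rightarrow> complex"
      proof -
        have "(\<Sum>j\<le>m. f j) = (\<Sum>j\<in>{0, 1}. f j)"
        proof (rule sum.mono_neutral_right)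
          show "\<forall>i\<in>{..m} - {0, 1}. f i = 0"
          proof
            fix i assume "i \<in> {..m} - {0, 1}"
            then have "2 \<le> i" "i \<le> m" by auto
            then show "f i = 0" by (rule that)
          qed
        qed (use m in auto)
        then show ?thesis by simp
      qed
      have s2: "c k 0 * (- of_nat k) + c k 1 * (1 - of_nat k) = 0"
        using c_sum2[OF k] two[of "\<lambda>j. c k j * (of_nat j - of_nat k)"] ge2' by simp
      have "c k 0 = 0 \<and> c k 1 = 0"
      proof (cases "k < 2")
        case True
        then consider "k = 0" | "k = 1" by linarith
        then show ?thesis using s2 kk by cases auto
      next
        case False
        then have "c k 0 + c k 1 = 0" using C two[of "c k"] ge2' by simp
        then have "c k 1 = - c k 0" by (simp add: eq_neg_iff_add_eq_0 add.commute)
        then show ?thesis using s2 by (simp add: algebra_simps)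
      qed
      then show ?thesis using ge2'[of j] \<open>j \<le> m\<close> by (metis One_nat_def less_2_cases not_le)
    qed
    have X0: "X j k = 0" if k: "k \<le> m" and "j \<le> m" for k j
    proof -
      have ne: "X j k = 0" if "j \<noteq> k" "j \<le> m" for j using c0[OF k that(2)] that(1) by (simp add: c_def)
      have "(\<Sum>j\<le>m. X j k) = X k k + (\<Sum>j\<in>{..m} - {k}. X j k)"
        using k by (intro sum.remove) auto
      then have "X k k = 0" using e1[OF k] ne by simp
      then show ?thesis using ne[of j] that(2) by (cases "j = k") auto
    qed
    have Y0: "Y k p = 0" if k: "k \<le> m" and p: "p < N + 2" for k p
    proof -
      consider "p < N" | "p = N" | "p = Suc N" using p by linarith
      then show ?thesis
      proof cases
        case 1
        then show ?thesis using e4[OF k 1] old X0[OF k] by simp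
      next
        case 2
        then show ?thesis using YN k by simp
      next
        case 3
        then show ?thesis using e2[OF k] X0[OF k] by simp
      qed
    qed
    have 0: "tangent_sum s u v x y k p l = 0" if "k \<le> m" "p < N" "l < N" for k p l
      using rel[of k p l] X0 Y0 that by (simp add: tangent_sum_def)
    have \<kappa>0: "y i (\<kappa> i) = 0" if "i < s" for i
      using y\<kappa>[rule_format, of i] that by (simp add: \<kappa>'_def)
    have "(\<forall>k\<le>m. x i0 k = 0) \<and> (\<forall>p<N + 2. y i0 p = 0)" if "i0 < s"
      using tangent_indepD[OF ti \<kappa>0 0 that] old[OF that] by (auto simp: less_Suc_eq)
    moreover have "(\<forall>k\<le>m. x i0 k = 0) \<and> (\<forall>p<N + 2. y i0 p = 0)" if "\<not> i0 < s"
      using X0[of _ "i0 - s"] Y0[of "i0 - s"] i0 that by (auto simp: X_def Y_def)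
    ultimately show "(\<forall>k\<le>m. x i0 k = 0) \<and> (\<forall>p<N + 2. y i0 p = 0)" by blast
  qed
  moreover have "\<forall>i<s + (m + 1). \<kappa>' i < N + 2" using \<kappa> by (auto simp: \<kappa>'_def less_Suc_eq)
  ultimately show ?thesis by blast
qed


text \<open>
  Number the cells of a grid with \<open>t\<close> rows and \<open>m + 1\<close> columns row by row, and let
  the point \<open>i\<close> occupy the cells \<open>2 * i\<close> and \<open>2 * i + 1\<close>: \<open>u i\<close> is the sum
  of the basis vectors of the two columns and \<open>v i\<close> that of the two rows (twice a basis vector
  if the rows agree). Since \<open>T\<close> has distinct eigenvalues and the columns differ, the plane
  spanned by \<open>u i\<close> and \<open>T (u i)\<close> is spanned by the two basis vectors.
\<close>
lemma exists_pencil_indep: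
  assumes m: "m \<ge> 1"
  shows "\<exists>u v. pencil_indep m t (((m + 1) * t) div 2) u v"
proof -
  define M where "M = m + 1"
  define u :: "nat \<Rightarrow> nat \<Rightarrow> complex" where
    "u i k = (if k = (2 * i) mod M then 1 else 0) + (if k = Suc (2 * i) mod M then 1 else 0)" for i k
  define v :: "nat \<Rightarrow> nat \<Rightarrow> complex" where
    "v i r = (if r = (2 * i) div M then 1 else 0) + (if r = Suc (2 * i) div M then 1 else 0)" for i r
  have M: "M \<ge> 2" using m by (simp add: M_def)
  let ?cross = "\<lambda>i. Suc (2 * i) div M \<noteq> (2 * i) div M"
  have cross: "(2 * i) mod M = m" "Suc (2 * i) mod M = 0" "Suc (2 * i) div M = Suc ((2 * i) div M)"
      "odd M" if "?cross i" for i
  proof -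
    show 0: "Suc (2 * i) mod M = 0" and "Suc (2 * i) div M = Suc ((2 * i) div M)"
      using that by (auto simp: div_Suc split: if_splits)
    then show "(2 * i) mod M = m" by (auto simp: mod_Suc M_def split: if_splits)
    show "odd M" using 0 by (metis dvd_trans even_Suc even_mult_iff even_numeral mod_eq_0_iff_dvd)
  qed
  have cols: "Suc (2 * i) mod M \<noteq> (2 * i) mod M" for i using M by (auto simp: mod_Suc)
  have cell: "r * M + k \<in> {2 * i, Suc (2 * i)}" if "\<not> ?cross i" "u i k \<noteq> 0" "v i r \<noteq> 0" for i k r
  proof -
    have "r = (2 * i) div M" using that(1,3) by (auto simp: v_def split: if_splits)
    moreover have "k = (2 * i) mod M \<or> k = Suc (2 * i) mod M"
      using that(2) by (auto simp: u_def split: if_splits)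
    ultimately show ?thesis using that(1) by (metis div_mult_mod_eq insert_iff)
  qed
  have "pencil_indep m t ((M * t) div 2) u v"
    unfolding pencil_indep_iff
  proof (intro allI impI)
    fix g h :: "nat \<Rightarrow> complex" and i0
    assume 0: "\<forall>k\<le>m. \<forall>p<t. (\<Sum>i<(M * t) div 2. (g i - of_nat k * h i) * u i k * v i p) = 0"
      and i0: "i0 < (M * t) div 2"
    define G where "G i k = g i - of_nat k * h i" for i k
    have rel: "G i k = 0" if i: "i < (M * t) div 2" and kr: "k = c mod M" "r = c div M"
      and c: "c = 2 * i \<or> c = Suc (2 * i)"
      and other: "\<And>j. j < (M * t) div 2 \<Longrightarrow> j \<noteq> i \<Longrightarrow> G j k = 0 \<or> u j k = 0 \<or> v j r = 0"
    for i k r c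
    proof -
      have "c < t * M" using i c by (auto simp: mult.commute)
      then have "r < t" using kr by (simp add: less_mult_imp_div_less)
      moreover have "k \<le> m" using kr M by (simp add: M_def less_Suc_eq_le[symmetric])
      ultimately have "(\<Sum>i<(M * t) div 2. G i k * u i k * v i r) = 0" using 0 by (simp add: G_def)
      also have "(\<Sum>i<(M * t) div 2. G i k * u i k * v i r)
          = (\<Sum>j<(M * t) div 2. if j = i then G i k * u i k * v i r else 0)"
        using other by (intro sum.cong) auto
      finally have "G i k * u i k * v i r = 0" using i by simp
      moreover have "u i k \<noteq> 0" "v i r \<noteq> 0" using kr c by (auto simp: u_def v_def)
      ultimately show ?thesis by simp
    qed
    have two: "g i = 0 \<and> h i = 0" if "G i ((2 * i) mod M) = 0" "G i (Suc (2 * i) mod M) = 0" for i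
    proof -
      have "of_nat (Suc (2 * i) mod M) * h i = of_nat ((2 * i) mod M) * h i"
        using that unfolding G_def right_minus_eq by metis
      then have "h i = 0" using cols[of i] by (metis mult_right_cancel of_nat_eq_iff)
      then show ?thesis using that(1) by (simp add: G_def)
    qed
    \<comment> \<open>A point occupying cells of two rows is treated first: no other point meets its two cells.\<close>
    have crossing: "g i = 0 \<and> h i = 0" if i: "i < (M * t) div 2" "?cross i" for i
    proof (rule two)
      have other: "u j (c mod M) = 0 \<or> v j (c div M) = 0"
        if c: "c = 2 * i \<or> c = Suc (2 * i)" and "j \<noteq> i" for j c
      proof (cases "?cross j")
        case False
        moreover have "c div M * M + c mod M \<notin> {2 * j, Suc (2 * j)}"
          using c \<open>j \<noteq> i\<close> unfolding div_mult_mod_eq by auto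
        ultimately show ?thesis using cell by blast
      next
        case True
        define a b where "a = (2 * i) div M" and "b = (2 * j) div M"
        have a: "2 * i = a * M + m" using cross(1)[OF i(2)] unfolding a_def by (metis div_mult_mod_eq)
        have b: "2 * j = b * M + m" using cross(1)[OF True] unfolding b_def by (metis div_mult_mod_eq)
        have "odd M" using cross(4)[OF True] .
        have ab: "even a" "even b"
          using a b \<open>odd M\<close> by (metis M_def even_add even_mult_iff dvd_triv_left odd_one)+
        moreover have "a \<noteq> b" using a b \<open>j \<noteq> i\<close> by auto
        ultimately have "a \<noteq> b" "a \<noteq> Suc b" "Suc a \<noteq> b" by auto
        then show ?thesis
          using c cross[OF i(2)] cross[OF True] by (auto simp: v_def a_def b_def)
      qed
      show "G i ((2 * i) mod M) = 0" "G i (Suc (2 * i) mod M) = 0"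
        using rel[OF i(1) refl refl] other by blast+
    qed
    show "g i0 = 0 \<and> h i0 = 0"
    proof (cases "?cross i0")
      case True
      then show ?thesis using crossing i0 by blast
    next
      case False
      have other: "G j (c mod M) = 0 \<or> u j (c mod M) = 0 \<or> v j (c div M) = 0"
        if c: "c = 2 * i0 \<or> c = Suc (2 * i0)" and j: "j \<noteq> i0" "j < (M * t) div 2" for j c
      proof (cases "?cross j")
        case True
        then show ?thesis using crossing[OF j(2)] by (simp add: G_def)
      next
        case False
        moreover have "c div M * M + c mod M \<notin> {2 * j, Suc (2 * j)}"
          using c j(1) unfolding div_mult_mod_eq by auto
        ultimately show ?thesis using cell by blast
      qed
      show ?thesis using rel[OF i0 refl refl] other by (intro two) blast+
    qed
  qed
  then show ?thesis unfolding M_def by blast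
qed

text \<open>
  Both conditions are open, so if each has a solution then the line through the two solutions
  contains a common one.
\<close>
lemma exists_tangent_and_pencil_indep:
  assumes "tangent_indep m N s u0 v0 \<kappa>" "pencil_indep m t s u1 v1"
  shows "\<exists>u v. tangent_indep m N s u v \<kappa> \<and> pencil_indep m t s u v"
proof -
  define u where "u c i k = u0 i k + c * (u1 i k - u0 i k)" for c i k
  define v where "v c i k = v0 i k + c * (v1 i k - v0 i k)" for c i k
  have u: "polyfn (\<lambda>c. u c i k)" and v: "polyfn (\<lambda>c. v c i k)" for i k
    unfolding u_def v_def by (intro polyfn_intros)+
  have "u 0 = u0" "v 0 = v0" "u 1 = u1" "v 1 = v1" by (auto simp: u_def v_def fun_eq_iff)
  then have 0: "tangent_indep m N s (u 0) (v 0) \<kappa>" "pencil_indep m t s (u 1) (v 1)"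
    using assms by auto
  have "finite {c. \<not> tangent_indep m N s (u c) (v c) \<kappa>}"
    unfolding tangent_indep_iff_fam_indep
  proof (rule fam_indep_generic[where M = "\<lambda>c. tan_vec (u c) (v c)",
        OF finite_tan_index _ 0(1)[unfolded tangent_indep_iff_fam_indep]])
    fix b :: "nat \<times> (nat + nat)" and j :: "nat \<times> nat \<times> nat"
    obtain k p l where j: "j = (k, p, l)" by (cases j) auto
    show "polyfn (\<lambda>c. tan_vec (u c) (v c) b j)"
      by (cases b; cases "snd b") (auto simp: j tan_vec_def intro!: polyfn_intros u v)
  qed
  moreover have "finite {c. \<not> pencil_indep m t s (u c) (v c)}"
    unfolding pencil_indep_def
  proof (rule fam_indep_generic[where M = "\<lambda>c (i, b) (k, p). (if b then of_nat k else 1) * u c i k * v c i p",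
        OF _ _ 0(2)[unfolded pencil_indep_def]])
    fix b :: "nat \<times> bool" and j :: "nat \<times> nat"
    show "polyfn (\<lambda>c. (case b of (i, b) \<Rightarrow> \<lambda>(k, p). (if b then of_nat k else 1) * u c i k * v c i p) j)"
      by (cases b; cases j) (auto intro!: polyfn_intros u v)
  qed simp
  ultimately have "finite ({c. \<not> tangent_indep m N s (u c) (v c) \<kappa>} \<union> {c. \<not> pencil_indep m t s (u c) (v c)})"
    by simp
  from ex_new_if_finite[OF infinite_UNIV_char_0 this] show ?thesis by blast
qed

text \<open>
  From \<open>t\<close> to \<open>t + 2\<close> the number of points grows by \<open>m + 1\<close>, as in
  \<open>tangent_indep_adjoin\<close>. For \<open>t = 0\<close> there are no points, and for \<open>t = 1\<close> the
  points built from basis vectors suffice.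
\<close>
lemma exists_tangent_indep:
  assumes m: "m \<ge> 1"
  shows "\<exists>u v \<kappa>. tangent_indep m (t + m - 1) (((m + 1) * t) div 2) u v \<kappa>
      \<and> (\<forall>i<((m + 1) * t) div 2. \<kappa> i < t + m - 1)"
proof (induction t rule: induct_nat_012)
  case 0
  show ?case by (simp add: tangent_indep_def)
next
  case 1
  let ?s = "((m + 1) * Suc 0) div 2"
  define u :: "nat \<Rightarrow> nat \<Rightarrow> complex" where "u i k = (if k = i then 1 else 0)" for i k
  have s: "?s \<le> m" using m by auto
  have "tangent_indep m m ?s u u (\<lambda>i. i)"
    unfolding tangent_indep_def
  proof (intro allI impI conjI)
    fix x y :: "nat \<Rightarrow> nat \<Rightarrow> complex" and i
    assume y: "\<forall>i<?s. y i i = 0" and i: "i < ?s"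
      and 0: "\<forall>k\<le>m. \<forall>p<m. \<forall>l<m. tangent_sum ?s u u x y k p l = 0"
    have ts: "tangent_sum ?s u u x y k i l = (if l = i then x i k else 0)
        + (if k < ?s then u k i * y k l + u k l * y k i else 0)" if "k \<le> m" "l < m" for k l
    proof -
      have "tangent_sum ?s u u x y k i l
        = (\<Sum>j<?s. (if j = i then (if l = i then x i k else 0) else 0)
            + (if j = k then u k i * y k l + u k l * y k i else 0))"
        unfolding tangent_sum_def by (intro sum.cong) (auto simp: u_def)
      then show ?thesis using i by (simp add: sum.distrib)
    qed
    show x0: "x i k = 0" if k: "k \<le> m" for k
      using 0[rule_format, of k i i] ts[OF k, of i] i s y k by (auto simp: u_def split: if_splits)
    show "y i p = 0" if "p < m" for p
      using 0[rule_format, of i i p] ts[of i p] i s y that x0[of i] by (auto simp: u_def split: if_splits)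
  qed
  then show ?case using s by (intro exI[of _ u] exI[of _ "\<lambda>i. i"]) auto
next
  case (ge2 t)
  let ?N = "t + m - 1" and ?s = "((m + 1) * t) div 2"
  obtain u0 v0 \<kappa> where t0: "tangent_indep m ?N ?s u0 v0 \<kappa>" and \<kappa>: "\<And>i. i < ?s \<Longrightarrow> \<kappa> i < ?N"
    using ge2(1) by blast
  obtain u1 v1 where "pencil_indep m t ?s u1 v1" using exists_pencil_indep[OF m] by blast
  with exists_tangent_and_pencil_indep[OF t0] obtain u v where
    uv: "tangent_indep m ?N ?s u v \<kappa>" "pencil_indep m t ?s u v" by blast
  define v' where "v' i p = (if p < ?N then v i p else 0)" for i p
  have "tangent_indep m ?N ?s u v' \<kappa>"
    unfolding tangent_indep_def
  proof (intro allI impI)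
    fix x y :: "nat \<Rightarrow> nat \<Rightarrow> complex" and i
    assume y: "\<forall>i<?s. y i (\<kappa> i) = 0" and i: "i < ?s"
      and 0: "\<forall>k\<le>m. \<forall>p<?N. \<forall>l<?N. tangent_sum ?s u v' x y k p l = 0"
    have "tangent_sum ?s u v x y k p l = 0" if "k \<le> m" "p < ?N" "l < ?N" for k p l
      using 0[rule_format, OF that] that by (simp add: tangent_sum_def v'_def)
    from tangent_indepD[OF uv(1) y[rule_format] this i]
    show "(\<forall>k\<le>m. x i k = 0) \<and> (\<forall>p<?N. y i p = 0)" by blast
  qed
  moreover have "pencil_indep m t ?s u v'"
    unfolding pencil_indep_iff
  proof (intro allI impI)
    fix g h :: "nat \<Rightarrow> complex" and i
    assume 0: "\<forall>k\<le>m. \<forall>p<t. (\<Sum>i<?s. (g i - of_nat k * h i) * u i k * v' i p) = 0" and i: "i < ?s"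
    have "p < ?N" if "p < t" for p using that m by simp
    then have "\<forall>k\<le>m. \<forall>p<t. (\<Sum>i<?s. (g i - of_nat k * h i) * u i k * v i p) = 0"
      using 0 by (simp add: v'_def)
    then show "g i = 0 \<and> h i = 0" using uv(2) i unfolding pencil_indep_iff by blast
  qed
  ultimately obtain u' v' \<kappa>' where
    "tangent_indep m (?N + 2) (?s + (m + 1)) u' v' \<kappa>'" "\<forall>i<?s + (m + 1). \<kappa>' i < ?N + 2"
    using tangent_indep_adjoin[OF m, of ?N t ?s v' u \<kappa>] \<kappa> m by (auto simp: v'_def)
  moreover have "?N + 2 = Suc (Suc t) + m - 1" using m by simp
  moreover have "?s + (m + 1) = ((m + 1) * Suc (Suc t)) div 2" by simp
  ultimately show ?case by metis
qed

section \<open>Dimensions of the Segre-Veronese variety and its secant varieties\<close>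

lemma finite_sv_index: "finite (sv_index m n)"
proof (rule finite_subset)
  show "sv_index m n \<subseteq> {..m} \<times> {..n} \<times> {..n}" by (auto simp: sv_index_def)
qed simp

text \<open>
  A sum of \<open>s\<close> vectors in the cone over the Segre-Veronese variety. Scalar coefficients can
  be absorbed in the \<open>x i\<close>.
\<close>
definition sv_sum :: "nat \<Rightarrow> nat \<Rightarrow> nat \<Rightarrow> (nat \<Rightarrow> nat \<Rightarrow> complex) \<Rightarrow> (nat \<Rightarrow> nat \<Rightarrow> complex)
    \<Rightarrow> nat \<times> nat \<times> nat \<Rightarrow> complex" where
  "sv_sum m n s x y = (\<lambda>idx. \<Sum>i<s. sv_map m n (x i) (y i) idx)"

lemma sv_sum_apply:
  "(k, p, l) \<in> sv_index m n \<Longrightarrow> sv_sum m n s x y (k, p, l) = (\<Sum>i<s. x i k * y i p * y i l)"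
  by (simp add: sv_sum_def sv_map_def)

lemma sv_map_coord_space: "sv_map m n x y \<in> coord_space (sv_index m n)"
  by (auto simp: coord_space_def sv_map_def)

lemma sv_sum_coord_space: "sv_sum m n s x y \<in> coord_space (sv_index m n)"
  using sv_map_coord_space by (auto simp: coord_space_def sv_sum_def)

lemma sv_map_scale: "sv_map m n (\<lambda>k. c * x k) y = (\<lambda>idx. c * sv_map m n x y idx)"
  by (auto simp: sv_map_def fun_eq_iff)

text \<open>
  A normal form, up to a common scalar, of a general sum of \<open>s\<close> vectors in the cone: the first
  coordinates of \<open>x 0\<close> and of all \<open>y i\<close> are \<open>1\<close>. The entry
  \<open>w (i, a)\<close> is the coordinate \<open>a\<close> of \<open>x i\<close> for \<open>a \<le> m\<close> and the
  coordinate \<open>a - m\<close> of \<open>y i\<close> for \<open>a > m\<close>; \<open>w (0, 0)\<close> is not used.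
\<close>
definition norm_x :: "(nat \<times> nat \<Rightarrow> complex) \<Rightarrow> nat \<Rightarrow> nat \<Rightarrow> complex" where
  "norm_x w i k = (if i = 0 \<and> k = 0 then 1 else w (i, k))"

definition norm_y :: "nat \<Rightarrow> (nat \<times> nat \<Rightarrow> complex) \<Rightarrow> nat \<Rightarrow> nat \<Rightarrow> complex" where
  "norm_y m w i p = (if p = 0 then 1 else w (i, m + p))"

text \<open>
  Every sum is a limit of multiples of normalised ones, so the normalised sums are enough to test
  the vanishing of a form.
\<close>
lemma form_vanishes_on_sv_sums:
  assumes F: "F \<in> forms (sv_index m n) d"
    and 0: "\<And>w. F (sv_sum m n s (norm_x w) (norm_y m w)) = 0" and s: "s \<ge> 1"
  shows "F (sv_sum m n s x y) = 0"
proof (rule ccontr)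
  assume nz: "F (sv_sum m n s x y) \<noteq> 0"
  \<comment> \<open>A perturbation makes the coordinates to be normalised nonzero.\<close>
  define X where "X t i k = (if i = 0 \<and> k = 0 then x i k + t else x i k)" for t i k
  define Y where "Y t i p = (if p = 0 then y i p + t else y i p)" for t i p
  have X: "polyfn (\<lambda>t. X t i k)" and Y: "polyfn (\<lambda>t. Y t i k)" for i k
    unfolding X_def Y_def by (intro polyfn_intros)+
  have "X 0 = x" "Y 0 = y" by (auto simp: X_def Y_def fun_eq_iff)
  then have nz': "F (sv_sum m n s (X 0) (Y 0)) \<noteq> 0" using nz by simp
  have "polyfn (\<lambda>t. F (sv_sum m n s (X t) (Y t)))"
  proof (rule form_polyfn[OF F])
    fix idx assume idx: "idx \<in> sv_index m n"
    obtain k p l where kpl: "idx = (k, p, l)" by (cases idx) auto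
    show "polyfn (\<lambda>t. sv_sum m n s (X t) (Y t) idx)"
      using idx unfolding kpl by (simp add: sv_sum_apply) (intro polyfn_intros X Y)
  qed
  then have "finite {t. F (sv_sum m n s (X t) (Y t)) = 0}"
    by (rule polyfn_finite_zeros) (rule nz')
  then have "finite ({t. F (sv_sum m n s (X t) (Y t)) = 0} \<union> {- x 0 0} \<union> (\<lambda>i. - y i 0) ` {..<s})"
    by simp
  from ex_new_if_finite[OF infinite_UNIV_char_0 this] obtain t where
    t: "F (sv_sum m n s (X t) (Y t)) \<noteq> 0" "t \<noteq> - x 0 0" "\<And>i. i < s \<Longrightarrow> t \<noteq> - y i 0" by blast
  have x0: "X t 0 0 \<noteq> 0" using t(2) by (auto simp: X_def add_eq_0_iff)
  have y0: "Y t i 0 \<noteq> 0" if "i < s" for i using t(3)[OF that] by (auto simp: Y_def add_eq_0_iff)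
  define c where "c = X t 0 0 * (Y t 0 0)\<^sup>2"
  have c: "c \<noteq> 0" using x0 y0 s by (simp add: c_def)
  define w where "w = (\<lambda>(i, a). if a \<le> m then X t i a * (Y t i 0)\<^sup>2 / c else Y t i (a - m) / Y t i 0)"
  have "sv_sum m n s (X t) (Y t) idx = c * sv_sum m n s (norm_x w) (norm_y m w) idx" for idx
  proof (cases "idx \<in> sv_index m n")
    case True
    obtain k p l where kpl: "idx = (k, p, l)" by (cases idx) auto
    have k: "k \<le> m" using True by (simp add: kpl sv_index_def)
    have wx: "c * norm_x w i k = X t i k * (Y t i 0)\<^sup>2" if "i < s" for i
      using k c by (auto simp: norm_x_def w_def c_def)
    have wy: "norm_y m w i p * Y t i 0 = Y t i p" if "i < s" for i p
      using y0[OF that] by (auto simp: norm_y_def w_def)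
    have "(\<Sum>i<s. X t i k * Y t i p * Y t i l) = c * (\<Sum>i<s. norm_x w i k * norm_y m w i p * norm_y m w i l)"
      unfolding sum_distrib_left
    proof (intro sum.cong refl)
      fix i assume "i \<in> {..<s}"
      then have i: "i < s" by simp
      have "c * (norm_x w i k * norm_y m w i p * norm_y m w i l)
        = X t i k * (norm_y m w i p * Y t i 0) * (norm_y m w i l * Y t i 0)"
        using wx[OF i] by (simp add: power2_eq_square mult.assoc[symmetric])
      then show "X t i k * Y t i p * Y t i l = c * (norm_x w i k * norm_y m w i p * norm_y m w i l)"
        by (simp add: wy[OF i])
    qed
    then show ?thesis using True by (simp add: kpl sv_sum_apply)
  next
    case False
    then have "sv_sum m n s a b idx = 0" for a b
      using sv_sum_coord_space[of m n s a b] unfolding coord_space_def by blast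
    then show ?thesis by simp
  qed
  then have "F (sv_sum m n s (X t) (Y t)) = F (\<lambda>idx. c * sv_sum m n s (norm_x w) (norm_y m w) idx)"
    by (intro arg_cong[of _ _ F] ext)
  also have "\<dots> = c ^ d * F (sv_sum m n s (norm_x w) (norm_y m w))" by (rule form_scale[OF F])
  finally show False using 0 t(1) by simp
qed

lemma krull_dim_le_of_sv_sums:
  assumes s: "s \<ge> 1" and S: "S \<subseteq> proj_space (sv_index m n)"
    and van: "\<And>F d. F \<in> forms (sv_index m n) d \<Longrightarrow> (\<And>x y. F (sv_sum m n s x y) = 0) \<Longrightarrow> vanishes_on F S"
  shows "krull_dim (subtopology (zariski (sv_index m n)) S) \<le> enat (s * (m + n + 1) - 1)"
proof -
  define J where "J = ({..<s} \<times> {..m + n}) - {(0, 0)}"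
  have J: "finite J" by (simp add: J_def)
  have cardJ: "card J = s * (m + n + 1) - 1"
    using s by (simp add: J_def card_Diff_subset)
  have "krull_dim (subtopology (zariski (sv_index m n)) S) \<le> enat (card J)"
  proof (rule krull_dim_le_card_parameters[OF finite_sv_index J S,
        where \<Phi> = "\<lambda>w. sv_sum m n s (norm_x w) (norm_y m w)"])
    fix idx assume idx: "idx \<in> sv_index m n"
    obtain k p l where kpl: "idx = (k, p, l)" by (cases idx) auto
    have bnd: "k \<le> m" "p \<le> n" "l \<le> n" using idx by (auto simp: kpl sv_index_def)
    have var: "(\<lambda>w. w j) \<in> box_polys J 1 0" if "j \<in> J" for j
      using box_polys_mono[OF box_polys_var[OF J that]] by simp
    have x: "(\<lambda>w. norm_x w i k) \<in> box_polys J 1 0" if "i < s" for i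
      using var[of "(i, k)"] box_polys_const[of 1 J 1] that bnd
      by (cases "i = 0 \<and> k = 0") (auto simp: norm_x_def J_def)
    have y: "(\<lambda>w. norm_y m w i p) \<in> box_polys J 1 0" if "i < s" "p \<le> n" for i p
      using var[of "(i, m + p)"] box_polys_const[of 1 J 1] that
      by (cases "p = 0") (auto simp: norm_y_def J_def)
    have "(\<lambda>w. \<Sum>i<s. norm_x w i k * norm_y m w i p * norm_y m w i l) \<in> box_polys J (1 + 1 + 1) (0 + 0 + 0)"
      using bnd by (intro box_polys_sum box_polys_mult x y) auto
    then show "(\<lambda>w. sv_sum m n s (norm_x w) (norm_y m w) idx) \<in> box_polys J 3 0"
      using idx by (simp add: kpl sv_sum_apply numeral_3_eq_3)
  next
    fix F d assume F: "F \<in> forms (sv_index m n) d"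
      and 0: "\<And>w. F (sv_sum m n s (norm_x w) (norm_y m w)) = 0"
    show "vanishes_on F S"
      using form_vanishes_on_sv_sums[OF F 0 s] by (rule van[OF F])
  qed
  then show ?thesis by (simp add: cardJ)
qed

lemma krull_dim_segre_veronese_le:
  "krull_dim (subtopology (zariski (sv_index m n)) (segre_veronese m n)) \<le> enat (m + n)"
proof -
  have "krull_dim (subtopology (zariski (sv_index m n)) (segre_veronese m n)) \<le> enat (1 * (m + n + 1) - 1)"
  proof (rule krull_dim_le_of_sv_sums[OF order_refl segre_veronese_subset])
    fix F d assume F: "F \<in> forms (sv_index m n) d" and 0: "\<And>x y. F (sv_sum m n 1 x y) = 0"
    show "vanishes_on F (segre_veronese m n)"
      unfolding vanishes_on_def
    proof (intro ballI)
      fix p z assume "p \<in> segre_veronese m n" "z \<in> p"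
      then obtain x y c where z: "z = (\<lambda>i. c * sv_map m n x y i)"
        unfolding segre_veronese_def proj_point_def by blast
      have "F (sv_map m n x y) = 0" using 0[of "\<lambda>_. x" "\<lambda>_. y"] by (simp add: sv_sum_def)
      then show "F z = 0" unfolding z form_scale[OF F] by simp
    qed
  qed
  then show ?thesis by simp
qed

lemma span_proj_points:
  fixes v :: "nat \<Rightarrow> 'i \<Rightarrow> complex"
  assumes "z \<in> cfun.span (\<Union>i<s. proj_point (v i))"
  shows "\<exists>a. z = (\<lambda>b. \<Sum>i<s. a i * v i b)"
  using assms
proof (induction rule: cfun.span_induct_alt)
  case base
  show ?case by (intro exI[of _ "\<lambda>_. 0"]) (simp add: fun_eq_iff)
next
  case (step c x z)
  then obtain j e where j: "j < s" "x = (\<lambda>b. e * v j b)" by (auto simp: proj_point_def)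
  obtain a where a: "z = (\<lambda>b. \<Sum>i<s. a i * v i b)" using step by blast
  have "c * x b + z b = (\<Sum>i<s. (a i + (if i = j then c * e else 0)) * v i b)" for b
  proof -
    have "(\<Sum>i<s. (a i + (if i = j then c * e else 0)) * v i b)
        = (\<Sum>i<s. a i * v i b + (if i = j then c * e * v j b else 0))"
      by (intro sum.cong) (auto simp: algebra_simps)
    then show ?thesis using j by (simp add: a sum.distrib)
  qed
  then show ?case by (intro exI[of _ "\<lambda>i. a i + (if i = j then c * e else 0)"]) (simp add: fun_eq_iff)
qed

lemma krull_dim_secant_variety_le:
  assumes s: "s \<ge> 1"
  shows "krull_dim (subtopology (zariski (sv_index m n)) (secant_variety (sv_index m n) s (segre_veronese m n)))
    \<le> enat (s * (m + n + 1) - 1)"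
proof (rule krull_dim_le_of_sv_sums[OF s])
  let ?I = "sv_index m n"
  show "secant_variety ?I s (segre_veronese m n) \<subseteq> proj_space ?I"
    unfolding secant_variety_def using closure_of_subset_topspace by (metis topspace_zariski)
  fix F d assume F: "F \<in> forms ?I d" and 0: "\<And>x y. F (sv_sum m n s x y) = 0"
  show "vanishes_on F (secant_variety ?I s (segre_veronese m n))"
    unfolding secant_variety_def
  proof (rule vanishes_on_closure[OF F])
    show "(\<Union>p\<in>{..<s} \<rightarrow> segre_veronese m n. linear_span ?I (p ` {..<s})) \<subseteq> proj_space ?I"
      by (auto simp: linear_span_def)
    show "vanishes_on F (\<Union>p\<in>{..<s} \<rightarrow> segre_veronese m n. linear_span ?I (p ` {..<s}))"
      unfolding vanishes_on_def
    proof (intro ballI)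
      fix r z assume r: "r \<in> (\<Union>p\<in>{..<s} \<rightarrow> segre_veronese m n. linear_span ?I (p ` {..<s}))" and z: "z \<in> r"
      then obtain p where p: "p \<in> {..<s} \<rightarrow> segre_veronese m n" "r \<in> linear_span ?I (p ` {..<s})" by blast
      have "\<forall>i\<in>{..<s}. \<exists>x y. p i = proj_point (sv_map m n x y)"
        using p(1) unfolding segre_veronese_def by fastforce
      then obtain x y where xy: "\<And>i. i < s \<Longrightarrow> p i = proj_point (sv_map m n (x i) (y i))"
        by (metis lessThan_iff)
      have "\<Union>(p ` {..<s}) = (\<Union>i<s. proj_point (sv_map m n (x i) (y i)))" using xy by auto
      then have "z \<in> cfun.span (\<Union>i<s. proj_point (sv_map m n (x i) (y i)))"
        using p(2) z unfolding linear_span_def by auto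
      from span_proj_points[OF this] obtain a where
        "z = (\<lambda>b. \<Sum>i<s. a i * sv_map m n (x i) (y i) b)" by blast
      then have "z = sv_sum m n s (\<lambda>i k. a i * x i k) y" by (simp add: sv_sum_def sv_map_scale)
      then show "F z = 0" using 0 by simp
    qed
  qed
qed

lemma tan_vec_swap: "tan_vec u v b (k, p, l) = tan_vec u v b (k, l, p)"
  by (cases b; cases "snd b") (auto simp: tan_vec_def)

text \<open>
  One half of Terracini's lemma. The value of \<open>sv_sum\<close> at \<open>(u, v)\<close> is itself a
  combination of the tangent vectors, because the image is a cone; exchanging it for the tangent
  vector of a direction \<open>b0\<close> that occurs in this combination leaves one parameter less than
  the number of tangent vectors, as \<open>krull_dim_ge_parameters\<close> requires.
\<close>
lemma krull_dim_ge_of_tangent_indep: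
  assumes n: "n \<ge> 1" and s: "s \<ge> 1" and S: "S \<subseteq> proj_space (sv_index m n)"
    and ti: "tangent_indep m (n + 1) s u v \<kappa>" and \<kappa>: "\<And>i. i < s \<Longrightarrow> \<kappa> i < n + 1"
    and inS: "\<And>x y. sv_sum m n s x y \<noteq> (\<lambda>_. 0) \<Longrightarrow> proj_point (sv_sum m n s x y) \<in> S"
  shows "enat (s * (m + n + 1) - 1) \<le> krull_dim (subtopology (zariski (sv_index m n)) S)"
proof -
  let ?I = "sv_index m n"
  define B where "B = tan_index m (n + 1) s \<kappa>"
  have B: "finite B" unfolding B_def by (rule finite_tan_index)
  have cardB: "card B = s * (m + n + 1)"
  proof -
    have "card B = (\<Sum>i<s. card ({..m} <+> ({..<n + 1} - {\<kappa> i})))"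
      unfolding B_def tan_index_def by (rule card_SigmaI) auto
    also have "\<dots> = (\<Sum>i<s. m + n + 1)"
      using \<kappa> by (intro sum.cong) (auto simp: card_Plus card_Diff_subset)
    finally show ?thesis by simp
  qed
  have "\<exists>a\<le>m. u 0 a \<noteq> 0"
  proof (rule ccontr)
    assume u0: "\<not> (\<exists>a\<le>m. u 0 a \<noteq> 0)"
    define p0 where "p0 = (if \<kappa> 0 = 0 then 1 else 0 :: nat)"
    define y :: "nat \<Rightarrow> nat \<Rightarrow> complex" where "y i p = (if i = 0 \<and> p = p0 then 1 else 0)" for i p
    have "y 0 p0 = 0"
    proof (rule tangent_indepD(2)[OF ti, where x = "\<lambda>_ _. 0"])
      show "y i (\<kappa> i) = 0" if "i < s" for i by (cases "i = 0") (auto simp: y_def p0_def)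
      show "tangent_sum s u v (\<lambda>_ _. 0) y k p l = 0" if "k \<le> m" for k p l
        unfolding tangent_sum_def using u0 that by (intro sum.neutral) (auto simp: y_def)
    qed (use s n in \<open>auto simp: p0_def\<close>)
    then show False by (simp add: y_def)
  qed
  then obtain a0 where a0: "a0 \<le> m" "u 0 a0 \<noteq> 0" by blast
  define b0 :: "nat \<times> (nat + nat)" where "b0 = (0, Inl a0)"
  have b0: "b0 \<in> B" using a0 s by (auto simp: b0_def B_def tan_index_def)
  define K where "K = s * (m + n + 1) - 1"
  have cardB': "card (B - {b0}) = K" using cardB b0 B by (simp add: K_def)
  obtain e where e: "bij_betw e {..<K} (B - {b0})"
    using ex_bij_betw_nat_finite[of "B - {b0}"] B cardB' by (auto simp: atLeast0LessThan)
  define e' where "e' = inv_into {..<K} e"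
  have e'e: "e' (e l) = l" if "l < K" for l
    using e that unfolding e'_def bij_betw_def by (auto intro: inv_into_f_f)
  have e'K: "e' b < K" "e (e' b) = b" if "b \<in> B - {b0}" for b
    using e that unfolding e'_def bij_betw_def
    by (metis inv_into_into lessThan_iff) (metis e that bij_betw_inv_into_right)
  have reindex: "(\<Sum>l<K. f l (e l)) = (\<Sum>b\<in>B - {b0}. f (e' b) b)" for f :: "nat \<Rightarrow> nat \<times> (nat + nat) \<Rightarrow> complex"
    using sum.reindex_bij_betw[OF e, of "\<lambda>b. f (e' b) b"] e'e by simp
  define P where "P l = (case l of 0 \<Rightarrow> sv_sum m n s u v | Suc l \<Rightarrow> tan_vec u v (e l))" for l
  define coef where "coef = (\<lambda>(i, b). case b of Inl a \<Rightarrow> u i a | Inr (r :: nat) \<Rightarrow> 0)"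
  have coef: "coef (i, Inl a) = u i a" "coef (i, Inr r) = 0" for i a r
    by (simp_all add: coef_def)
  have sum_tan: "(\<Sum>b\<in>B. c b * tan_vec u v b (k, p, l))
      = tangent_sum s u v (\<lambda>i a. c (i, Inl a)) (\<lambda>i r. if r = \<kappa> i then 0 else c (i, Inr r)) k p l"
    if "(k, p, l) \<in> ?I" for c k p l
    unfolding B_def using that by (intro sum_tan_vec) (auto simp: sv_index_def)
  have P0: "sv_sum m n s u v idx = (\<Sum>b\<in>B. coef b * tan_vec u v b idx)" if "idx \<in> ?I" for idx
  proof -
    obtain k p l where kpl: "idx = (k, p, l)" by (cases idx) auto
    show ?thesis
      using that unfolding kpl by (simp add: sum_tan sv_sum_apply tangent_sum_def coef cong: if_cong)
  qed
  have indep: "fam_indep {..K} ?I P"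
    unfolding fam_indep_def
  proof (intro allI impI ballI)
    fix c l0 assume 0: "\<forall>idx\<in>?I. (\<Sum>l\<le>K. c l * P l idx) = 0" and l0: "l0 \<in> {..K}"
    define c' where "c' b = (if b = b0 then 0 else c (Suc (e' b))) + c 0 * coef b" for b
    have split: "(\<Sum>b\<in>B. c' b * tan_vec u v b idx) = (\<Sum>l\<le>K. c l * P l idx)" if "idx \<in> ?I" for idx
    proof -
      have "(\<Sum>l\<le>K. c l * P l idx) = c 0 * sv_sum m n s u v idx + (\<Sum>l<K. c (Suc l) * tan_vec u v (e l) idx)"
        by (subst sum.atMost_shift) (simp add: P_def)
      also have "(\<Sum>l<K. c (Suc l) * tan_vec u v (e l) idx)
          = (\<Sum>b\<in>B - {b0}. c (Suc (e' b)) * tan_vec u v b idx)"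
        by (rule reindex)
      also have "\<dots> = (\<Sum>b\<in>B. (if b = b0 then 0 else c (Suc (e' b))) * tan_vec u v b idx)"
        using B by (intro sum.mono_neutral_cong_left) auto
      finally show ?thesis
        by (simp add: P0[OF that] c'_def distrib_right sum.distrib sum_distrib_left mult.assoc)
    qed
    have c'0: "c' b = 0" if "b \<in> B" for b
    proof (rule fam_indepD[where c = c', OF ti[unfolded tangent_indep_iff_fam_indep, folded B_def] _ that])
      fix j :: "nat \<times> nat \<times> nat" assume j: "j \<in> {..m} \<times> {..<n + 1} \<times> {..<n + 1}"
      obtain k p l where kpl: "j = (k, p, l)" by (cases j) auto
      have "(k, p, l) \<in> ?I \<or> (k, l, p) \<in> ?I" using j by (auto simp: kpl sv_index_def)
      then show "(\<Sum>b\<in>B. c' b * tan_vec u v b j) = 0"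
      proof
        assume "(k, p, l) \<in> ?I"
        then show ?thesis using split[of "(k, p, l)"] 0 by (simp add: kpl)
      next
        assume "(k, l, p) \<in> ?I"
        then have "(\<Sum>b\<in>B. c' b * tan_vec u v b (k, l, p)) = 0" using split[of "(k, l, p)"] 0 by simp
        then show ?thesis unfolding kpl tan_vec_swap[of u v _ k p l] .
      qed
    qed
    have "c 0 = 0" using c'0[OF b0] a0 by (simp add: c'_def coef_def b0_def)
    moreover have "c (Suc l) = 0" if "l < K" for l
    proof -
      have el: "e l \<in> B - {b0}" using e that by (auto simp: bij_betw_def)
      then show ?thesis using c'0[of "e l"] \<open>c 0 = 0\<close> e'e[OF that] by (auto simp: c'_def)
    qed
    ultimately show "c l0 = 0" using l0 by (cases l0) auto
  qed
  define cw where "cw w b = (if b \<in> B - {b0} then w (e' b) else 0)" for w :: "nat \<Rightarrow> complex" and b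
  define dx where "dx w i k = cw w (i, Inl k)" for w i k
  define dy where "dy w i p = cw w (i, Inr p)" for w i p
  define \<Psi> where "\<Psi> w = sv_sum m n s (\<lambda>i k. u i k + dx w i k) (\<lambda>i p. v i p + dy w i p)" for w
  define Q where "Q = (\<lambda>(k, p, l) w. \<Sum>i<s. u i k * (dy w i p * dy w i l)
      + v i p * (dx w i k * dy w i l) + v i l * (dx w i k * dy w i p) + dx w i k * dy w i p * dy w i l)"
  have "enat K \<le> krull_dim (subtopology (zariski ?I) S)"
  proof (rule krull_dim_ge_parameters[OF finite_sv_index S _ _ _ indep, where \<Psi> = \<Psi> and Q = Q and D = 3])
    show "\<Psi> w \<in> coord_space ?I" for w unfolding \<Psi>_def by (rule sv_sum_coord_space)
    show "proj_point (\<Psi> w) \<in> S" if "\<Psi> w \<noteq> (\<lambda>_. 0)" for w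
      using that unfolding \<Psi>_def by (rule inS)
    show "\<Psi> w idx = P 0 idx + (\<Sum>l<K. w l * P (Suc l) idx) + Q idx w" if idx: "idx \<in> ?I" for w idx
    proof -
      obtain k p l where kpl: "idx = (k, p, l)" by (cases idx) auto
      have "(\<Sum>l<K. w l * P (Suc l) idx) = (\<Sum>b\<in>B - {b0}. w (e' b) * tan_vec u v b idx)"
        using reindex[of "\<lambda>l b. w l * tan_vec u v b idx"] by (simp add: P_def)
      also have "\<dots> = (\<Sum>b\<in>B. cw w b * tan_vec u v b idx)"
        using B by (intro sum.mono_neutral_cong_left) (auto simp: cw_def)
      also have "\<dots> = tangent_sum s u v (dx w) (\<lambda>i r. if r = \<kappa> i then 0 else dy w i r) k p l"
        using sum_tan[of k p l "cw w"] idx by (simp add: kpl dx_def[abs_def] dy_def cong: if_cong)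
      also have "(\<lambda>i r. if r = \<kappa> i then 0 else dy w i r) = dy w"
        by (auto simp: fun_eq_iff dy_def cw_def B_def tan_index_def)
      finally have lin: "(\<Sum>l<K. w l * P (Suc l) idx) = tangent_sum s u v (dx w) (dy w) k p l" .
      show ?thesis
        unfolding lin using idx
        by (simp add: kpl \<Psi>_def P_def Q_def sv_sum_apply tangent_sum_def
            sum.distrib[symmetric] algebra_simps)
    qed
    show "Q idx \<in> box_polys {..<K} 3 2" if "idx \<in> ?I" for idx
    proof -
      obtain k p l where kpl: "idx = (k, p, l)" by (cases idx) auto
      have cw: "(\<lambda>w. cw w b) \<in> box_polys {..<K} 1 1" for b
        using e'K[of b] box_polys_var[of "{..<K}" "e' b"] box_polys_zero by (cases "b \<in> B - {b0}") (auto simp: cw_def)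
      have dx: "(\<lambda>w. dx w i k) \<in> box_polys {..<K} 1 1" and dy: "(\<lambda>w. dy w i k) \<in> box_polys {..<K} 1 1" for i k
        unfolding dx_def dy_def by (rule cw)+
      have two: "(\<lambda>w. f w * g w) \<in> box_polys {..<K} 3 2"
        if "f \<in> box_polys {..<K} 1 1" "g \<in> box_polys {..<K} 1 1" for f g
        by (rule box_polys_mono[OF box_polys_mult[OF that]]) auto
      have three: "(\<lambda>w. f w * g w * h w) \<in> box_polys {..<K} 3 2"
        if "f \<in> box_polys {..<K} 1 1" "g \<in> box_polys {..<K} 1 1" "h \<in> box_polys {..<K} 1 1" for f g h
        by (rule box_polys_mono[OF box_polys_mult[OF box_polys_mult[OF that(1,2)] that(3)]]) auto
      have "Q (k, p, l) = (\<lambda>w. \<Sum>i<s. u i k * (dy w i p * dy w i l)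
        + v i p * (dx w i k * dy w i l) + v i l * (dx w i k * dy w i p) + dx w i k * dy w i p * dy w i l)"
        by (simp add: Q_def)
      also have "\<dots> \<in> box_polys {..<K} 3 2"
        by (intro box_polys_sum box_polys_add box_polys_scale two three dx dy)
      finally show ?thesis by (simp add: kpl)
    qed
  qed
  then show ?thesis by (simp add: K_def)
qed

lemma proj_point_sv_map_in_segre_veronese:
  assumes "sv_map m n x y \<noteq> (\<lambda>_. 0)"
  shows "proj_point (sv_map m n x y) \<in> segre_veronese m n"
proof -
  define x' where "x' k = (if k \<le> m then x k else 0)" for k
  define y' where "y' k = (if k \<le> n then y k else 0)" for k
  have eq: "sv_map m n x y = sv_map m n x' y'"
    by (auto simp: sv_map_def fun_eq_iff sv_index_def x'_def y'_def)
  have "sv_map m n (\<lambda>_. 0) y' = (\<lambda>_. 0)" "sv_map m n x' (\<lambda>_. 0) = (\<lambda>_. 0)"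
    by (auto simp: sv_map_def fun_eq_iff)
  then have "x' \<noteq> (\<lambda>_. 0)" "y' \<noteq> (\<lambda>_. 0)" using assms unfolding eq by auto
  moreover have "x' \<in> coord_space {..m}" "y' \<in> coord_space {..n}"
    by (auto simp: coord_space_def x'_def y'_def)
  ultimately have "proj_point x' \<in> proj_space {..m}" "proj_point y' \<in> proj_space {..n}"
    by (auto intro: proj_point_in_proj_space)
  then show ?thesis unfolding segre_veronese_def eq by blast
qed

lemma proj_dim_segre_veronese:
  assumes n: "n \<ge> 1"
  shows "proj_dim (sv_index m n) (segre_veronese m n) = enat (m + n)"
proof -
  define u :: "nat \<Rightarrow> nat \<Rightarrow> complex" where "u i k = (if k = 0 then 1 else 0)" for i k
  have "tangent_indep m (n + 1) 1 u u (\<lambda>_. 0)"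
    unfolding tangent_indep_def
  proof (intro allI impI)
    fix x y :: "nat \<Rightarrow> nat \<Rightarrow> complex" and i :: nat
    assume y: "\<forall>i<1. y i 0 = 0" and i: "i < 1"
      and 0: "\<forall>k\<le>m. \<forall>p<n + 1. \<forall>l<n + 1. tangent_sum 1 u u x y k p l = 0"
    have x0: "x 0 k = 0" if "k \<le> m" for k
      using 0[rule_format, of k 0 0] y that by (simp add: tangent_sum_def u_def split: if_splits)
    have "y 0 p = 0" if "p < n + 1" for p
      using 0[rule_format, of 0 0 p] y that x0[of 0] by (simp add: tangent_sum_def u_def split: if_splits)
    then show "(\<forall>k\<le>m. x i k = 0) \<and> (\<forall>p<n + 1. y i p = 0)" using x0 i by simp
  qed
  then have "enat (1 * (m + n + 1) - 1) \<le> krull_dim (subtopology (zariski (sv_index m n)) (segre_veronese m n))"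
  proof (rule krull_dim_ge_of_tangent_indep[OF n order_refl segre_veronese_subset])
    fix x y assume "sv_sum m n 1 x y \<noteq> (\<lambda>_. 0)"
    moreover have "sv_sum m n 1 x y = sv_map m n (x 0) (y 0)" by (simp add: sv_sum_def)
    ultimately show "proj_point (sv_sum m n 1 x y) \<in> segre_veronese m n"
      using proj_point_sv_map_in_segre_veronese by metis
  qed simp
  then show ?thesis
    unfolding proj_dim_def using krull_dim_segre_veronese_le[of m n] by (intro antisym) auto
qed

lemma span_sum_functions:
  "(\<And>i. i \<in> A \<Longrightarrow> f i \<in> cfun.span T) \<Longrightarrow> (\<lambda>b. \<Sum>i\<in>A. f i b) \<in> cfun.span T"
proof (induction A rule: infinite_finite_induct)
  case (insert a A)
  then have "f a + (\<lambda>b. \<Sum>i\<in>A. f i b) \<in> cfun.span T" by (intro cfun.span_add) auto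
  then show ?case using insert by (simp add: plus_fun_def)
qed (use cfun.span_zero in \<open>auto simp: zero_fun_def\<close>)

lemma sv_sum_in_secant_variety:
  assumes nz: "sv_sum m n s x y \<noteq> (\<lambda>_. 0)"
  shows "proj_point (sv_sum m n s x y) \<in> secant_variety (sv_index m n) s (segre_veronese m n)"
proof -
  let ?I = "sv_index m n" and ?z = "sv_sum m n s x y"
  define d :: "nat \<Rightarrow> complex" where "d k = (if k = 0 then 1 else 0)" for k
  have d: "sv_map m n d d \<noteq> (\<lambda>_. 0)"
  proof
    assume "sv_map m n d d = (\<lambda>_. 0)"
    then have "sv_map m n d d (0, 0, 0) = 0" by simp
    then show False by (simp add: sv_map_def sv_index_def d_def)
  qed
  define p where "p i = proj_point (if sv_map m n (x i) (y i) = (\<lambda>_. 0) then sv_map m n d d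
      else sv_map m n (x i) (y i))" for i
  have p: "p \<in> {..<s} \<rightarrow> segre_veronese m n"
    using d by (auto simp: p_def intro: proj_point_sv_map_in_segre_veronese)
  have mem: "sv_map m n (x i) (y i) \<in> cfun.span (\<Union>(p ` {..<s}))" if "i < s" for i
  proof (cases "sv_map m n (x i) (y i) = (\<lambda>_. 0)")
    case True
    then show ?thesis using cfun.span_zero by (simp add: zero_fun_def)
  next
    case False
    then have "sv_map m n (x i) (y i) \<in> p i" by (simp add: p_def self_in_proj_point)
    then show ?thesis using that by (intro cfun.span_base) auto
  qed
  have z: "?z \<in> cfun.span (\<Union>(p ` {..<s}))"
    unfolding sv_sum_def using mem by (intro span_sum_functions) auto
  have "proj_point ?z \<subseteq> cfun.span (\<Union>(p ` {..<s}))"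
    using cfun.span_scale[OF z] by (auto simp: proj_point_def)
  moreover have "proj_point ?z \<in> proj_space ?I"
    by (rule proj_point_in_proj_space[OF sv_sum_coord_space nz])
  ultimately have "proj_point ?z \<in> (\<Union>p\<in>{..<s} \<rightarrow> segre_veronese m n. linear_span ?I (p ` {..<s}))"
    using p by (auto simp: linear_span_def)
  moreover have "(\<Union>p\<in>{..<s} \<rightarrow> segre_veronese m n. linear_span ?I (p ` {..<s})) \<subseteq> topspace (zariski ?I)"
    by (auto simp: linear_span_def topspace_zariski)
  ultimately show ?thesis
    unfolding secant_variety_def using closure_of_subset by blast
qed

lemma proj_dim_secant_variety:
  assumes "n \<ge> 1" "s \<ge> 1" "tangent_indep m (n + 1) s u v \<kappa>" "\<And>i. i < s \<Longrightarrow> \<kappa> i < n + 1"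
  shows "proj_dim (sv_index m n) (secant_variety (sv_index m n) s (segre_veronese m n))
    = enat (s * (m + n + 1) - 1)"
  unfolding proj_dim_def
proof (rule antisym)
  have "secant_variety (sv_index m n) s (segre_veronese m n) \<subseteq> proj_space (sv_index m n)"
    unfolding secant_variety_def using closure_of_subset_topspace by (metis topspace_zariski)
  from krull_dim_ge_of_tangent_indep[OF assms(1,2) this assms(3,4) sv_sum_in_secant_variety]
  show "enat (s * (m + n + 1) - 1) \<le> krull_dim (subtopology (zariski (sv_index m n))
      (secant_variety (sv_index m n) s (segre_veronese m n)))" by blast
qed (rule krull_dim_secant_variety_le[OF assms(2)])

section \<open>The number of points\<close>

text \<open>
  Since \<open>(n + 1) * (n + 2) = (m + n + 1) * (n + 2 - m) + m * (m - 1)\<close>, the fraction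
  whose integer part is \<open>q m n\<close> exceeds \<open>(m + 1) * (n + 2 - m) / 2\<close> by less than one half
  when \<open>n\<close> is large.
\<close>
lemma q_eq_half:
  assumes m: "m \<ge> 1" and n: "n \<ge> m" "m + n + 1 > (m + 1) * (m * (m - 1))"
  shows "q m n = ((m + 1) * (n + 2 - m)) div 2"
proof -
  define M D t h where "M = m + 1" and "D = m + n + 1" and "t = n + 2 - m" and "h = (M * t) div 2"
  define C where "C = (n + 2) choose 2"
  have "2 * C = (n + 2) * (n + 1)"
  proof -
    have "even ((n + 2) * (n + 1))" by simp
    then show ?thesis by (simp add: C_def choose_two)
  qed
  also have "\<dots> = D * t + m * (m - 1)"
  proof -
    obtain r j where "n = m + r" "m = Suc j" using n(1) m by (metis le_Suc_ex One_nat_def Suc_le_D)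
    then show ?thesis by (simp add: D_def t_def algebra_simps)
  qed
  finally have "M * (2 * C) = M * (D * t + m * (m - 1))" by (rule arg_cong)
  then have "2 * (M * C) = D * (M * t) + M * (m * (m - 1))"
    by (simp only: distrib_left mult.left_commute)
  moreover have "M * (m * (m - 1)) < D" using n(2) by (simp add: M_def D_def)
  moreover have h: "2 * h \<le> M * t" "M * t \<le> 2 * h + 1" unfolding h_def by linarith+
  moreover have "D * (2 * h) \<le> D * (M * t)" "D * (M * t) \<le> D * (2 * h + 1)"
    using h by (intro mult_left_mono; simp)+
  then have "2 * (D * h) \<le> D * (M * t)" "D * (M * t) \<le> 2 * (D * h) + D"
    by (simp_all add: algebra_simps)
  ultimately have "D * h \<le> M * C" "M * C < D * h + D" by linarith+
  then have "(M * C) div D = h" by (intro div_nat_eqI) (simp_all add: mult.commute add.commute)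
  then show ?thesis by (simp add: q_def M_def C_def D_def h_def t_def)
qed

theorem theorem1p1:
  fixes m :: nat
  assumes "m \<ge> 1"
  shows "\<exists>n0. \<forall>n\<ge>n0. has_expected_secant_dim (sv_index m n) (q m n) (segre_veronese m n)"
proof (intro exI allI impI)
  fix n assume n0: "n \<ge> m + (m + 1) * (m * (m - 1))"
  then have n: "n \<ge> m" "n \<ge> 1" using assms by auto
  define t where "t = n + 2 - m"
  have N: "t + m - 1 = n + 1" using n by (simp add: t_def)
  have q: "q m n = ((m + 1) * t) div 2"
    unfolding t_def using n0 by (intro q_eq_half assms) auto
  have "1 \<le> t" using n by (simp add: t_def)
  then have "2 * 1 \<le> (m + 1) * t" using assms by (intro mult_le_mono) auto
  then have s: "q m n \<ge> 1" unfolding q by simp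
  obtain u v \<kappa> where "tangent_indep m (n + 1) (q m n) u v \<kappa>" "\<And>i. i < q m n \<Longrightarrow> \<kappa> i < n + 1"
    using exists_tangent_indep[OF assms, of t] unfolding N q[symmetric] by blast
  from proj_dim_secant_variety[OF n(2) s this]
  have "proj_dim (sv_index m n) (secant_variety (sv_index m n) (q m n) (segre_veronese m n))
      = enat (q m n * (m + n + 1) - 1)" .
  moreover have "q m n * (m + n + 1) \<le> card (sv_index m n)"
    unfolding card_sv_index q_def by (rule div_times_less_eq_dividend)
  then have "expected_secant_dim (sv_index m n) (q m n) (segre_veronese m n)
      = enat (q m n * (m + n + 1) - 1)"
  proof -
    assume le: "q m n * (m + n + 1) \<le> card (sv_index m n)"
    have "enat (q m n) * (enat (m + n) + 1) - 1 = enat (q m n * (m + n + 1) - 1)"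
      by (simp add: one_enat_def)
    moreover have "enat (q m n * (m + n + 1) - 1) \<le> enat (card (sv_index m n) - 1)"
      unfolding enat_ord_simps using le by (rule diff_le_mono)
    ultimately show ?thesis
      unfolding expected_secant_dim_def proj_dim_segre_veronese[OF n(2)] by (metis min_absorb2)
  qed
  ultimately show "has_expected_secant_dim (sv_index m n) (q m n) (segre_veronese m n)"
    unfolding has_expected_secant_dim_def by simp
qed

end
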